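(* Let $X$ be a Polish space, let $P$ be a point process on $X$ of first order, let $n\geq 2$, and let $q_1,\ldots,q_n\in(0,1)$ be such that $q_1+\ldots+q_n=1$. Let $q$ denote the law on $\{1,\ldots,n\}$ with $q(\{m\})=q_m$. Then $P$ is a Poisson point process if and only if $$S^n_q(P)=\Gamma_{q_1}(P)\otimes\ldots\otimes\Gamma_{q_n}(P).$$
   Context: $X$ is a Polish space, with bounded sets understood with respect to a fixed complete metric generating its topology; $\mathcal{B}(X)$ denotes its Borel sets. $\mathcal{M}(X)$ is the space of locally finite (Radon) measures on $X$, i.e. Borel measures finite on bounded Borel sets, equipped with the vague topology, for which it is Polish. $\mathcal{M}^{\cdot\cdot}(X)\subset\mathcal{M}(X)$ is the closed (hence measurable) subspace of Radon point measures (integer-valued locally finite measures; multiple points are allowed). A point process on $X$ is a probability law $P$ on $\mathcal{M}^{\cdot\cdot}(X)$. Its first moment measure is $\nu_P(B)=\int_{\mathcal{M}^{\cdot\cdot}(X)} \mu(B)\,P(d\mu)$, $B\in\mathcal{B}(X)$. $P$ is of first order if $\nu_P\in\mathcal{M}(X)$. For $\varrho\in\mathcal{M}(X)$ (atoms allowed), $\Pi_\varrho$ denotes the Poisson point process with first moment measure (intensity) $\varrho$, i.e. the point process with Laplace transform $\int e^{-\mu(f)}\,\Pi_\varrho(d\mu)=\exp\left(-\int_X (1-e^{-f})\,d\varrho\right)$ for all non-negative bounded measurable $f$ on $X$ with support contained in a bounded set. A point process $P$ is a Poisson point process if $P=\Pi_\varrho$ for some $\varrho\in\mathcal{M}(X)$.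 For $s\in(0,1)$ and $\mu\in\mathcal{M}^{\cdot\cdot}(X)$, the independent $s$-thinning of $\mu$ is the point process $$T^\mu_s = \mathop{\ast}_{x\in\mu}\left((1-s)\,\delta_{\mathbf{0}}+s\,\delta_{\delta_x}\right)^{\ast\mu(\{x\})},$$ where $\ast$ is convolution of point processes (law of the sum of independent point processes), $\mathbf{0}$ is the zero measure on $X$, and "$x\in\mu$" means that the convolution is over the set $\{y\in X : \mu(\{y\})>0\}$. That is, each point of $\mu$, counted with multiplicity, is independently kept with probability $s$ and deleted with probability $1-s$. The independent $s$-thinning of a point process $P$ is $\Gamma_s(P)=\int_{\mathcal{M}^{\cdot\cdot}(X)} P(d\mu)\,T^\mu_s$. For $\mu\in\mathcal{M}^{\cdot\cdot}(X)$ and $s_1,\ldots,s_{n-1}\in(0,1)$, the law $T^\mu_{(s_1,\ldots,s_{n-1})}$ on the $n$-fold product $\mathcal{M}^{\cdot\cdot}(X)\times\cdots\times\mathcal{M}^{\cdot\cdot}(X)$ is defined by $$T^\mu_{(s_1,\ldots,s_{n-1})}(h)=\int T^\mu_{s_1}(d\kappa_1)\,T^{\mu-\kappa_1}_{s_2}(d\kappa_2)\cdots T^{\mu-(\kappa_1+\ldots+\kappa_{n-2})}_{s_{n-1}}(d\kappa_{n-1})\;h\bigl(\kappa_1,\ldots,\kappa_{n-1},\mu-(\kappa_1+\ldots+\kappa_{n-1})\bigr)$$ for all non-negative measurable $h$ on the product space (the differences are almost surely in $\mathcal{M}^{\cdot\cdot}(X)$). Given $q_1,\ldots,q_n\in(0,1)$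 summing to one and $q$ the law on $\{1,\ldots,n\}$ with $q(\{m\})=q_m$, put $$s_m=\frac{q_m}{q_m+\ldots+q_n},\qquad 1\le m\le n$$ (so $s_n=1$, and under $T^\mu_{(s_1,\ldots,s_{n-1})}$ each point of $\mu$ belongs to the $m$-th collection with probability $q_m$). The multi-splitting law is $$S^n_q(P)=\int_{\mathcal{M}^{\cdot\cdot}(X)} P(d\mu)\,T^\mu_{(s_1,\ldots,s_{n-1})}.$$ *)

theory Defs
  imports "HOL-Probability.Probability"
begin

section \<open>Locally finite measures, point measures and point processes\<close>

text \<open>
  The Polish space \<open>X\<close> is a type of class \<^class>\<open>polish_space\<close>; its metric is the fixed complete
  metric, so that \<^const>\<open>bounded\<close> is boundedness with respect to that metric.
\<close>

definition locally_finite_measures :: "'a::polish_space measure set" where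
  "locally_finite_measures =
     {\<mu>. sets \<mu> = sets borel \<and> (\<forall>B\<in>sets borel. bounded B \<longrightarrow> emeasure \<mu> B < \<infinity>)}"

text \<open>
  The coarsest topology making \<open>\<mu> \<mapsto> \<integral> f d\<mu>\<close> continuous for every bounded continuous \<open>f\<close> that
  vanishes outside a bounded set.
\<close>

definition vague_topology :: "'a::polish_space measure topology" where
  "vague_topology = topology_generated_by
     {{\<mu> \<in> locally_finite_measures. (\<integral>x. f x \<partial>\<mu>) \<in> U} | (f :: 'a \<Rightarrow> real) U.
        continuous_on UNIV f \<and> bounded (range f) \<and> bounded {x. f x \<noteq> 0} \<and> open U}"

definition vague_borel :: "'a::polish_space measure measure" where
  "vague_borel = sigma locally_finite_measures {U. openin vague_topology U}"

definition point_measures :: "'a::polish_space measure set" where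
  "point_measures =
     {\<mu> \<in> locally_finite_measures. \<forall>B\<in>sets borel. bounded B \<longrightarrow> emeasure \<mu> B \<in> \<nat>}"

definition point_borel :: "'a::polish_space measure measure" where
  "point_borel = restrict_space vague_borel point_measures"

definition point_process :: "'a::polish_space measure measure \<Rightarrow> bool" where
  "point_process P \<longleftrightarrow> prob_space P \<and> sets P = sets point_borel"

definition first_moment :: "'a::polish_space measure measure \<Rightarrow> 'a measure" where
  "first_moment P = measure_of UNIV (sets borel) (\<lambda>B. \<integral>\<^sup>+\<mu>. emeasure \<mu> B \<partial>P)"

definition first_order :: "'a::polish_space measure measure \<Rightarrow> bool" where
  "first_order P \<longleftrightarrow> first_moment P \<in> locally_finite_measures"


section \<open>Poisson point processes\<close>

definition has_poisson_law :: "'a::polish_space measure \<Rightarrow> 'a measure measure \<Rightarrow> bool" where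
  "has_poisson_law \<rho> P \<longleftrightarrow> point_process P \<and>
     (\<forall>f :: 'a \<Rightarrow> real. f \<in> borel_measurable borel \<longrightarrow> (\<forall>x. 0 \<le> f x) \<longrightarrow> bounded (range f) \<longrightarrow>
        bounded {x. f x \<noteq> 0} \<longrightarrow>
        (\<integral>\<mu>. exp (- (\<integral>x. f x \<partial>\<mu>)) \<partial>P) = exp (- (\<integral>x. 1 - exp (- f x) \<partial>\<rho>)))"

definition poisson_process :: "'a::polish_space measure measure \<Rightarrow> bool" where
  "poisson_process P \<longleftrightarrow> (\<exists>\<rho>\<in>locally_finite_measures. has_poisson_law \<rho> P)"


section \<open>Sums, convolutions and differences\<close>

definition superpose :: "'i set \<Rightarrow> ('i \<Rightarrow> 'a::polish_space measure) \<Rightarrow> 'a measure" where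
  "superpose I \<mu> = measure_of UNIV (sets borel) (\<lambda>B. \<integral>\<^sup>+i. emeasure (\<mu> i) B \<partial>count_space I)"

text \<open>
  The law of the sum of independent point processes with laws \<open>Q i\<close>. The index set may be
  infinite; the convolution then makes sense when the sum is almost surely locally finite, and
  the value on the exceptional null set is immaterial (here: the zero measure).
\<close>

definition convolve ::
  "'i set \<Rightarrow> ('i \<Rightarrow> 'a::polish_space measure measure) \<Rightarrow> 'a measure measure" where
  "convolve I Q = distr (PiM I Q) point_borel
     (\<lambda>\<omega>. if superpose I \<omega> \<in> point_measures then superpose I \<omega> else null_measure borel)"

text \<open>
  The difference \<open>\<mu> - \<kappa>\<close>. A setwise difference is meaningless on sets where both measures are
  infinite, so it is formed on bounded sets and extended by monotone limits. Subtraction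
  on \<^typ>\<open>ennreal\<close> is truncated; if \<open>\<kappa> \<le> \<mu>\<close> fails, the result is the positive part of \<open>\<mu> - \<kappa>\<close>.
\<close>

definition point_diff :: "'a::polish_space measure \<Rightarrow> 'a measure \<Rightarrow> 'a measure" where
  "point_diff \<mu> \<kappa> = measure_of UNIV (sets borel)
     (\<lambda>B. SUP C\<in>{C \<in> sets borel. bounded C \<and> C \<subseteq> B}. emeasure \<mu> C - emeasure \<kappa> C)"

lemma emeasure_superpose:
  fixes \<mu> :: "'i \<Rightarrow> 'a::polish_space measure"
  assumes "\<And>i. i \<in> I \<Longrightarrow> sets (\<mu> i) = sets borel" and B: "B \<in> sets borel"
  shows "emeasure (superpose I \<mu>) B = (\<integral>\<^sup>+i. emeasure (\<mu> i) B \<partial>count_space I)"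
  unfolding superpose_def
proof (rule emeasure_measure_of_sigma)
  show "sigma_algebra UNIV (sets (borel :: 'a measure))"
    using sets.sigma_algebra_axioms[of "borel :: 'a measure"] by simp
  show "positive (sets borel) (\<lambda>B. \<integral>\<^sup>+i. emeasure (\<mu> i) B \<partial>count_space I)"
    by (simp add: positive_def)
  show "countably_additive (sets borel) (\<lambda>B. \<integral>\<^sup>+i. emeasure (\<mu> i) B \<partial>count_space I)"
  proof (rule countably_additiveI)
    fix A :: "nat \<Rightarrow> 'a set"
    assume A: "range A \<subseteq> sets borel" "disjoint_family A"
    have "(\<Sum>n. \<integral>\<^sup>+i. emeasure (\<mu> i) (A n) \<partial>count_space I) =
        (\<integral>\<^sup>+i. (\<Sum>n. emeasure (\<mu> i) (A n)) \<partial>count_space I)"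
      by (rule nn_integral_suminf[symmetric]) simp
    also have "\<dots> = (\<integral>\<^sup>+i. emeasure (\<mu> i) (\<Union>n. A n) \<partial>count_space I)"
      using A assms(1) by (intro nn_integral_cong suminf_emeasure) simp_all
    finally show "(\<Sum>n. \<integral>\<^sup>+i. emeasure (\<mu> i) (A n) \<partial>count_space I) =
      (\<integral>\<^sup>+i. emeasure (\<mu> i) (\<Union>n. A n) \<partial>count_space I)" .
  qed
qed (rule B)

lemma point_diff_eqI:
  fixes \<mu> \<kappa> \<xi> :: "'a::polish_space measure"
  assumes "\<kappa> \<in> locally_finite_measures" "\<xi> \<in> locally_finite_measures"
    and sum: "\<And>B. B \<in> sets borel \<Longrightarrow> emeasure \<mu> B = emeasure \<kappa> B + emeasure \<xi> B"
  shows "point_diff \<mu> \<kappa> = \<xi>"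
proof -
  have \<xi>: "sets \<xi> = sets borel" and fin: "\<And>C. C \<in> sets borel \<Longrightarrow> bounded C \<Longrightarrow> emeasure \<kappa> C \<noteq> \<infinity>"
    using assms(1,2) by (auto simp: locally_finite_measures_def less_top)
  have *: "(SUP C\<in>{C \<in> sets borel. bounded C \<and> C \<subseteq> B}. emeasure \<mu> C - emeasure \<kappa> C) = emeasure \<xi> B"
    if B: "B \<in> sets borel" for B
  proof -
    let ?S = "{C \<in> sets borel. bounded C \<and> C \<subseteq> B}"
    define A where "A n = B \<inter> ball (undefined :: 'a) (real n)" for n
    have A: "A n \<in> ?S" for n
      using B by (simp add: A_def bounded_Int)
    have UA: "(\<Union>n. A n) = B"
    proof (intro set_eqI iffI)
      fix x assume "x \<in> B"
      moreover obtain n where "dist undefined x < real n"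
        using reals_Archimedean2 by blast
      ultimately show "x \<in> (\<Union>n. A n)"
        by (auto simp: A_def)
    qed (auto simp: A_def)
    have eq: "(SUP C\<in>?S. emeasure \<mu> C - emeasure \<kappa> C) = (SUP C\<in>?S. emeasure \<xi> C)"
      using sum fin by (intro SUP_cong refl) simp
    show ?thesis
      unfolding eq
    proof (rule antisym)
      show "(SUP C\<in>?S. emeasure \<xi> C) \<le> emeasure \<xi> B"
        using B \<xi> by (intro SUP_least emeasure_mono) auto
      have "emeasure \<xi> B = (SUP n. emeasure \<xi> (A n))"
        unfolding UA[symmetric]
        by (rule SUP_emeasure_incseq[symmetric])
          (use A \<xi> in \<open>auto simp: incseq_def A_def intro: less_le_trans\<close>)
      also have "\<dots> \<le> (SUP C\<in>?S. emeasure \<xi> C)"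
        using A by (intro SUP_least SUP_upper) auto
      finally show "emeasure \<xi> B \<le> (SUP C\<in>?S. emeasure \<xi> C)" .
    qed
  qed
  have "sigma_sets UNIV (sets (borel :: 'a measure)) = sets borel"
    using sets.sigma_sets_eq[of "borel :: 'a measure"] by simp
  then have "point_diff \<mu> \<kappa> = measure_of UNIV (sets borel) (emeasure \<xi>)"
    unfolding point_diff_def by (intro measure_of_eq) (simp_all add: *)
  also have "\<dots> = \<xi>"
    using measure_of_of_measure[of \<xi>] sets_eq_imp_space_eq[OF \<xi>] by (simp add: \<xi>)
  finally show ?thesis .
qed


section \<open>Independent thinning and multi-splitting\<close>

text \<open>The law \<open>(1 - s) \<delta>\<^sub>0 + s \<delta>\<^bsub>\<delta>\<^sub>x\<^esub>\<close> on point measures.\<close>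

definition site_law :: "real \<Rightarrow> 'a::polish_space \<Rightarrow> 'a measure measure" where
  "site_law s x = distr (measure_pmf (bernoulli_pmf s)) point_borel
     (\<lambda>b. if b then return borel x else null_measure borel)"

lemma space_point_borel: "space point_borel = point_measures"
  by (auto simp: point_borel_def vague_borel_def space_restrict_space space_measure_of_conv
      point_measures_def)

lemma null_measure_in_point_measures: "null_measure borel \<in> point_measures"
  by (simp add: point_measures_def locally_finite_measures_def)

lemma return_in_point_measures: "return borel x \<in> point_measures"
  by (auto simp: point_measures_def locally_finite_measures_def indicator_def)

lemma emeasure_site_law:
  assumes "0 \<le> s" "s \<le> 1" and A: "A \<in> sets point_borel"
  shows "emeasure (site_law s x) A =
    ennreal (1 - s) * indicator A (null_measure borel) + ennreal s * indicator A (return borel x)"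
proof -
  let ?g = "\<lambda>b. if b then return borel x else null_measure borel"
  have g: "?g \<in> measurable (measure_pmf (bernoulli_pmf s)) point_borel"
    by (simp add: space_point_borel null_measure_in_point_measures return_in_point_measures)
  have "emeasure (site_law s x) A = (\<integral>\<^sup>+b. indicator A (?g b) \<partial>measure_pmf (bernoulli_pmf s))"
    unfolding site_law_def
    using nn_integral_distr[OF g, of "indicator A"] A by simp
  then show ?thesis
    using assms(1,2) by (simp add: mult.commute add.commute)
qed

text \<open>For a point measure the mass \<open>\<mu> {x}\<close> is a natural number, so taking the floor loses nothing.\<close>

definition thin_kernel :: "real \<Rightarrow> 'a::polish_space measure \<Rightarrow> 'a measure measure" where
  "thin_kernel s \<mu> = convolve {x. emeasure \<mu> {x} > 0}
     (\<lambda>x. convolve {..<nat \<lfloor>measure \<mu> {x}\<rfloor>} (\<lambda>_. site_law s x))"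

definition thinning :: "real \<Rightarrow> 'a::polish_space measure measure \<Rightarrow> 'a measure measure" where
  "thinning s P = P \<bind> thin_kernel s"

text \<open>
  \<open>successive_thin s \<mu> m\<close> is the joint law of \<open>(\<kappa>\<^sub>1, \<dots>, \<kappa>\<^sub>m)\<close>, where given
  \<open>\<kappa>\<^sub>1, \<dots>, \<kappa>\<^sub>j\<close> the next component is an independent \<open>s\<^bsub>j+1\<^esub>\<close>-thinning of
  \<open>\<mu> - (\<kappa>\<^sub>1 + \<dots> + \<kappa>\<^sub>j)\<close>.
\<close>

primrec successive_thin ::
  "(nat \<Rightarrow> real) \<Rightarrow> 'a::polish_space measure \<Rightarrow> nat \<Rightarrow> (nat \<Rightarrow> 'a measure) measure" where
  "successive_thin s \<mu> 0 = return (PiM {1..0} (\<lambda>_. point_borel)) (\<lambda>_. undefined)"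
| "successive_thin s \<mu> (Suc m) = successive_thin s \<mu> m \<bind>
     (\<lambda>\<kappa>. distr (thin_kernel (s (Suc m)) (point_diff \<mu> (superpose {1..m} \<kappa>)))
        (PiM {1..Suc m} (\<lambda>_. point_borel)) (\<lambda>\<kappa>'. \<kappa>(Suc m := \<kappa>')))"

definition split_kernel ::
  "nat \<Rightarrow> (nat \<Rightarrow> real) \<Rightarrow> 'a::polish_space measure \<Rightarrow> (nat \<Rightarrow> 'a measure) measure" where
  "split_kernel n s \<mu> = distr (successive_thin s \<mu> (n - 1)) (PiM {1..n} (\<lambda>_. point_borel))
     (\<lambda>\<kappa>. \<kappa>(n := point_diff \<mu> (superpose {1..n - 1} \<kappa>)))"

definition multi_splitting ::
  "nat \<Rightarrow> (nat \<Rightarrow> real) \<Rightarrow> 'a::polish_space measure measure \<Rightarrow> (nat \<Rightarrow> 'a measure) measure" where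
  "multi_splitting n q P = P \<bind> split_kernel n (\<lambda>m. q m / (\<Sum>j=m..n. q j))"

end

(*
  The identity is read through Laplace functionals L(f) = E exp(-mu(f)). A thinning replaces e^(-f) by
  1 - q + q e^(-f), and the multi-splitting of P has joint functional L(-ln(sum_m q_m e^(-f_m))), so the
  Poisson direction is a computation. Conversely, put f_t = -ln(1 - t u) with u = 1 - e^(-f). Taking all
  f_m equal to f_t, the identity becomes L(f_t) = prod_m L(f_(q_m t)); hence psi(t) = -ln L(f_t) / t is
  the q-average of the values psi(q_m t). As P is of first order, psi(t) tends to nu(u) for t -> 0, where
  nu is the first moment measure, and averaging over ever smaller arguments forces psi(1) = nu(u).
*)

theory Submission
  imports Defs
begin

section \<open>Integrals against locally finite measures\<close>

text \<open>Two measure-theoretic obstacles shape the proof. Point processes live on the Borel sets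
  of the vague topology, whose given subbase is uncountable, while random measures are accessible
  through their values on sets. So this sigma-algebra is first shown to be generated by the counts
  on bounded Borel sets. Secondly, integrals against \<open>bind\<close> can be evaluated only for
  measurable kernels, but the thinning of \<mu> is a convolution over the atoms of \<mu>, an index
  set that varies with \<mu>. Its measurability is deduced from its explicit Laplace functional:
  counts are integers, so indicators of events are limits of combinations of exponentials of counts.
  The same argument shows that joint Laplace functionals determine laws. A thinning is always
  treated together with its remainder, since the next thinning acts on that remainder. In the
  converse, the limit of psi at 0 is a dominated convergence whose dominating function is integrable
  because \<open>P\<close> is of first order. Averaging forces psi(1) to equal this limit because
  some summand always deviates at least as much as the average, and the arguments shrink at least by
  the factor max q_m < 1.\<close>

definition bounded_support_fun :: "('a::polish_space \<Rightarrow> real) \<Rightarrow> bool" where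
  "bounded_support_fun f \<longleftrightarrow>
     f \<in> borel_measurable borel \<and> bounded (range f) \<and> bounded {x. f x \<noteq> 0}"

lemma locally_finite_measuresD:
  assumes "\<mu> \<in> locally_finite_measures"
  shows "sets \<mu> = sets borel" "space \<mu> = UNIV"
    and "bounded B \<Longrightarrow> emeasure \<mu> B < \<infinity>"
proof -
  show 1: "sets \<mu> = sets borel" using assms by (simp add: locally_finite_measures_def)
  show "space \<mu> = UNIV" using sets_eq_imp_space_eq[OF 1] by simp
  \<comment> \<open>Measurability of \<open>B\<close> need not be known: off the sigma-algebra
    \<open>emeasure\<close> takes the default value 0.\<close>
  show "emeasure \<mu> B < \<infinity>" if "bounded B"
    using that assms by (cases "B \<in> sets borel") (auto simp: locally_finite_measures_def emeasure_notin_sets)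
qed

lemma integrable_bounded_support_fun:
  fixes \<mu> :: "'a::polish_space measure"
  assumes \<mu>: "\<mu> \<in> locally_finite_measures" and f: "bounded_support_fun f"
  shows "integrable \<mu> f"
proof -
  obtain C where C: "\<And>x. norm (f x) \<le> C"
    using f by (auto simp: bounded_support_fun_def bounded_iff)
  have m[measurable]: "f \<in> borel_measurable borel" using f by (simp add: bounded_support_fun_def)
  have "{x. f x \<noteq> 0} \<in> sets borel" by measurable
  then show ?thesis
    using f C locally_finite_measuresD[OF \<mu>]
    by (intro integrableI_bounded_set[where A="{x. f x \<noteq> 0}" and B=C])
       (simp_all add: bounded_support_fun_def measurable_cong_sets[OF locally_finite_measuresD(1)[OF \<mu>] refl])
qed

text \<open>Continuity from below along balls about an arbitrary base point that exhaust the space.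
  It reduces questions about Borel sets to bounded ones, where all masses are finite.\<close>

lemma emeasure_eq_SUP_ball:
  fixes \<mu> :: "'a::polish_space measure"
  assumes [simp]: "sets \<mu> = sets borel" and [measurable]: "B \<in> sets borel"
  shows "emeasure \<mu> B = (SUP n::nat. emeasure \<mu> (B \<inter> ball undefined (real n)))"
proof -
  have 1: "incseq (\<lambda>n::nat. B \<inter> ball undefined (real n))"
    by (intro monoI Int_mono order_refl subset_ball) simp
  have 2: "range (\<lambda>n::nat. B \<inter> ball undefined (real n)) \<subseteq> sets \<mu>"
    by (rule image_subsetI) simp
  have 3: "(\<Union>n::nat. B \<inter> ball undefined (real n)) = B"
  proof (intro set_eqI iffI)
    fix x assume "x \<in> B"
    moreover obtain n where "dist undefined x < real n" using reals_Archimedean2 by blast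
    ultimately show "x \<in> (\<Union>n::nat. B \<inter> ball undefined (real n))" by auto
  qed auto
  show ?thesis
    using SUP_emeasure_incseq[OF 2 1] unfolding 3 by (rule sym)
qed

lemma measurable_emeasure_locally_finite:
  fixes K :: "'w \<Rightarrow> 'a::polish_space measure"
  assumes K: "\<And>x. x \<in> space M \<Longrightarrow> sets (K x) = sets borel"
    and ev: "\<And>B. B \<in> sets borel \<Longrightarrow> bounded B \<Longrightarrow> (\<lambda>x. emeasure (K x) B) \<in> borel_measurable M"
    and B: "B \<in> sets borel"
  shows "(\<lambda>x. emeasure (K x) B) \<in> borel_measurable M"
proof (subst measurable_cong)
  show "emeasure (K x) B = (SUP n::nat. emeasure (K x) (B \<inter> ball undefined (real n)))" if "x \<in> space M" for x
    using that K B by (intro emeasure_eq_SUP_ball) auto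
  show "(\<lambda>x. SUP n::nat. emeasure (K x) (B \<inter> ball undefined (real n))) \<in> borel_measurable M"
    using B by (intro borel_measurable_SUP ev) (auto simp: bounded_Int)
qed

text \<open>A locally finite measure may have infinite total mass, so \<open>K\<close> is not a
  kernel into \<open>subprob_algebra\<close>; hence the induction on \<open>f\<close> is done
  directly, starting from bounded sets.\<close>

lemma measurable_nn_integral_locally_finite:
  fixes K :: "'w \<Rightarrow> 'a::polish_space measure"
  assumes K: "\<And>x. x \<in> space M \<Longrightarrow> sets (K x) = sets borel"
    and ev: "\<And>B. B \<in> sets borel \<Longrightarrow> bounded B \<Longrightarrow> (\<lambda>x. emeasure (K x) B) \<in> borel_measurable M"
    and f: "f \<in> borel_measurable borel"
  shows "(\<lambda>x. \<integral>\<^sup>+y. f y \<partial>K x) \<in> borel_measurable M"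
  using f
proof (induction f rule: borel_measurable_induct)
  case (cong f g)
  then show ?case by (simp cong: nn_integral_cong)
next
  case (set A)
  have "(\<lambda>x. emeasure (K x) A) \<in> borel_measurable M"
    using K ev set by (rule measurable_emeasure_locally_finite)
  then show ?case
    by (rule measurable_cong[THEN iffD1, rotated]) (use K set in simp)
next
  case (mult u c)
  have "(\<lambda>x. c * (\<integral>\<^sup>+y. u y \<partial>K x)) \<in> borel_measurable M" using mult by measurable
  then show ?case
    by (rule measurable_cong[THEN iffD1, rotated])
       (use K mult in \<open>subst nn_integral_cmult; simp add: measurable_cong_sets[OF K refl]\<close>)
next
  case (add u v)
  have "(\<lambda>x. (\<integral>\<^sup>+y. v y \<partial>K x) + (\<integral>\<^sup>+y. u y \<partial>K x)) \<in> borel_measurable M" using add by measurable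
  then show ?case
    by (rule measurable_cong[THEN iffD1, rotated])
       (use K add in \<open>subst nn_integral_add; simp add: measurable_cong_sets[OF K refl]\<close>)
next
  case (seq U)
  have "(\<lambda>x. SUP i. (\<integral>\<^sup>+y. U i y \<partial>K x)) \<in> borel_measurable M" using seq by measurable
  then show ?case
    by (rule measurable_cong[THEN iffD1, rotated])
       (use K seq in \<open>simp add: image_comp, subst nn_integral_monotone_convergence_SUP;
          simp add: measurable_cong_sets[OF K refl]\<close>)
qed

lemma measurable_integral_locally_finite:
  fixes K :: "'w \<Rightarrow> 'a::polish_space measure"
  assumes K: "\<And>x. x \<in> space M \<Longrightarrow> K x \<in> locally_finite_measures"
    and ev: "\<And>B. B \<in> sets borel \<Longrightarrow> bounded B \<Longrightarrow> (\<lambda>x. emeasure (K x) B) \<in> borel_measurable M"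
    and f: "bounded_support_fun f"
  shows "(\<lambda>x. \<integral>y. f y \<partial>K x) \<in> borel_measurable M"
proof (subst measurable_cong)
  show "(\<integral>y. f y \<partial>K x) = enn2real (\<integral>\<^sup>+y. ennreal (f y) \<partial>K x) - enn2real (\<integral>\<^sup>+y. ennreal (- f y) \<partial>K x)"
    if "x \<in> space M" for x
    by (rule real_lebesgue_integral_def[OF integrable_bounded_support_fun[OF K[OF that] f]])
  have [measurable]: "f \<in> borel_measurable borel" using f by (simp add: bounded_support_fun_def)
  have [measurable]: "(\<lambda>x. \<integral>\<^sup>+y. ennreal (f y) \<partial>K x) \<in> borel_measurable M"
    "(\<lambda>x. \<integral>\<^sup>+y. ennreal (- f y) \<partial>K x) \<in> borel_measurable M"
    by (rule measurable_nn_integral_locally_finite[OF locally_finite_measuresD(1)[OF K] ev]; simp)+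
  show "(\<lambda>x. enn2real (\<integral>\<^sup>+y. ennreal (f y) \<partial>K x) - enn2real (\<integral>\<^sup>+y. ennreal (- f y) \<partial>K x)) \<in> borel_measurable M"
    by measurable
qed

section \<open>The Borel sets of the vague topology\<close>

text \<open>A countable subbase has only countably many finite intersections, and every open set is
  a union of some of them. That union is therefore countable, which is what turns a measurability
  check on the subbase into one on all open sets.\<close>

lemma openin_topology_generated_by_countableE:
  assumes "openin (topology_generated_by \<S>) U" "countable \<S>"
  obtains \<T> where "countable \<T>" "U = \<Union>\<T>" "\<And>V. V \<in> \<T> \<Longrightarrow> \<exists>\<F>. finite \<F> \<and> \<F> \<noteq> {} \<and> \<F> \<subseteq> \<S> \<and> V = \<Inter>\<F>"
proof -
  \<comment> \<open>The empty family is excluded because its intersection is \<open>UNIV\<close>,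
    while the whole space of a generated topology is only the union of its subbase.\<close>
  define \<B> where "\<B> = Inter ` {\<F>. finite \<F> \<and> \<F> \<noteq> {} \<and> \<F> \<subseteq> \<S>}"
  have "countable {\<F>. finite \<F> \<and> \<F> \<subseteq> \<S>}"
    using assms(2) by (rule countable_Collect_finite_subset)
  then have "countable \<B>"
    unfolding \<B>_def by (intro countable_image) (rule countable_subset[rotated], auto)
  have "generate_topology_on \<S> U"
    using assms(1) by (simp add: openin_topology_generated_by_iff)
  then have "\<exists>\<T>\<subseteq>\<B>. U = \<Union>\<T>"
  proof induction
    case Empty
    then show ?case by (intro exI[of _ "{}"]) simp
  next
    case (Int a b)
    then obtain S T where ST: "S \<subseteq> \<B>" "T \<subseteq> \<B>" "a = \<Union>S" "b = \<Union>T" by blast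
    have "s \<inter> t \<in> \<B>" if st: "s \<in> \<B>" "t \<in> \<B>" for s t
    proof -
      obtain F G where "finite F" "F \<noteq> {}" "F \<subseteq> \<S>" "s = \<Inter>F" "finite G" "G \<noteq> {}" "G \<subseteq> \<S>" "t = \<Inter>G"
        using st by (auto simp: \<B>_def)
      then show ?thesis unfolding \<B>_def by (intro image_eqI[of _ _ "F \<union> G"]) auto
    qed
    then show ?case
      using ST by (intro exI[of _ "(\<lambda>(s, t). s \<inter> t) ` (S \<times> T)"]) auto
  next
    case (UN K)
    then obtain T where "\<And>k. k \<in> K \<Longrightarrow> T k \<subseteq> \<B> \<and> k = \<Union>(T k)" by metis
    then have "\<Union>(T ` K) \<subseteq> \<B>" "\<Union>K = \<Union>(\<Union>(T ` K))" by blast+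
    then show ?case by blast
  next
    case (Basis s)
    then show ?case unfolding \<B>_def
      by (intro exI[of _ "{s}"]) (auto intro!: image_eqI[of _ _ "{s}"])
  qed
  then obtain \<T> where "\<T> \<subseteq> \<B>" "U = \<Union>\<T>" by blast
  then show thesis
    using \<open>countable \<B>\<close> by (intro that[of \<T>]) (auto simp: \<B>_def intro: countable_subset)
qed

lemma openin_vague_subset:
  assumes "openin (vague_topology :: 'a::polish_space measure topology) U"
  shows "U \<subseteq> locally_finite_measures"
proof -
  have "topspace (vague_topology :: 'a measure topology) \<subseteq> locally_finite_measures"
    unfolding vague_topology_def topology_generated_by_topspace by (rule Union_least) blast
  with openin_subset[OF assms] show ?thesis by blast
qed

text \<open>
  A nonnegative test function is an increasing limit of maxima of finitely many bumps below it, and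
  countably many bumps suffice. So its integral is lower semicontinuous for a topology with a
  countable subbase; subtracting from a multiple of a cutoff gives upper semicontinuity.
\<close>

definition bump :: "real \<times> nat \<times> 'a::polish_space \<Rightarrow> 'a \<Rightarrow> real" where
  "bump = (\<lambda>(a, k, z) x. a * max 0 (1 - (real k + 1) * dist x z))"

text \<open>\<open>undefined\<close> serves as an arbitrary base point. A bounded set lies in the
  region where \<open>cutoff j\<close> is 1 as soon as \<open>j\<close> is large.\<close>

definition cutoff :: "nat \<Rightarrow> 'a::polish_space \<Rightarrow> real" where
  "cutoff j x = max 0 (min 1 (real j + 1 - dist x undefined))"

definition vague_test :: "('a::polish_space \<Rightarrow> real) \<Rightarrow> bool" where
  "vague_test f \<longleftrightarrow> continuous_on UNIV f \<and> bounded (range f) \<and> bounded {x. f x \<noteq> 0}"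

lemma vague_test_bounded_support_fun: "vague_test f \<Longrightarrow> bounded_support_fun f"
  by (auto simp: vague_test_def bounded_support_fun_def intro: borel_measurable_continuous_onI)

lemma vague_test_bump: "vague_test (bump t)"
proof -
  obtain a k z where t: "t = (a, k, z)" by (cases t)
  have "{x. bump t x \<noteq> 0} \<subseteq> cball z 1"
  proof (rule subsetI, rule ccontr)
    fix x assume *: "x \<in> {x. bump t x \<noteq> 0}" "x \<notin> cball z 1"
    then have "1 < dist x z" by (simp add: dist_commute)
    moreover have "dist x z * 1 \<le> dist x z * (real k + 1)" by (intro mult_left_mono) auto
    ultimately have "1 - (real k + 1) * dist x z < 0" by (simp only: mult.commute[of "dist x z"])
    with * show False by (simp add: bump_def t)
  qed
  moreover have "norm (bump t x) \<le> \<bar>a\<bar>" for x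
  proof -
    have "\<bar>a\<bar> * max 0 (1 - (real k + 1) * dist x z) \<le> \<bar>a\<bar> * 1" by (intro mult_left_mono) auto
    then show ?thesis by (simp add: bump_def t abs_mult)
  qed
  then have "bounded (range (bump t))" by (auto simp: bounded_iff)
  moreover have "continuous_on UNIV (bump t)"
    unfolding bump_def t by (simp, intro continuous_intros)
  ultimately show ?thesis
    by (auto simp: vague_test_def intro: bounded_subset)
qed

lemma vague_test_cutoff: "vague_test (cutoff j)"
proof -
  have "{x. cutoff j x \<noteq> 0} \<subseteq> cball undefined (real j + 1)"
    by (auto simp: cutoff_def dist_commute)
  moreover have "bounded (range (cutoff j))"
    by (auto simp: bounded_iff cutoff_def intro!: exI[of _ 1])
  moreover have "continuous_on UNIV (cutoff j)"
    unfolding cutoff_def by (intro continuous_intros)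
  ultimately show ?thesis
    by (auto simp: vague_test_def intro: bounded_subset)
qed

lemma vague_test_add: "vague_test f \<Longrightarrow> vague_test g \<Longrightarrow> vague_test (\<lambda>x. f x + g x)"
proof -
  assume f: "vague_test f" and g: "vague_test g"
  have "bounded {x. f x + g x \<noteq> 0}"
    by (rule bounded_subset[of "{x. f x \<noteq> 0} \<union> {x. g x \<noteq> 0}"]) (use f g in \<open>auto simp: vague_test_def\<close>)
  moreover have "bounded (range (\<lambda>x. f x + g x))"
    by (rule bounded_plus_comp) (use f g in \<open>auto simp: vague_test_def\<close>)
  ultimately show ?thesis
    using f g by (auto simp: vague_test_def intro: continuous_intros)
qed

lemma vague_test_cmult: "vague_test f \<Longrightarrow> vague_test (\<lambda>x. c * f x)"
proof -
  assume f: "vague_test f"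
  have "bounded {x. c * f x \<noteq> 0}"
    by (rule bounded_subset[of "{x. f x \<noteq> 0}"]) (use f in \<open>auto simp: vague_test_def\<close>)
  moreover have "bounded (range (\<lambda>x. c * f x))"
    using f bounded_scaling[of "range f" c] by (auto simp: vague_test_def image_image)
  ultimately show ?thesis
    using f by (auto simp: vague_test_def intro!: continuous_intros)
qed

lemma vague_test_max: "vague_test f \<Longrightarrow> vague_test g \<Longrightarrow> vague_test (\<lambda>x. max (f x) (g x))"
proof -
  assume f: "vague_test f" and g: "vague_test g"
  have "bounded {x. max (f x) (g x) \<noteq> 0}"
    by (rule bounded_subset[of "{x. f x \<noteq> 0} \<union> {x. g x \<noteq> 0}"])
       (use f g in \<open>auto simp: vague_test_def max_def split: if_splits\<close>)
  moreover have "bounded (range (\<lambda>x. max (f x) (g x)))"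
    by (rule bounded_subset[of "range f \<union> range g"]) (use f g in \<open>auto simp: vague_test_def max_def\<close>)
  ultimately show ?thesis
    using f g by (auto simp: vague_test_def intro: continuous_intros)
qed

primrec bump_max :: "(real \<times> nat \<times> 'a::polish_space) list \<Rightarrow> 'a \<Rightarrow> real" where
  "bump_max [] = (\<lambda>x. 0)"
| "bump_max (t # ts) = (\<lambda>x. max (bump t x) (bump_max ts x))"

lemma vague_test_bump_max: "vague_test (bump_max ts)"
proof (induction ts)
  case Nil
  show ?case by (auto simp: vague_test_def bounded_iff)
next
  case (Cons t ts)
  then show ?case by (simp add: vague_test_max vague_test_bump)
qed

lemma bump_max_nonneg: "0 \<le> bump_max ts x"
  by (induction ts) auto

lemma bump_max_le_iff: "bump_max ts x \<le> c \<longleftrightarrow> 0 \<le> c \<and> (\<forall>t\<in>set ts. bump t x \<le> c)"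
  by (induction ts) auto

text \<open>By continuity \<open>f\<close> stays above some level \<open>a\<close> between
  \<open>c\<close> and \<open>f x\<close> on a ball about \<open>x\<close>. A bump of height
  \<open>a\<close> fits below \<open>f\<close> if it lives inside that ball, and it exceeds
  \<open>c\<close> at \<open>x\<close> if its centre is close enough to \<open>x\<close>.\<close>

lemma exists_bump_below:
  fixes f :: "'a::polish_space \<Rightarrow> real"
  assumes D: "\<And>U :: 'a set. open U \<Longrightarrow> U \<noteq> {} \<Longrightarrow> \<exists>d\<in>D. d \<in> U"
    and f: "continuous_on UNIV f" "\<And>x. 0 \<le> f x" and c: "0 \<le> c" "c < f x"
  obtains t where "t \<in> \<rat> \<times> UNIV \<times> D" "\<And>y. bump t y \<le> f y" "c < bump t x"
proof -
  obtain a where a: "a \<in> \<rat>" "c < a" "a < f x" using Rats_dense_in_real[OF c(2)] by blast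
  have "isCont f x" using f(1) by (simp add: continuous_on_eq_continuous_at)
  then obtain e where e: "e > 0" "\<And>y. dist y x < e \<Longrightarrow> a < f y"
  proof -
    have "\<forall>\<^sub>F y in nhds x. a < f y"
      using \<open>isCont f x\<close> a(3) by (auto simp: isCont_def tendsto_at_iff_tendsto_nhds intro: order_tendstoD(1))
    then show thesis using that by (auto simp: eventually_nhds_metric)
  qed
  \<comment> \<open>This makes the radius \<open>1 / (k + 1)\<close> of the bump smaller than
    \<open>e / 2\<close>; with a centre within \<open>e / 2\<close> of \<open>x\<close> the bump
    vanishes outside the ball of radius \<open>e\<close>.\<close>
  obtain k :: nat where k: "2 / e < real k + 1"
    using reals_Archimedean2[of "2 / e - 1"] by (auto simp: algebra_simps)
  have k0: "2 < (real k + 1) * e" using k e by (simp add: field_simps)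
  \<comment> \<open>At distance exactly \<open>r\<close> from its centre the bump has dropped from
    \<open>a\<close> to \<open>c\<close>.\<close>
  define r where "r = (1 - c / a) / (real k + 1)"
  have r: "0 < r" using a c by (simp add: r_def)
  have r1: "r \<le> 1 / (real k + 1)" unfolding r_def using a c by (intro divide_right_mono) auto
  also have "\<dots> < e / 2" using k0 by (simp add: field_simps)
  finally have r2: "r < e / 2" .
  obtain d where d: "d \<in> D" "dist x d < r"
    using D[of "ball x r"] r by auto
  have "bump (a, k, d) y \<le> f y" for y
  proof (cases "dist y x < e")
    case True
    have "a * max 0 (1 - (real k + 1) * dist y d) \<le> a * 1" using a c by (intro mult_left_mono) auto
    then show ?thesis using e(2)[OF True] by (simp add: bump_def)
  next
    case False
    then have "e \<le> dist y d + dist x d" using dist_triangle[of y x d] by (simp add: dist_commute)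
    then have "e / 2 \<le> dist y d" using d r2 by linarith
    then have "(real k + 1) * (e / 2) \<le> (real k + 1) * dist y d" by (intro mult_left_mono) auto
    then have "1 - (real k + 1) * dist y d \<le> 0" using k0 by linarith
    then show ?thesis using f(2)[of y] by (simp only: bump_def prod.case max_absorb1 mult_zero_right)
  qed
  moreover have "c < bump (a, k, d) x"
  proof -
    have "(real k + 1) * dist x d < (real k + 1) * r" using d by (intro mult_strict_left_mono) auto
    also have "\<dots> = 1 - c / a" by (simp add: r_def)
    finally have "c / a < 1 - (real k + 1) * dist x d" by simp
    then have "c < a * (1 - (real k + 1) * dist x d)" using a c by (simp add: field_simps)
    also have "\<dots> \<le> a * max 0 (1 - (real k + 1) * dist x d)" using a c by (intro mult_left_mono) auto
    finally show ?thesis by (simp add: bump_def)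
  qed
  ultimately show thesis using a d by (intro that[of "(a, k, d)"]) auto
qed


text \<open>All parameters are rational, natural, or from \<open>D\<close>, which makes the family
  countable. Upper bounds occur for the cutoffs alone; those for other test functions are recovered
  in \<open>openin_vague_lower\<close>, applied to the negative function.\<close>

definition vague_subbase :: "'a::polish_space set \<Rightarrow> 'a measure set set" where
  "vague_subbase D =
     (\<lambda>(ts, r). {\<mu> \<in> locally_finite_measures. r < (\<integral>x. bump_max ts x \<partial>\<mu>)}) ` (lists (\<rat> \<times> UNIV \<times> D) \<times> \<rat>) \<union>
     (\<lambda>(j, r). {\<mu> \<in> locally_finite_measures. (\<integral>x. cutoff j x \<partial>\<mu>) < r}) ` (UNIV \<times> \<rat>)"

lemma countable_vague_subbase: "countable D \<Longrightarrow> countable (vague_subbase D)"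
  unfolding vague_subbase_def by (intro countable_Un countable_image countable_SIGMA countable_lists countable_rat) auto

context
  fixes D :: "'a::polish_space set"
  assumes D: "countable D" "\<And>U :: 'a set. open U \<Longrightarrow> U \<noteq> {} \<Longrightarrow> \<exists>d\<in>D. d \<in> U"
begin

lemma integral_bump_max_approx:
  fixes f :: "'a \<Rightarrow> real"
  assumes f: "vague_test f" "\<And>x. 0 \<le> f x" and \<mu>: "\<mu> \<in> locally_finite_measures"
    and a: "a < (\<integral>x. f x \<partial>\<mu>)"
  obtains ts where "ts \<in> lists (\<rat> \<times> UNIV \<times> D)" "\<And>x. bump_max ts x \<le> f x" "a < (\<integral>x. bump_max ts x \<partial>\<mu>)"
proof -
  define T where "T = {t \<in> \<rat> \<times> UNIV \<times> D. \<forall>y. bump t y \<le> f y}"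
  have cT: "countable T" unfolding T_def
    by (rule countable_subset[of _ "\<rat> \<times> UNIV \<times> D"]) (auto intro!: countable_SIGMA D countable_rat)
  have T: "\<exists>t\<in>T. c < bump t x" if "0 \<le> c" "c < f x" for c x
  proof -
    have "continuous_on UNIV f" using f(1) by (simp add: vague_test_def)
    from exists_bump_below[OF D(2) this f(2) that]
    obtain t where "t \<in> \<rat> \<times> UNIV \<times> D" "\<And>y. bump t y \<le> f y" "c < bump t x" by metis
    then show ?thesis unfolding T_def by blast
  qed
  show thesis
  proof (cases "T = {}")
    case True
    \<comment> \<open>Any positive value of \<open>f\<close> would leave room for a bump, so without
      bumps \<open>f\<close> vanishes and the empty list is exact.\<close>
    then have "f = (\<lambda>x. 0)" using T[of 0] f(2) by (force simp: fun_eq_iff less_le)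
    then show thesis using a by (intro that[of "[]"]) auto
  next
    case False
    define ts where "ts n = map (from_nat_into T) [0..<n]" for n
    have ts: "set (ts n) \<subseteq> T" for n using from_nat_into[OF False] by (auto simp: ts_def)
    have le: "bump_max (ts n) x \<le> f x" for n x
      using ts[of n] f(2) by (auto simp: bump_max_le_iff T_def)
    have "(\<lambda>n. \<integral>x. bump_max (ts n) x \<partial>\<mu>) \<longlonglongrightarrow> (\<integral>x. f x \<partial>\<mu>)"
    proof (rule integral_dominated_convergence[where w=f])
      show "integrable \<mu> f" "f \<in> borel_measurable \<mu>"
        using integrable_bounded_support_fun[OF \<mu> vague_test_bounded_support_fun[OF f(1)]] by auto
      show "bump_max (ts n) \<in> borel_measurable \<mu>" for n
        using integrable_bounded_support_fun[OF \<mu> vague_test_bounded_support_fun[OF vague_test_bump_max]] by blast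
      show "AE x in \<mu>. norm (bump_max (ts n) x) \<le> f x" for n
        by (rule AE_I2) (simp add: le bump_max_nonneg abs_of_nonneg)
      have "(\<lambda>n. bump_max (ts n) x) \<longlonglongrightarrow> f x" for x
      proof (rule order_tendstoI)
        fix c assume c: "c < f x"
        show "\<forall>\<^sub>F n in sequentially. c < bump_max (ts n) x"
        proof (cases "0 \<le> c")
          case True
          then obtain t where t: "t \<in> T" "c < bump t x" using T c by blast
          then obtain m where m: "t = from_nat_into T m" using from_nat_into_surj[OF cT] by metis
          have "c < bump_max (ts n) x" if "n > m" for n
          proof -
            have "t \<in> set (ts n)" using that by (auto simp: ts_def m)
            then have "bump t x \<le> bump_max (ts n) x" using bump_max_le_iff[of "ts n" x "bump_max (ts n) x"] by auto
            with t show ?thesis by simp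
          qed
          then show ?thesis using eventually_gt_at_top by (rule eventually_mono[rotated])
        next
          case False
          then have "c < bump_max (ts n) x" for n using bump_max_nonneg[of "ts n" x] by linarith
          then show ?thesis by simp
        qed
      next
        fix c assume "f x < c"
        then show "\<forall>\<^sub>F n in sequentially. bump_max (ts n) x < c"
          using le by (intro always_eventually) (meson le_less_trans)
      qed
      then show "AE x in \<mu>. (\<lambda>n. bump_max (ts n) x) \<longlonglongrightarrow> f x" by simp
    qed
    from order_tendstoD(1)[OF this a] obtain n where "a < (\<integral>x. bump_max (ts n) x \<partial>\<mu>)"
      by (auto simp: eventually_sequentially)
    moreover have "ts n \<in> lists (\<rat> \<times> UNIV \<times> D)" using ts[of n] by (auto simp: T_def)
    ultimately show thesis using le by (intro that)
  qed
qed

text \<open>Once the integral of \<open>f\<close> exceeds \<open>a\<close>, so does that of a single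
  finite maximum of bumps below \<open>f\<close>, and a rational fits in between. This exhibits the
  set as a union of members of the subbase.\<close>

lemma openin_vague_lower_nonneg:
  fixes f :: "'a \<Rightarrow> real"
  assumes f: "vague_test f" "\<And>x. 0 \<le> f x"
  shows "openin (topology_generated_by (vague_subbase D))
           {\<mu> \<in> locally_finite_measures. a < (\<integral>x. f x \<partial>\<mu>)}" (is "openin ?\<tau> ?U")
proof -
  let ?I = "{(ts, r). ts \<in> lists (\<rat> \<times> UNIV \<times> D) \<and> r \<in> \<rat> \<and> (\<forall>x. bump_max ts x \<le> f x) \<and> a < r}"
  let ?V = "\<lambda>(ts, r). {\<mu> \<in> locally_finite_measures. r < (\<integral>x. bump_max ts x \<partial>\<mu>)}"
  have eq: "?U = \<Union>(?V ` ?I)"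
  proof (intro equalityI subsetI)
    fix \<mu> assume "\<mu> \<in> ?U"
    then have \<mu>: "\<mu> \<in> locally_finite_measures" "a < (\<integral>x. f x \<partial>\<mu>)" by auto
    obtain ts where ts: "ts \<in> lists (\<rat> \<times> UNIV \<times> D)" "\<And>x. bump_max ts x \<le> f x" "a < (\<integral>x. bump_max ts x \<partial>\<mu>)"
      using integral_bump_max_approx[OF f \<mu>] by blast
    obtain r where "r \<in> \<rat>" "a < r" "r < (\<integral>x. bump_max ts x \<partial>\<mu>)" using Rats_dense_in_real[OF ts(3)] by blast
    then show "\<mu> \<in> \<Union>(?V ` ?I)" using ts \<mu> by blast
  next
    fix \<mu> assume "\<mu> \<in> \<Union>(?V ` ?I)"
    then obtain ts r where 1: "\<mu> \<in> locally_finite_measures" "\<And>x. bump_max ts x \<le> f x" "a < r"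
      "r < (\<integral>x. bump_max ts x \<partial>\<mu>)" by auto
    have "(\<integral>x. bump_max ts x \<partial>\<mu>) \<le> (\<integral>x. f x \<partial>\<mu>)"
      using 1 by (intro integral_mono integrable_bounded_support_fun vague_test_bounded_support_fun vague_test_bump_max f)
    with 1 show "\<mu> \<in> ?U" by auto
  qed
  have sub: "?V (ts, r) \<in> vague_subbase D" if "ts \<in> lists (\<rat> \<times> UNIV \<times> D)" "r \<in> \<rat>" for ts r
    unfolding vague_subbase_def using that by (intro UnI1 image_eqI[where x="(ts, r)"] refl SigmaI)
  show ?thesis unfolding eq
  proof (rule openin_Union, elim imageE)
    fix S i assume i: "S = ?V i" "i \<in> ?I"
    obtain ts r where "i = (ts, r)" by (cases i)
    with i have "S = ?V (ts, r)" "ts \<in> lists (\<rat> \<times> UNIV \<times> D)" "r \<in> \<rat>" by blast+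
    then show "openin ?\<tau> S" using sub by (simp only: topology_generated_by_Basis)
  qed
qed

text \<open>Adding \<open>c\<close> times a cutoff that is 1 on the support of \<open>f\<close>
  gives a nonnegative function. The integral of \<open>f\<close> exceeds \<open>a\<close> iff for
  some rational \<open>r\<close> the sum integrates to more than \<open>a + c * r\<close> while the
  cutoff integrates to less than \<open>r\<close>.\<close>

lemma openin_vague_lower:
  fixes f :: "'a \<Rightarrow> real"
  assumes f: "vague_test f"
  shows "openin (topology_generated_by (vague_subbase D))
           {\<mu> \<in> locally_finite_measures. a < (\<integral>x. f x \<partial>\<mu>)}" (is "openin ?\<tau> ?U")
proof -
  obtain c0 where c0: "\<And>x. \<bar>f x\<bar> \<le> c0" using f by (auto simp: vague_test_def bounded_iff)
  \<comment> \<open>The maximum with 1 keeps \<open>c\<close> positive even for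
    \<open>f = 0\<close>, so that division by \<open>c\<close> is allowed.\<close>
  define c where "c = max 1 c0"
  have c: "\<bar>f x\<bar> \<le> c" "0 < c" for x using c0[of x] by (auto simp: c_def)
  obtain e where e: "\<And>x. f x \<noteq> 0 \<Longrightarrow> dist undefined x \<le> e"
    using f by (auto simp: vague_test_def bounded_any_center[where a=undefined])
  obtain j :: nat where j: "e < real j" using reals_Archimedean2 by blast
  let ?g = "\<lambda>x. f x + c * cutoff j x"
  have g: "vague_test ?g" by (intro vague_test_add f vague_test_cmult vague_test_cutoff)
  have g0: "0 \<le> ?g x" for x
  proof (cases "f x = 0")
    case False
    then have "cutoff j x = 1" using e[OF False] j by (simp add: cutoff_def dist_commute)
    then show ?thesis using c(1)[of x] by simp
  qed (use c in \<open>auto simp: cutoff_def\<close>)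
  let ?h = "\<lambda>r. {\<mu> \<in> locally_finite_measures. a + c * r < (\<integral>x. ?g x \<partial>\<mu>)} \<inter> {\<mu> \<in> locally_finite_measures. (\<integral>x. cutoff j x \<partial>\<mu>) < r}"
  have int: "(\<integral>x. ?g x \<partial>\<mu>) = (\<integral>x. f x \<partial>\<mu>) + c * (\<integral>x. cutoff j x \<partial>\<mu>)" if "\<mu> \<in> locally_finite_measures" for \<mu>
    using integrable_bounded_support_fun[OF that vague_test_bounded_support_fun[OF f]]
      integrable_bounded_support_fun[OF that vague_test_bounded_support_fun[OF vague_test_cutoff]] by simp
  have "?U = (\<Union>r\<in>\<rat>. ?h r)"
  proof (intro equalityI subsetI)
    fix \<mu> assume "\<mu> \<in> ?U"
    then have \<mu>: "\<mu> \<in> locally_finite_measures" "a < (\<integral>x. f x \<partial>\<mu>)" by auto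
    have "(\<integral>x. cutoff j x \<partial>\<mu>) < (\<integral>x. cutoff j x \<partial>\<mu>) + ((\<integral>x. f x \<partial>\<mu>) - a) / c" using \<mu> c by simp
    then obtain r where r: "r \<in> \<rat>" "(\<integral>x. cutoff j x \<partial>\<mu>) < r" "r < (\<integral>x. cutoff j x \<partial>\<mu>) + ((\<integral>x. f x \<partial>\<mu>) - a) / c"
      using Rats_dense_in_real by blast
    have "r - (\<integral>x. cutoff j x \<partial>\<mu>) < ((\<integral>x. f x \<partial>\<mu>) - a) / c" using r by simp
    then have "(r - (\<integral>x. cutoff j x \<partial>\<mu>)) * c < (\<integral>x. f x \<partial>\<mu>) - a" using c by (simp add: pos_less_divide_eq)
    then have "a + c * r < (\<integral>x. ?g x \<partial>\<mu>)" unfolding int[OF \<mu>(1)] by (simp add: algebra_simps)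
    then show "\<mu> \<in> (\<Union>r\<in>\<rat>. ?h r)" using r \<mu> by blast
  next
    fix \<mu> assume "\<mu> \<in> (\<Union>r\<in>\<rat>. ?h r)"
    then obtain r where \<mu>: "\<mu> \<in> locally_finite_measures" and r: "a + c * r < (\<integral>x. ?g x \<partial>\<mu>)" "(\<integral>x. cutoff j x \<partial>\<mu>) < r" by blast
    have "c * (\<integral>x. cutoff j x \<partial>\<mu>) < c * r" using r c by simp
    with r(1) show "\<mu> \<in> ?U" using \<mu> unfolding int[OF \<mu>] by simp
  qed
  moreover have "openin ?\<tau> (?h r)" if "r \<in> \<rat>" for r
    using that by (intro openin_Int openin_vague_lower_nonneg g g0 topology_generated_by_Basis)
      (auto simp: vague_subbase_def)
  ultimately show ?thesis by (auto intro!: openin_Union)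
qed

lemma openin_vague_subbase:
  assumes "openin (vague_topology :: 'a measure topology) U"
  shows "openin (topology_generated_by (vague_subbase D)) U"
proof -
  have "generate_topology_on {{\<mu> \<in> locally_finite_measures. (\<integral>x. f x \<partial>\<mu>) \<in> U} | (f :: 'a \<Rightarrow> real) U.
        continuous_on UNIV f \<and> bounded (range f) \<and> bounded {x. f x \<noteq> 0} \<and> open U} U"
    using assms unfolding vague_topology_def openin_topology_generated_by_iff .
  then show ?thesis
  proof induction
    case (Basis s)
    then obtain f :: "'a \<Rightarrow> real" and U where f: "vague_test f" and U: "open U"
      and s: "s = {\<mu> \<in> locally_finite_measures. (\<integral>x. f x \<partial>\<mu>) \<in> U}" by (auto simp: vague_test_def)
    \<comment> \<open>An open set of reals is a union of intervals, and the upper bound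
      \<open>b\<close> for the integral of \<open>f\<close> is a lower bound \<open>- b\<close> for
      that of \<open>- f\<close>.\<close>
    let ?h = "\<lambda>(a, b). {\<mu> \<in> locally_finite_measures. a < (\<integral>x. f x \<partial>\<mu>)} \<inter> {\<mu> \<in> locally_finite_measures. - b < (\<integral>x. - f x \<partial>\<mu>)}"
    have eq: "s = \<Union>(?h ` {(a, b). {a<..<b} \<subseteq> U})"
    proof (intro equalityI subsetI)
      fix \<mu> assume "\<mu> \<in> s"
      then have \<mu>: "\<mu> \<in> locally_finite_measures" "(\<integral>x. f x \<partial>\<mu>) \<in> U" using s by auto
      obtain e where "e > 0" "ball (\<integral>x. f x \<partial>\<mu>) e \<subseteq> U" using U \<mu>(2) by (metis open_contains_ball)
      then show "\<mu> \<in> \<Union>(?h ` {(a, b). {a<..<b} \<subseteq> U})" using \<mu>(1)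
        by (intro UN_I[of "((\<integral>x. f x \<partial>\<mu>) - e, (\<integral>x. f x \<partial>\<mu>) + e)"]) (auto simp: ball_eq_greaterThanLessThan)
    qed (auto simp: s)
    show ?case unfolding eq
    proof (rule openin_Union, elim imageE)
      fix S i assume S: "S = ?h i"
      have "vague_test (\<lambda>x. - f x)" using vague_test_cmult[OF f, of "- 1"] by simp
      then show "openin (topology_generated_by (vague_subbase D)) S"
        unfolding S by (cases i) (simp only: prod.case, intro openin_Int openin_vague_lower f)
    qed
  qed (auto intro: openin_Union)
qed

text \<open>One half of the equality between the vague Borel sets and the sigma-algebra of the
  evaluations on bounded Borel sets: preimages are checked on the countable subbase, where only
  integrals of test functions occur. The other half is
  \<open>measurable_emeasure_vague_borel\<close>.\<close>

lemma measurable_vague_borel_aux: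
  fixes K :: "'w \<Rightarrow> 'a measure"
  assumes K: "\<And>x. x \<in> space M \<Longrightarrow> K x \<in> locally_finite_measures"
    and ev: "\<And>B. B \<in> sets borel \<Longrightarrow> bounded B \<Longrightarrow> (\<lambda>x. emeasure (K x) B) \<in> borel_measurable M"
  shows "K \<in> measurable M vague_borel"
  unfolding vague_borel_def
proof (rule measurable_measure_of)
  show "{U. openin vague_topology U} \<subseteq> Pow (locally_finite_measures :: 'a measure set)"
    using openin_vague_subset by auto
  show "K \<in> space M \<rightarrow> locally_finite_measures" using K by auto
  fix U :: "'a measure set" assume "U \<in> {U. openin vague_topology U}"
  then obtain \<T> where \<T>: "countable \<T>" "U = \<Union>\<T>"
    "\<And>V. V \<in> \<T> \<Longrightarrow> \<exists>\<F>. finite \<F> \<and> \<F> \<noteq> {} \<and> \<F> \<subseteq> vague_subbase D \<and> V = \<Inter>\<F>"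
    using openin_topology_generated_by_countableE[OF openin_vague_subbase countable_vague_subbase[OF D(1)]] by (metis mem_Collect_eq)
  have sub: "K -` s \<inter> space M \<in> sets M" if "s \<in> vague_subbase D" for s
    using that unfolding vague_subbase_def
  proof (elim UnE imageE; clarify)
    fix ts r
    have [measurable]: "(\<lambda>y. \<integral>x. bump_max ts x \<partial>K y) \<in> borel_measurable M"
      by (intro measurable_integral_locally_finite K ev vague_test_bounded_support_fun vague_test_bump_max)
    have "K -` {\<mu> \<in> locally_finite_measures. r < (\<integral>x. bump_max ts x \<partial>\<mu>)} \<inter> space M = {y \<in> space M. r < (\<integral>x. bump_max ts x \<partial>K y)}"
      using K by auto
    then show "K -` {\<mu> \<in> locally_finite_measures. r < (\<integral>x. bump_max ts x \<partial>\<mu>)} \<inter> space M \<in> sets M" by simp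
  next
    fix j r
    have [measurable]: "(\<lambda>y. \<integral>x. cutoff j x \<partial>K y) \<in> borel_measurable M"
      by (intro measurable_integral_locally_finite K ev vague_test_bounded_support_fun vague_test_cutoff)
    have "K -` {\<mu> \<in> locally_finite_measures. (\<integral>x. cutoff j x \<partial>\<mu>) < r} \<inter> space M = {y \<in> space M. (\<integral>x. cutoff j x \<partial>K y) < r}"
      using K by auto
    then show "K -` {\<mu> \<in> locally_finite_measures. (\<integral>x. cutoff j x \<partial>\<mu>) < r} \<inter> space M \<in> sets M" by simp
  qed
  have "K -` V \<inter> space M \<in> sets M" if V: "V \<in> \<T>" for V
  proof -
    obtain \<F> where F: "finite \<F>" "\<F> \<noteq> {}" "\<F> \<subseteq> vague_subbase D" "V = \<Inter>\<F>" using \<T>(3)[OF V] by blast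
    then have "K -` V \<inter> space M = (\<Inter>s\<in>\<F>. K -` s \<inter> space M)" by auto
    also have "\<dots> \<in> sets M" using F sub by (intro sets.finite_INT) auto
    finally show ?thesis .
  qed
  then have "(\<Union>V\<in>\<T>. K -` V \<inter> space M) \<in> sets M" using \<T>(1) by (intro sets.countable_UN') auto
  also have "(\<Union>V\<in>\<T>. K -` V \<inter> space M) = K -` U \<inter> space M" using \<T>(2) by auto
  finally show "K -` U \<inter> space M \<in> sets M" .
qed

end

lemma measurable_vague_borel:
  fixes K :: "'w \<Rightarrow> 'a::polish_space measure"
  assumes "\<And>x. x \<in> space M \<Longrightarrow> K x \<in> locally_finite_measures"
    and "\<And>B. B \<in> sets borel \<Longrightarrow> bounded B \<Longrightarrow> (\<lambda>x. emeasure (K x) B) \<in> borel_measurable M"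
  shows "K \<in> measurable M vague_borel"
proof -
  obtain D :: "'a set" where D: "countable D" "\<And>X. open X \<Longrightarrow> X \<noteq> {} \<Longrightarrow> \<exists>d\<in>D. d \<in> X"
    using countable_dense_setE by blast
  from D assms show ?thesis by (rule measurable_vague_borel_aux)
qed

section \<open>Evaluations on Borel sets are measurable for the vague topology\<close>

lemma space_vague_borel: "space vague_borel = locally_finite_measures"
  by (simp add: vague_borel_def space_measure_of_conv)

lemma measurable_integral_vague_test:
  fixes f :: "'a::polish_space \<Rightarrow> real"
  assumes "vague_test f"
  shows "(\<lambda>\<mu>. \<integral>x. f x \<partial>\<mu>) \<in> borel_measurable vague_borel"
proof (rule borel_measurableI)
  fix S :: "real set" assume "open S"
  then have "openin vague_topology {\<mu> \<in> locally_finite_measures. (\<integral>x. f x \<partial>\<mu>) \<in> S}"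
    unfolding vague_topology_def using assms
    by (intro topology_generated_by_Basis) (auto simp: vague_test_def)
  then have "{\<mu> \<in> locally_finite_measures. (\<integral>x. f x \<partial>\<mu>) \<in> S} \<in> sets vague_borel"
    unfolding vague_borel_def by (intro in_measure_of) (auto dest: openin_vague_subset)
  also have "{\<mu> \<in> locally_finite_measures. (\<integral>x. f x \<partial>\<mu>) \<in> S} = (\<lambda>\<mu>. \<integral>x. f x \<partial>\<mu>) -` S \<inter> space vague_borel"
    by (auto simp: space_vague_borel)
  finally show "(\<lambda>\<mu>. \<integral>x. f x \<partial>\<mu>) -` S \<inter> space vague_borel \<in> sets vague_borel" .
qed

text \<open>The indicator of \<open>C\<close> is the decreasing limit of continuous functions of the
  distance to \<open>C\<close>. The first of them has bounded support and dominates the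
  rest.\<close>

lemma measurable_emeasure_closed:
  fixes C :: "'a::polish_space set"
  assumes C: "closed C" "bounded C"
  shows "(\<lambda>\<mu>. emeasure \<mu> C) \<in> borel_measurable vague_borel"
\<comment> \<open>For the empty set \<open>infdist\<close> is 0 everywhere, and the approximants
  below would be constantly 1.\<close>
proof (cases "C = {}")
  case False
  define f where "f k x = max 0 (1 - (real k + 1) * infdist x C)" for k x
  have f: "vague_test (f k)" for k
  proof -
    obtain r where r: "\<And>y. y \<in> C \<Longrightarrow> dist undefined y \<le> r" using C(2) by (auto simp: bounded_any_center[where a=undefined])
    have "{x. f k x \<noteq> 0} \<subseteq> cball undefined (r + 1)"
    proof
      fix x assume "x \<in> {x. f k x \<noteq> 0}"
      then have "(real k + 1) * infdist x C < 1" by (auto simp: f_def max_def split: if_splits)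
      moreover have "1 * infdist x C \<le> (real k + 1) * infdist x C" by (intro mult_right_mono infdist_nonneg) simp
      ultimately have "infdist x C < 1" by simp
      then obtain y where "y \<in> C" "dist x y < 1"
        using False by (auto simp: infdist_def cINF_less_iff)
      then show "x \<in> cball undefined (r + 1)" using r[of y] dist_triangle[of undefined x y] by (simp add: dist_commute)
    qed
    moreover have "bounded (range (f k))"
      using infdist_nonneg[of _ C] by (auto simp: bounded_iff f_def intro!: exI[of _ 1])
    moreover have "continuous_on UNIV (f k)" unfolding f_def by (intro continuous_intros)
    ultimately show ?thesis by (auto simp: vague_test_def intro: bounded_subset)
  qed
  have "(\<lambda>\<mu>. measure \<mu> C) \<in> borel_measurable vague_borel"
  proof (rule borel_measurable_LIMSEQ_real)
    show "(\<lambda>\<mu>. \<integral>x. f k x \<partial>\<mu>) \<in> borel_measurable vague_borel" for k by (rule measurable_integral_vague_test[OF f])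
    fix \<mu> :: "'a measure" assume "\<mu> \<in> space vague_borel"
    then have \<mu>: "\<mu> \<in> locally_finite_measures" by (simp add: space_vague_borel)
    note int = integrable_bounded_support_fun[OF \<mu> vague_test_bounded_support_fun[OF f]]
    have "(\<lambda>k. \<integral>x. f k x \<partial>\<mu>) \<longlonglongrightarrow> (\<integral>x. indicator C x \<partial>\<mu>)"
    proof (rule integral_dominated_convergence[where w="f 0"])
      show "indicator C \<in> borel_measurable \<mu>" using C locally_finite_measuresD(1)[OF \<mu>] by (intro borel_measurable_indicator) auto
      show "AE x in \<mu>. norm (f k x) \<le> f 0 x" for k
      proof (rule AE_I2)
        fix x
        have "1 * infdist x C \<le> (real k + 1) * infdist x C" by (intro mult_right_mono infdist_nonneg) simp
        then show "norm (f k x) \<le> f 0 x" by (simp add: f_def)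
      qed
      have "(\<lambda>k. f k x) \<longlonglongrightarrow> indicator C x" for x
      proof (cases "x \<in> C")
        case True
        then show ?thesis by (simp add: f_def)
      next
        case False
        then have "0 < infdist x C" using C \<open>C \<noteq> {}\<close> by (simp add: infdist_pos_not_in_closed)
        then obtain k0 :: nat where k0: "1 / infdist x C < real k0" using reals_Archimedean2 by blast
        have "f k x = 0" if "k \<ge> k0" for k
        proof -
          have "1 < real k0 * infdist x C" using k0 \<open>0 < infdist x C\<close> by (simp add: field_simps)
          also have "\<dots> \<le> (real k + 1) * infdist x C" using that by (intro mult_right_mono infdist_nonneg) simp
          finally show ?thesis by (simp add: f_def)
        qed
        then have "\<forall>\<^sub>F k in sequentially. f k x = 0" using eventually_ge_at_top[of k0] by (rule eventually_mono[rotated])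
        then show ?thesis using False by (simp add: tendsto_eventually)
      qed
      then show "AE x in \<mu>. (\<lambda>k. f k x) \<longlonglongrightarrow> indicator C x" by simp
    qed (use int in auto)
    then show "(\<lambda>k. \<integral>x. f k x \<partial>\<mu>) \<longlonglongrightarrow> measure \<mu> C"
      using C locally_finite_measuresD[OF \<mu>] by simp
  qed
  then have "(\<lambda>\<mu>. ennreal (measure \<mu> C)) \<in> borel_measurable vague_borel" by measurable
  then show ?thesis
    using locally_finite_measuresD(3)[OF _ C(2)]
    by (subst measurable_cong[where g="\<lambda>\<mu>. ennreal (measure \<mu> C)"])
       (auto simp: space_vague_borel emeasure_eq_ennreal_measure less_top)
qed simp

text \<open>The closed sets generate the Borel sets and are stable under intersection, so Dynkin's
  argument extends \<open>measurable_emeasure_closed\<close> to them.\<close>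

lemma measurable_emeasure_vague_borel:
  fixes B :: "'a::polish_space set"
  assumes "B \<in> sets borel"
  shows "(\<lambda>\<mu>. emeasure \<mu> B) \<in> borel_measurable vague_borel"
proof (rule measurable_emeasure_locally_finite[OF _ _ assms])
  show "sets \<mu> = sets borel" if "\<mu> \<in> space vague_borel" for \<mu> :: "'a measure"
    using that by (simp add: space_vague_borel locally_finite_measuresD)
  fix B :: "'a set" assume B: "B \<in> sets borel" "bounded B"
  obtain e where "\<And>y. y \<in> B \<Longrightarrow> dist undefined y \<le> e"
    using B(2) by (auto simp: bounded_any_center[where a=undefined])
  then have e: "B \<subseteq> cball undefined e" by auto
  \<comment> \<open>Intersecting with this fixed closed ball keeps all masses finite, as the
    subtraction in the complement step requires, and costs nothing since \<open>B\<close> lies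
    inside it.\<close>
  let ?C = "cball (undefined :: 'a) e"
  have "sets (borel :: 'a measure) = sigma_sets UNIV (Collect closed)" by (simp add: borel_eq_closed)
  then have "B \<in> sigma_sets UNIV (Collect closed)" using B by simp
  then have "(\<lambda>\<mu>. emeasure \<mu> (B \<inter> ?C)) \<in> borel_measurable vague_borel"
  proof (induction rule: sigma_sets_induct_disjoint[rotated 2, consumes 1, case_names basic empty compl union Int_stable Pow])
    case (basic A)
    then show ?case by (intro measurable_emeasure_closed) (auto intro: bounded_subset)
  next
    case (compl A)
    have A: "A \<in> sets borel" using compl(1) by (simp add: borel_eq_closed)
    have "(\<lambda>\<mu>. emeasure \<mu> ?C - emeasure \<mu> (A \<inter> ?C)) \<in> borel_measurable vague_borel"
      using compl(2) measurable_emeasure_closed[of ?C] by measurable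
    then show ?case
    proof (subst measurable_cong)
      fix \<mu> :: "'a measure" assume "\<mu> \<in> space vague_borel"
      then have \<mu>: "\<mu> \<in> locally_finite_measures" by (simp add: space_vague_borel)
      have "(UNIV - A) \<inter> ?C = ?C - (A \<inter> ?C)" by auto
      then show "emeasure \<mu> ((UNIV - A) \<inter> ?C) = emeasure \<mu> ?C - emeasure \<mu> (A \<inter> ?C)"
        using A locally_finite_measuresD[OF \<mu>] locally_finite_measuresD(3)[OF \<mu>, of "A \<inter> ?C"]
        by (simp add: emeasure_Diff bounded_Int less_top)
    qed
  next
    case (union A)
    have A: "A i \<in> sets borel" for i using union(2) by (auto simp: borel_eq_closed)
    have "(\<lambda>\<mu>. \<Sum>i. emeasure \<mu> (A i \<inter> ?C)) \<in> borel_measurable vague_borel" using union by measurable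
    then show ?case
    proof (subst measurable_cong)
      fix \<mu> :: "'a measure" assume "\<mu> \<in> space vague_borel"
      then have \<mu>: "\<mu> \<in> locally_finite_measures" by (simp add: space_vague_borel)
      have "(\<Sum>i. emeasure \<mu> (A i \<inter> ?C)) = emeasure \<mu> (\<Union>i. A i \<inter> ?C)"
        using A union(1) locally_finite_measuresD(1)[OF \<mu>]
        by (intro suminf_emeasure) (auto simp: disjoint_family_on_def)
      then show "emeasure \<mu> ((\<Union>i. A i) \<inter> ?C) = (\<Sum>i. emeasure \<mu> (A i \<inter> ?C))" by simp
    qed
  qed (auto simp: Int_stable_def)
  moreover have "B \<inter> ?C = B" using e by auto
  ultimately show "(\<lambda>\<mu>. emeasure \<mu> B) \<in> borel_measurable vague_borel" by simp
qed

section \<open>Point measures\<close>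

text \<open>This is the number of factors at \<open>x\<close> in \<open>thin_kernel\<close>. By
  \<open>point_measure_eqI\<close> it determines a point measure, so identities between point
  measures become natural number arithmetic at each point.\<close>

definition pmult :: "'a::polish_space measure \<Rightarrow> 'a \<Rightarrow> nat" where
  "pmult \<mu> x = nat \<lfloor>measure \<mu> {x}\<rfloor>"

lemma point_measuresD:
  assumes "\<mu> \<in> point_measures"
  shows "\<mu> \<in> locally_finite_measures" "sets \<mu> = sets borel" "space \<mu> = UNIV"
    and "B \<in> sets borel \<Longrightarrow> bounded B \<Longrightarrow> emeasure \<mu> B \<in> \<nat>"
    and "bounded B \<Longrightarrow> emeasure \<mu> B < \<infinity>"
  using assms locally_finite_measuresD[of \<mu>] by (auto simp: point_measures_def)

lemma measurable_point_borel:
  fixes K :: "'w \<Rightarrow> 'a::polish_space measure"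
  assumes "\<And>x. x \<in> space M \<Longrightarrow> K x \<in> point_measures"
    and "\<And>B. B \<in> sets borel \<Longrightarrow> bounded B \<Longrightarrow> (\<lambda>x. emeasure (K x) B) \<in> borel_measurable M"
  shows "K \<in> measurable M point_borel"
  unfolding point_borel_def
  using assms by (intro measurable_restrict_space2 measurable_vague_borel) (auto simp: point_measures_def)

lemma measurable_emeasure_point_borel:
  assumes "B \<in> sets borel"
  shows "(\<lambda>\<mu>. emeasure \<mu> B) \<in> borel_measurable point_borel"
  unfolding point_borel_def
  by (intro measurable_restrict_space1 measurable_emeasure_vague_borel assms)

lemma measurable_integral_point_borel:
  fixes f :: "'a::polish_space \<Rightarrow> real"
  assumes "bounded_support_fun f"
  shows "(\<lambda>\<mu>. \<integral>x. f x \<partial>\<mu>) \<in> borel_measurable point_borel"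
  using measurable_emeasure_point_borel point_measuresD(1) assms
  by (intro measurable_integral_locally_finite) (auto simp: space_point_borel)

lemma emeasure_singleton_eq_mult:
  assumes "\<mu> \<in> point_measures"
  shows "emeasure \<mu> {x} = of_nat (pmult \<mu> x)" "measure \<mu> {x} = real (pmult \<mu> x)"
proof -
  have "emeasure \<mu> {x} \<in> \<nat>" using assms by (intro point_measuresD) auto
  then obtain n where n: "emeasure \<mu> {x} = of_nat n" by (auto simp: Nats_def)
  then have "measure \<mu> {x} = real n" by (simp add: measure_def ennreal_of_nat_eq_real_of_nat)
  then show "emeasure \<mu> {x} = of_nat (pmult \<mu> x)" "measure \<mu> {x} = real (pmult \<mu> x)"
    using n by (simp_all add: pmult_def)
qed

text \<open>Each atom contributes at least 1 to the mass of a closed ball containing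
  \<open>B\<close>, and this mass is a natural number. The ball stands in for \<open>B\<close>,
  which need not be Borel.\<close>

lemma finite_mult_bounded:
  assumes \<mu>: "\<mu> \<in> point_measures" and B: "bounded B"
  shows "finite {x \<in> B. pmult \<mu> x \<noteq> 0}"
proof -
  obtain e where e: "B \<subseteq> cball undefined e"
    using B by (metis bounded_any_center mem_cball subsetI)
  have "emeasure \<mu> (cball undefined e) \<in> \<nat>" using \<mu> by (intro point_measuresD) auto
  then obtain n where n: "emeasure \<mu> (cball undefined e) = of_nat n" by (auto simp: Nats_def)
  have "card F \<le> n" if F: "finite F" "F \<subseteq> {x \<in> B. pmult \<mu> x \<noteq> 0}" for F
  proof -
    have "(of_nat (card F) :: ennreal) = (\<Sum>x\<in>F. 1)" by simp
    also have "\<dots> \<le> (\<Sum>x\<in>F. emeasure \<mu> {x})"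
    proof (rule sum_mono)
      fix x assume "x \<in> F"
      then have "1 \<le> pmult \<mu> x" using F by auto
      then show "1 \<le> emeasure \<mu> {x}" unfolding emeasure_singleton_eq_mult[OF \<mu>]
        by (metis of_nat_1 of_nat_le_iff)
    qed
    also have "\<dots> = emeasure \<mu> F"
      using F by (intro emeasure_eq_sum_singleton[symmetric]) (auto simp: point_measuresD[OF \<mu>])
    also have "\<dots> \<le> emeasure \<mu> (cball undefined e)"
      using F e by (intro emeasure_mono) (auto simp: point_measuresD[OF \<mu>])
    finally show ?thesis unfolding n by simp
  qed
  then show ?thesis using finite_if_finite_subsets_card_bdd[of "{x \<in> B. pmult \<mu> x \<noteq> 0}" n] by simp
qed

lemma countable_mult:
  assumes \<mu>: "\<mu> \<in> point_measures"
  shows "countable {x. pmult \<mu> x \<noteq> 0}"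
proof -
  have "{x. pmult \<mu> x \<noteq> 0} \<subseteq> (\<Union>n::nat. {x \<in> ball undefined (real n). pmult \<mu> x \<noteq> 0})"
  proof
    fix x assume "x \<in> {x. pmult \<mu> x \<noteq> 0}"
    moreover obtain n where "dist undefined x < real n" using reals_Archimedean2 by blast
    ultimately show "x \<in> (\<Union>n::nat. {x \<in> ball undefined (real n). pmult \<mu> x \<noteq> 0})" by auto
  qed
  moreover have "countable (\<Union>n::nat. {x \<in> ball undefined (real n). pmult \<mu> x \<noteq> 0})"
    by (rule countable_UN[OF countableI_type countable_finite[OF finite_mult_bounded[OF \<mu> bounded_ball]]])
  ultimately show ?thesis by (rule countable_subset)
qed

text \<open>The non-atoms in small balls about \<open>x\<close> decrease to a set of mass 0. Their
  masses are finite and tend to 0; being natural numbers, they are eventually 0. By Lindelof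
  countably many such balls cover the space, so the non-atoms have mass 0 altogether.\<close>

lemma point_measure_atomic:
  fixes \<mu> :: "'a::polish_space measure"
  assumes \<mu>: "\<mu> \<in> point_measures"
  shows "{x. pmult \<mu> x = 0} \<in> null_sets \<mu>"
proof -
  note [simp] = point_measuresD(2,3)[OF \<mu>]
  let ?A = "{x. pmult \<mu> x = 0}"
  have "{x. pmult \<mu> x \<noteq> 0} \<in> sets borel" by (rule sets.countable[OF _ countable_mult[OF \<mu>]]) simp
  moreover have "?A = UNIV - {x. pmult \<mu> x \<noteq> 0}" by auto
  ultimately have A[measurable]: "?A \<in> sets borel"
    using sets.compl_sets[of "{x. pmult \<mu> x \<noteq> 0}" borel] by simp
  have "\<exists>r>0. emeasure \<mu> (ball x r \<inter> ?A) = 0" for x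
  proof -
    have lim: "(\<lambda>n::nat. emeasure \<mu> (ball x (1 / (real n + 1)) \<inter> ?A)) \<longlonglongrightarrow> emeasure \<mu> (\<Inter>n::nat. ball x (1 / (real n + 1)) \<inter> ?A)"
    proof (rule Lim_emeasure_decseq)
      show "range (\<lambda>n::nat. ball x (1 / (real n + 1)) \<inter> ?A) \<subseteq> sets \<mu>" by (rule image_subsetI) simp
      show "decseq (\<lambda>n::nat. ball x (1 / (real n + 1)) \<inter> ?A)"
        by (intro antimonoI Int_mono order_refl subset_ball) (simp add: frac_le)
      show "emeasure \<mu> (ball x (1 / (real n + 1)) \<inter> ?A) \<noteq> \<infinity>" for n
        using point_measuresD(5)[OF \<mu>, of "ball x (1 / (real n + 1)) \<inter> ?A"] by (simp add: bounded_Int less_top)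
    qed
    have "(\<Inter>n::nat. ball x (1 / (real n + 1)) \<inter> ?A) \<subseteq> {x} \<inter> ?A"
    proof
      fix y assume y: "y \<in> (\<Inter>n::nat. ball x (1 / (real n + 1)) \<inter> ?A)"
      have "dist x y \<le> 0"
      proof (rule ccontr)
        assume "\<not> dist x y \<le> 0"
        then obtain n where "inverse (of_nat (Suc n)) < dist x y" using reals_Archimedean[of "dist x y"] by auto
        moreover have "dist x y < 1 / (real n + 1)" using y by auto
        ultimately show False by (simp add: inverse_eq_divide add.commute)
      qed
      then show "y \<in> {x} \<inter> ?A" using y by auto
    qed
    then have "emeasure \<mu> (\<Inter>n::nat. ball x (1 / (real n + 1)) \<inter> ?A) \<le> emeasure \<mu> ({x} \<inter> ?A)"
      by (rule emeasure_mono) simp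
    also have "\<dots> = 0"
      using emeasure_singleton_eq_mult(1)[OF \<mu>, of x] by (cases "pmult \<mu> x = 0") auto
    finally have "emeasure \<mu> (\<Inter>n::nat. ball x (1 / (real n + 1)) \<inter> ?A) < 1" by simp
    from order_tendstoD(2)[OF lim this] obtain n :: nat where n: "emeasure \<mu> (ball x (1 / (real n + 1)) \<inter> ?A) < 1"
      by (auto simp: eventually_sequentially)
    have "emeasure \<mu> (ball x (1 / (real n + 1)) \<inter> ?A) \<in> \<nat>"
      by (intro point_measuresD[OF \<mu>]) (auto simp: bounded_Int)
    then obtain k where k: "emeasure \<mu> (ball x (1 / (real n + 1)) \<inter> ?A) = of_nat k" by (auto simp: Nats_def)
    with n have "k = 0" by (metis less_one of_nat_1 of_nat_less_iff)
    then show ?thesis using k by (intro exI[of _ "1 / (real n + 1)"]) simp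
  qed
  then obtain r where r: "\<And>x. r x > 0" "\<And>x. emeasure \<mu> (ball x (r x) \<inter> ?A) = 0" by metis
  obtain \<F> where \<F>: "\<F> \<subseteq> range (\<lambda>x. ball x (r x))" "countable \<F>" "\<Union>\<F> = \<Union>(range (\<lambda>x. ball x (r x)))"
    using Lindelof[of "range (\<lambda>x. ball x (r x))"] by auto
  have "\<Union>(range (\<lambda>x. ball x (r x))) = UNIV" using r(1) by force
  then have "?A = (\<Union>S\<in>\<F>. S \<inter> ?A)" using \<F>(3) by auto
  moreover have "(\<Union>S\<in>\<F>. S \<inter> ?A) \<in> null_sets \<mu>"
    using \<F>(1) r(2) by (intro null_sets_UN' \<F>(2)) (auto intro!: null_setsI)
  ultimately show ?thesis by simp
qed

text \<open>Almost every point is an atom, so \<open>B\<close> may be replaced by \<open>J\<close>.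
  \<open>J\<close> may contain points without mass; this allows several measures to be summed over a
  common index set.\<close>

lemma emeasure_point_measure:
  assumes \<mu>: "\<mu> \<in> point_measures" and B: "B \<in> sets borel"
    and J: "finite J" "J \<subseteq> B" "\<And>x. x \<in> B \<Longrightarrow> pmult \<mu> x \<noteq> 0 \<Longrightarrow> x \<in> J"
  shows "emeasure \<mu> B = of_nat (\<Sum>x\<in>J. pmult \<mu> x)"
proof -
  note [simp] = point_measuresD(2,3)[OF \<mu>]
  have "emeasure \<mu> B = emeasure \<mu> J"
  proof (rule emeasure_eq_AE)
    show "AE x in \<mu>. x \<in> B \<longleftrightarrow> x \<in> J"
      by (rule AE_I'[OF point_measure_atomic[OF \<mu>]]) (use J in auto)
    show "J \<in> sets \<mu>" using J by (auto intro: sets.countable countable_finite)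
  qed (use B in auto)
  also have "\<dots> = (\<Sum>x\<in>J. emeasure \<mu> {x})"
    using J by (intro emeasure_eq_sum_singleton) auto
  finally show ?thesis by (simp add: emeasure_singleton_eq_mult[OF \<mu>])
qed

lemma integral_point_measure:
  fixes f :: "'a::polish_space \<Rightarrow> real"
  assumes \<mu>: "\<mu> \<in> point_measures" and f: "f \<in> borel_measurable borel"
    and J: "finite J" "\<And>x. f x \<noteq> 0 \<Longrightarrow> pmult \<mu> x \<noteq> 0 \<Longrightarrow> x \<in> J"
  shows "(\<integral>x. f x \<partial>\<mu>) = (\<Sum>x\<in>J. f x * pmult \<mu> x)"
proof -
  note [simp] = point_measuresD(2,3)[OF \<mu>]
  have 1: "{y} \<in> sets \<mu>" "emeasure \<mu> {y} < \<infinity>" for y using point_measuresD(5)[OF \<mu>, of "{y}"] by auto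
  have [measurable]: "f \<in> borel_measurable \<mu>" using f by (simp add: measurable_cong_sets[of \<mu> borel])
  have "(\<integral>x. f x \<partial>\<mu>) = (\<integral>x. (\<Sum>y\<in>J. f y * indicator {y} x) \<partial>\<mu>)"
  proof -
    have ae: "AE x in \<mu>. f x = (\<Sum>y\<in>J. f y * indicator {y} x)"
    proof (rule AE_I'[OF point_measure_atomic[OF \<mu>]], rule subsetI, rule ccontr)
      fix x assume x: "x \<in> {x \<in> space \<mu>. f x \<noteq> (\<Sum>y\<in>J. f y * indicator {y} x)}" "x \<notin> {x. pmult \<mu> x = 0}"
      have "(\<Sum>y\<in>J. f y * indicator {y} x) = (\<Sum>y\<in>J. if y = x then f x else 0)"
        by (intro sum.cong) (auto simp: indicator_def)
      also have "\<dots> = f x" using J x by (auto simp: sum.delta)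
      finally show False using x by simp
    qed
    have m: "(\<lambda>x. \<Sum>y\<in>J. f y * indicator {y} x) \<in> borel_measurable \<mu>"
      by (intro borel_measurable_sum borel_measurable_times borel_measurable_const borel_measurable_indicator 1)
    show ?thesis by (rule integral_cong_AE[OF _ m ae]) simp
  qed
  also have "\<dots> = (\<Sum>y\<in>J. \<integral>x. f y * indicator {y} x \<partial>\<mu>)" using 1
    by (intro Bochner_Integration.integral_sum integrable_mult_right integrable_real_indicator)
  also have "\<dots> = (\<Sum>y\<in>J. f y * pmult \<mu> y)" by (simp add: emeasure_singleton_eq_mult[OF \<mu>])
  finally show ?thesis .
qed

lemma point_measure_eqI:
  assumes \<mu>: "\<mu> \<in> point_measures" and \<kappa>: "\<kappa> \<in> point_measures" and eq: "\<And>x. pmult \<mu> x = pmult \<kappa> x"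
  shows "\<mu> = \<kappa>"
proof (rule measure_eqI)
  show "sets \<mu> = sets \<kappa>" by (simp add: point_measuresD(2)[OF \<mu>] point_measuresD(2)[OF \<kappa>])
  fix B assume "B \<in> sets \<mu>"
  then have B: "B \<in> sets borel" by (simp add: point_measuresD(2)[OF \<mu>])
  have "emeasure \<mu> (B \<inter> ball undefined (real n)) = emeasure \<kappa> (B \<inter> ball undefined (real n))" for n
  proof -
    let ?B = "B \<inter> ball undefined (real n)"
    let ?J = "{x \<in> ?B. pmult \<mu> x \<noteq> 0}"
    have J: "finite ?J" by (rule finite_mult_bounded[OF \<mu>]) (simp add: bounded_Int)
    have B: "?B \<in> sets borel" using B by simp
    have "emeasure \<mu> ?B = of_nat (\<Sum>x\<in>?J. pmult \<mu> x)"
      by (rule emeasure_point_measure[OF \<mu> B J]) auto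
    moreover have "emeasure \<kappa> ?B = of_nat (\<Sum>x\<in>?J. pmult \<kappa> x)"
      by (rule emeasure_point_measure[OF \<kappa> B J]) (auto simp: eq)
    ultimately show ?thesis by (simp only: eq)
  qed
  then show "emeasure \<mu> B = emeasure \<kappa> B"
    by (simp add: emeasure_eq_SUP_ball[OF point_measuresD(2)[OF \<mu>] B] emeasure_eq_SUP_ball[OF point_measuresD(2)[OF \<kappa>] B])
qed

section \<open>Point measures with prescribed multiplicities, and truncated differences\<close>

definition from_mult :: "('a::polish_space \<Rightarrow> nat) \<Rightarrow> 'a measure" where
  "from_mult c = superpose UNIV (\<lambda>x. scale_measure (of_nat (c x)) (return borel x))"

lemma sets_superpose [simp]: "sets (superpose I \<mu>) = sets borel"
  unfolding superpose_def
  using sets.sigma_sets_eq[of borel] by (simp add: sets_measure_of_conv)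

lemma from_mult:
  fixes c :: "'a::polish_space \<Rightarrow> nat"
  assumes c: "\<And>B. bounded B \<Longrightarrow> finite {x \<in> B. c x \<noteq> 0}"
  shows "from_mult c \<in> point_measures" "pmult (from_mult c) x = c x"
proof -
  have 1: "emeasure (from_mult c) B = of_nat (\<Sum>x\<in>{x \<in> B. c x \<noteq> 0}. c x)" if B: "B \<in> sets borel" "bounded B" for B
  proof -
    have "emeasure (from_mult c) B = (\<integral>\<^sup>+x. of_nat (c x) * indicator B x \<partial>count_space UNIV)"
      unfolding from_mult_def using B by (subst emeasure_superpose) auto
    also have "\<dots> = (\<Sum>x\<in>{x \<in> B. c x \<noteq> 0}. of_nat (c x) * indicator B x)"
      using c[OF B(2)] by (intro nn_integral_count_space') (auto simp: indicator_def)
    also have "\<dots> = (\<Sum>x\<in>{x \<in> B. c x \<noteq> 0}. of_nat (c x))"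
      by (intro sum.cong) auto
    finally show ?thesis by simp
  qed
  show 2: "from_mult c \<in> point_measures"
  proof -
    have "sets (from_mult c) = sets borel" by (simp add: from_mult_def)
    moreover have "emeasure (from_mult c) B < \<infinity>" "emeasure (from_mult c) B \<in> \<nat>" if "B \<in> sets borel" "bounded B" for B
      unfolding 1[OF that] using of_nat_less_top by (auto simp del: of_nat_sum)
    ultimately show ?thesis by (simp add: point_measures_def locally_finite_measures_def)
  qed
  have "of_nat (pmult (from_mult c) x) = (of_nat (\<Sum>y\<in>{y \<in> {x}. c y \<noteq> 0}. c y) :: ennreal)"
    using 1[of "{x}"] emeasure_singleton_eq_mult(1)[OF 2, of x] by simp
  also have "(\<Sum>y\<in>{y \<in> {x}. c y \<noteq> 0}. c y) = c x"
    by (cases "c x = 0") (auto simp: Collect_conv_if)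
  finally show "pmult (from_mult c) x = c x" by simp
qed

lemma ennreal_of_nat_minus: "(of_nat m - of_nat n :: ennreal) = of_nat (m - n)"
proof (cases "n \<le> m")
  case True
  then show ?thesis by (simp add: ennreal_of_nat_eq_real_of_nat ennreal_minus of_nat_diff)
next
  case False
  then show ?thesis by (simp add: ennreal_of_nat_eq_real_of_nat ennreal_minus ennreal_neg)
qed

text \<open>On a bounded set \<mu> exceeds \<kappa> by at most the sum of the positive excesses at
  its points, and the set of points with positive excess attains this. No domination of \<kappa> by
  \<mu> is assumed, so the difference is a point measure at every argument of the iterated integrals
  over \<open>successive_thin\<close>, not merely almost surely.\<close>

lemma point_diff:
  fixes \<mu> \<kappa> :: "'a::polish_space measure"
  assumes \<mu>: "\<mu> \<in> point_measures" and \<kappa>: "\<kappa> \<in> point_measures"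
  shows "point_diff \<mu> \<kappa> \<in> point_measures" "pmult (point_diff \<mu> \<kappa>) x = pmult \<mu> x - pmult \<kappa> x"
proof -
  define \<xi> where "\<xi> = from_mult (\<lambda>x. pmult \<mu> x - pmult \<kappa> x)"
  have c: "finite {x \<in> B. pmult \<mu> x - pmult \<kappa> x \<noteq> 0}" if "bounded B" for B
    by (rule finite_subset[OF _ finite_mult_bounded[OF \<mu> that]]) auto
  have \<xi>: "\<xi> \<in> point_measures" "\<And>x. pmult \<xi> x = pmult \<mu> x - pmult \<kappa> x"
    unfolding \<xi>_def by (rule from_mult(1)[OF c], assumption) (rule from_mult(2)[OF c])
  note [simp] = point_measuresD(2,3)[OF \<xi>(1)]
  have le: "emeasure \<mu> C - emeasure \<kappa> C \<le> emeasure \<xi> C" if C: "C \<in> sets borel" "bounded C" for C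
  proof -
    let ?J = "{x \<in> C. pmult \<mu> x \<noteq> 0} \<union> {x \<in> C. pmult \<kappa> x \<noteq> 0}"
    have J: "finite ?J" using finite_mult_bounded[OF \<mu> C(2)] finite_mult_bounded[OF \<kappa> C(2)] by simp
    have "emeasure \<mu> C = of_nat (\<Sum>x\<in>?J. pmult \<mu> x)" by (rule emeasure_point_measure[OF \<mu> C(1) J]) auto
    also have "\<dots> \<le> of_nat ((\<Sum>x\<in>?J. pmult \<kappa> x) + (\<Sum>x\<in>?J. pmult \<xi> x))"
      unfolding sum.distrib[symmetric] of_nat_le_iff by (intro sum_mono) (simp add: \<xi>)
    also have "\<dots> = emeasure \<kappa> C + emeasure \<xi> C"
    proof -
      have "emeasure \<kappa> C = of_nat (\<Sum>x\<in>?J. pmult \<kappa> x)" by (rule emeasure_point_measure[OF \<kappa> C(1) J]) auto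
      moreover have "emeasure \<xi> C = of_nat (\<Sum>x\<in>?J. pmult \<xi> x)" by (rule emeasure_point_measure[OF \<xi>(1) C(1) J]) (auto simp: \<xi>)
      ultimately show ?thesis by simp
    qed
    finally show ?thesis
      using point_measuresD(5)[OF \<mu> C(2)] by (subst ennreal_minus_le_iff) auto
  qed
  have *: "(SUP C\<in>{C \<in> sets borel. bounded C \<and> C \<subseteq> B}. emeasure \<mu> C - emeasure \<kappa> C) = emeasure \<xi> B"
    if B: "B \<in> sets borel" for B
  proof (rule antisym)
    show "(SUP C\<in>{C \<in> sets borel. bounded C \<and> C \<subseteq> B}. emeasure \<mu> C - emeasure \<kappa> C) \<le> emeasure \<xi> B"
    proof (rule SUP_least)
      fix C assume C: "C \<in> {C \<in> sets borel. bounded C \<and> C \<subseteq> B}"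
      then have "emeasure \<mu> C - emeasure \<kappa> C \<le> emeasure \<xi> C" by (intro le) auto
      also have "\<dots> \<le> emeasure \<xi> B" using C B by (intro emeasure_mono) auto
      finally show "emeasure \<mu> C - emeasure \<kappa> C \<le> emeasure \<xi> B" .
    qed
    have "emeasure \<xi> (B \<inter> ball undefined (real n)) \<le> (SUP C\<in>{C \<in> sets borel. bounded C \<and> C \<subseteq> B}. emeasure \<mu> C - emeasure \<kappa> C)" for n
    proof -
      \<comment> \<open>The points where \<mu> exceeds \<kappa>: on this finite set nothing cancels,
        so it serves as competitor in the supremum.\<close>
      let ?J = "{x \<in> B \<inter> ball undefined (real n). pmult \<mu> x - pmult \<kappa> x \<noteq> 0}"
      have J: "finite ?J" by (rule c) (simp add: bounded_Int)
      have Jb: "?J \<in> sets borel" by (rule sets.countable[OF _ countable_finite[OF J]]) simp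
      have "emeasure \<xi> (B \<inter> ball undefined (real n)) = of_nat (\<Sum>x\<in>?J. pmult \<xi> x)"
        using B by (intro emeasure_point_measure[OF \<xi>(1) _ J]) (auto simp: \<xi>)
      also have "\<dots> = of_nat ((\<Sum>x\<in>?J. pmult \<mu> x) - (\<Sum>x\<in>?J. pmult \<kappa> x))"
        by (subst sum_subtractf_nat[symmetric]) (auto simp: \<xi>)
      also have "\<dots> = emeasure \<mu> ?J - emeasure \<kappa> ?J"
        unfolding ennreal_of_nat_minus[symmetric]
        using emeasure_point_measure[OF \<mu> Jb J] emeasure_point_measure[OF \<kappa> Jb J] by simp
      also have "\<dots> \<le> (SUP C\<in>{C \<in> sets borel. bounded C \<and> C \<subseteq> B}. emeasure \<mu> C - emeasure \<kappa> C)"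
        by (rule SUP_upper) (use Jb J in \<open>auto simp: finite_imp_bounded\<close>)
      finally show ?thesis .
    qed
    then show "emeasure \<xi> B \<le> (SUP C\<in>{C \<in> sets borel. bounded C \<and> C \<subseteq> B}. emeasure \<mu> C - emeasure \<kappa> C)"
      unfolding emeasure_eq_SUP_ball[OF point_measuresD(2)[OF \<xi>(1)] B] by (rule SUP_least)
  qed
  have "sigma_sets UNIV (sets (borel :: 'a measure)) = sets borel"
    using sets.sigma_sets_eq[of "borel :: 'a measure"] by simp
  then have "point_diff \<mu> \<kappa> = measure_of UNIV (sets borel) (emeasure \<xi>)"
    unfolding point_diff_def by (intro measure_of_eq) (simp_all add: *)
  also have "\<dots> = \<xi>"
    using measure_of_of_measure[of \<xi>] by simp
  finally have eq: "point_diff \<mu> \<kappa> = \<xi>" .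
  show "point_diff \<mu> \<kappa> \<in> point_measures" "pmult (point_diff \<mu> \<kappa>) x = pmult \<mu> x - pmult \<kappa> x"
    unfolding eq by (fact \<xi>)+
qed

text \<open>The balls of radius \<open>1 / (n + 1)\<close> about an enumerated dense set cover the
  space; making them disjoint gives the cells.\<close>

lemma exists_fine_partition:
  obtains A :: "nat \<Rightarrow> nat \<Rightarrow> 'a::polish_space set" where
    "\<And>n j. A n j \<in> sets borel" "\<And>n. disjoint_family (A n)" "\<And>n. (\<Union>j. A n j) = UNIV"
    "\<And>n j x y. x \<in> A n j \<Longrightarrow> y \<in> A n j \<Longrightarrow> dist x y < 2 / (real n + 1)"
proof -
  obtain D :: "'a set" where D: "countable D" "\<And>X. open X \<Longrightarrow> X \<noteq> {} \<Longrightarrow> \<exists>d\<in>D. d \<in> X"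
    using countable_dense_setE by blast
  have "D \<noteq> {}" using D(2)[of UNIV] by auto
  define d where "d = from_nat_into D"
  define A where "A n = disjointed (\<lambda>j. ball (d j) (1 / (real n + 1)))" for n
  have sub: "A n j \<subseteq> ball (d j) (1 / (real n + 1))" for n j
    unfolding A_def by (rule disjointed_subset)
  show thesis
  proof
    show "A n j \<in> sets borel" for n j
      unfolding A_def disjointed_def by simp
    show "disjoint_family (A n)" for n unfolding A_def by (rule disjoint_family_disjointed)
    show "(\<Union>j. A n j) = UNIV" for n
    proof -
      have "\<exists>j. x \<in> ball (d j) (1 / (real n + 1))" for x
      proof -
        obtain z where "z \<in> D" "z \<in> ball x (1 / (real n + 1))" using D(2)[of "ball x (1 / (real n + 1))"] by auto
        then show ?thesis using from_nat_into_surj[OF D(1), of z] by (metis d_def dist_commute mem_ball)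
      qed
      then show ?thesis unfolding A_def UN_disjointed_eq by auto
    qed
    show "dist x y < 2 / (real n + 1)" if "x \<in> A n j" "y \<in> A n j" for n j x y
    proof -
      have "dist (d j) x < 1 / (real n + 1)" "dist (d j) y < 1 / (real n + 1)" using that sub by (auto simp: subset_iff)
      then have "dist x y < 1 / (real n + 1) + 1 / (real n + 1)" using dist_triangle[of x y "d j"] by (simp add: dist_commute)
      then show ?thesis by simp
    qed
  qed
qed

lemma finite_set_separated:
  fixes J :: "'a::metric_space set"
  assumes "finite J"
  obtains n :: nat where "\<And>x y. x \<in> J \<Longrightarrow> y \<in> J \<Longrightarrow> dist x y < 2 / (real n + 1) \<Longrightarrow> x = y"
proof -
  let ?S = "(\<lambda>(x, y). dist x y) ` {(x, y) \<in> J \<times> J. x \<noteq> y}"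
  \<comment> \<open>The extra 1 keeps the minimum defined and positive when \<open>J\<close> has
    fewer than two points.\<close>
  have S: "finite (insert 1 ?S)" 
    by (intro finite.insertI finite_imageI, rule finite_subset[OF _ finite_cartesian_product[OF assms assms]]) auto
  define e where "e = Min (insert 1 ?S)"
  have "\<forall>a\<in>insert 1 ?S. 0 < a" by auto
  then have "0 < e" unfolding e_def using S by (simp only: Min_gr_iff[OF S insert_not_empty])
  then obtain n :: nat where "2 / e < real n" using reals_Archimedean2 by blast
  then have n: "2 / (real n + 1) < e" using \<open>0 < e\<close> by (simp add: field_simps)
  have "x = y" if xy: "x \<in> J" "y \<in> J" "dist x y < 2 / (real n + 1)" for x y
  proof (rule ccontr)
    assume "x \<noteq> y"
    then have "e \<le> dist x y" unfolding e_def using S xy by (intro Min_le) auto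
    with xy n show False by simp
  qed
  then show thesis by (rule that)
qed

text \<open>
  The supremum over Borel sets in \<^const>\<open>point_diff\<close> is attained along partitions into sets of
  vanishing diameter, since these eventually separate the finitely many atoms in a bounded set.
\<close>

lemma measurable_point_diff:
  assumes K: "K \<in> measurable M point_borel" and L: "L \<in> measurable M (point_borel :: 'a::polish_space measure measure)"
  shows "(\<lambda>\<omega>. point_diff (K \<omega>) (L \<omega>)) \<in> measurable M point_borel"
proof (rule measurable_point_borel)
  have KL: "K \<omega> \<in> point_measures" "L \<omega> \<in> point_measures" if "\<omega> \<in> space M" for \<omega>
    using measurable_space[OF K that] measurable_space[OF L that] by (auto simp: space_point_borel)
  show "point_diff (K \<omega>) (L \<omega>) \<in> point_measures" if "\<omega> \<in> space M" for \<omega>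
    using KL[OF that] by (rule point_diff)
  fix B :: "'a set" assume B: "B \<in> sets borel" "bounded B"
  obtain A :: "nat \<Rightarrow> nat \<Rightarrow> 'a set" where A: "\<And>n j. A n j \<in> sets borel" "\<And>n. disjoint_family (A n)" "\<And>n. (\<Union>j. A n j) = UNIV"
    "\<And>n j x y. x \<in> A n j \<Longrightarrow> y \<in> A n j \<Longrightarrow> dist x y < 2 / (real n + 1)"
    using exists_fine_partition by blast
  have [measurable]: "(\<lambda>\<omega>. emeasure (K \<omega>) (B \<inter> A n j)) \<in> borel_measurable M"
    "(\<lambda>\<omega>. emeasure (L \<omega>) (B \<inter> A n j)) \<in> borel_measurable M" for n j
    using A(1) B(1) by (auto intro!: measurable_compose[OF K] measurable_compose[OF L] measurable_emeasure_point_borel)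
  have "(\<lambda>\<omega>. SUP n. \<Sum>j. emeasure (K \<omega>) (B \<inter> A n j) - emeasure (L \<omega>) (B \<inter> A n j)) \<in> borel_measurable M"
    by measurable
  also have "?this \<longleftrightarrow> (\<lambda>\<omega>. emeasure (point_diff (K \<omega>) (L \<omega>)) B) \<in> borel_measurable M"
  proof (rule measurable_cong)
    fix \<omega> assume \<omega>: "\<omega> \<in> space M"
    let ?\<mu> = "K \<omega>" and ?\<kappa> = "L \<omega>"
    define \<xi> where "\<xi> = point_diff ?\<mu> ?\<kappa>"
    note \<mu> = KL(1)[OF \<omega>] and \<kappa> = KL(2)[OF \<omega>]
    have \<xi>: "\<xi> \<in> point_measures" "\<And>x. pmult \<xi> x = pmult ?\<mu> x - pmult ?\<kappa> x"
      unfolding \<xi>_def by (rule point_diff[OF \<mu> \<kappa>])+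
    have BA: "B \<inter> A n j \<in> sets borel" "bounded (B \<inter> A n j)" for n j using A(1) B by (auto simp: bounded_Int)
    have sum: "(\<Sum>j. emeasure \<xi> (B \<inter> A n j)) = emeasure \<xi> B" for n
    proof -
      have "(\<Sum>j. emeasure \<xi> (B \<inter> A n j)) = emeasure \<xi> (\<Union>j. B \<inter> A n j)"
      proof (rule suminf_emeasure)
        show "disjoint_family (\<lambda>j. B \<inter> A n j)"
          using A(2)[of n] unfolding disjoint_family_on_def by blast
      qed (use BA in \<open>auto simp: point_measuresD[OF \<xi>(1)]\<close>)
      also have "(\<Union>j. B \<inter> A n j) = B" using A(3)[of n] by auto
      finally show ?thesis .
    qed
    \<comment> \<open>On a set with several charged points an excess of the second measure at one
      point may cancel an excess of the first at another, which gives only an inequality. With at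
      most one charged point nothing can cancel.\<close>
    have eq: "emeasure ?\<mu> C - emeasure ?\<kappa> C \<le> emeasure \<xi> C" "(\<And>x y. x \<in> C \<Longrightarrow> y \<in> C \<Longrightarrow> pmult ?\<mu> x \<noteq> 0 \<or> pmult ?\<kappa> x \<noteq> 0 \<Longrightarrow> pmult ?\<mu> y \<noteq> 0 \<or> pmult ?\<kappa> y \<noteq> 0 \<Longrightarrow> x = y) \<Longrightarrow>
       emeasure ?\<mu> C - emeasure ?\<kappa> C = emeasure \<xi> C" if C: "C \<in> sets borel" "bounded C" for C
    proof -
      let ?J = "{x \<in> C. pmult ?\<mu> x \<noteq> 0} \<union> {x \<in> C. pmult ?\<kappa> x \<noteq> 0}"
      have J: "finite ?J" using finite_mult_bounded[OF \<mu> C(2)] finite_mult_bounded[OF \<kappa> C(2)] by simp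
      have e: "emeasure ?\<mu> C = of_nat (\<Sum>x\<in>?J. pmult ?\<mu> x)" "emeasure ?\<kappa> C = of_nat (\<Sum>x\<in>?J. pmult ?\<kappa> x)"
        "emeasure \<xi> C = of_nat (\<Sum>x\<in>?J. pmult \<xi> x)"
        by (rule emeasure_point_measure[OF _ C(1) J]; auto simp: \<mu> \<kappa> \<xi>)+
      have "(\<Sum>x\<in>?J. pmult ?\<mu> x) \<le> (\<Sum>x\<in>?J. pmult ?\<kappa> x) + (\<Sum>x\<in>?J. pmult \<xi> x)"
        unfolding sum.distrib[symmetric] by (intro sum_mono) (simp add: \<xi>)
      then show "emeasure ?\<mu> C - emeasure ?\<kappa> C \<le> emeasure \<xi> C"
        unfolding e ennreal_of_nat_minus of_nat_le_iff by simp
      assume *: "\<And>x y. x \<in> C \<Longrightarrow> y \<in> C \<Longrightarrow> pmult ?\<mu> x \<noteq> 0 \<or> pmult ?\<kappa> x \<noteq> 0 \<Longrightarrow> pmult ?\<mu> y \<noteq> 0 \<or> pmult ?\<kappa> y \<noteq> 0 \<Longrightarrow> x = y"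
      have "?J = {} \<or> (\<exists>x. ?J = {x})"
      proof (cases "?J = {}")
        case False
        then obtain x where "x \<in> ?J" by blast
        then have "?J = {x}" using * by blast
        then show ?thesis by blast
      qed simp
      then show "emeasure ?\<mu> C - emeasure ?\<kappa> C = emeasure \<xi> C"
        unfolding e by (elim disjE exE; simp only: sum.empty sum.insert finite.intros empty_iff not_False_eq_True add_0_right \<xi> ennreal_of_nat_minus; simp)
    qed
    obtain N :: nat where N: "\<And>x y. x \<in> {x \<in> B. pmult ?\<mu> x \<noteq> 0} \<union> {x \<in> B. pmult ?\<kappa> x \<noteq> 0} \<Longrightarrow> y \<in> {x \<in> B. pmult ?\<mu> x \<noteq> 0} \<union> {x \<in> B. pmult ?\<kappa> x \<noteq> 0}
        \<Longrightarrow> dist x y < 2 / (real N + 1) \<Longrightarrow> x = y"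
      using finite_set_separated finite_mult_bounded[OF \<mu> B(2)] finite_mult_bounded[OF \<kappa> B(2)] by (metis (no_types, lifting) finite_UnI)
    show "(SUP n. \<Sum>j. emeasure ?\<mu> (B \<inter> A n j) - emeasure ?\<kappa> (B \<inter> A n j)) = emeasure (point_diff ?\<mu> ?\<kappa>) B"
      unfolding \<xi>_def[symmetric]
    proof (rule antisym)
      show "(SUP n. \<Sum>j. emeasure ?\<mu> (B \<inter> A n j) - emeasure ?\<kappa> (B \<inter> A n j)) \<le> emeasure \<xi> B"
      proof (rule SUP_least)
        show "(\<Sum>j. emeasure ?\<mu> (B \<inter> A n j) - emeasure ?\<kappa> (B \<inter> A n j)) \<le> emeasure \<xi> B" for n
          unfolding sum[of n, symmetric] by (intro suminf_le eq(1) BA) auto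
      qed
      have "emeasure \<xi> B = (\<Sum>j. emeasure ?\<mu> (B \<inter> A N j) - emeasure ?\<kappa> (B \<inter> A N j))"
        unfolding sum[of N, symmetric]
      proof (rule suminf_cong)
        fix j
        show "emeasure \<xi> (B \<inter> A N j) = emeasure ?\<mu> (B \<inter> A N j) - emeasure ?\<kappa> (B \<inter> A N j)"
          using A(4) by (intro eq(2)[symmetric] BA N) auto
      qed
      also have "\<dots> \<le> (SUP n. \<Sum>j. emeasure ?\<mu> (B \<inter> A n j) - emeasure ?\<kappa> (B \<inter> A n j))" by (rule SUP_upper) simp
      finally show "emeasure \<xi> B \<le> (SUP n. \<Sum>j. emeasure ?\<mu> (B \<inter> A n j) - emeasure ?\<kappa> (B \<inter> A n j))" .
    qed
  qed
  finally show "(\<lambda>\<omega>. emeasure (point_diff (K \<omega>) (L \<omega>)) B) \<in> borel_measurable M" .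
qed

section \<open>A multiplicative class theorem for integer valued functions\<close>

text \<open>A functional monotone class theorem for an arbitrary property \<open>H\<close>. Lists
  \<open>js\<close> with repetitions provide all natural exponents, so the exponentials are closed
  under products; as the \<open>Y j\<close> are integer valued, indicators of \<open>Y j = n\<close>
  can be extracted from them by explicit limits.\<close>

locale multiplicative_class =
  fixes M :: "'w measure" and Y :: "'j \<Rightarrow> 'w \<Rightarrow> real" and J :: "'j set" and H :: "('w \<Rightarrow> real) \<Rightarrow> bool"
  assumes Y: "\<And>j \<omega>. j \<in> J \<Longrightarrow> \<omega> \<in> space M \<Longrightarrow> Y j \<omega> \<in> \<nat>"
    and gen: "sets M = sigma_sets (space M) {{\<omega> \<in> space M. Y j \<omega> = real n} | j n. j \<in> J}"
    and lin: "\<And>F G a b. H F \<Longrightarrow> H G \<Longrightarrow> H (\<lambda>\<omega>. a * F \<omega> + b * G \<omega>)"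
    and lim: "\<And>F G C. (\<And>i. H (F i)) \<Longrightarrow> (\<And>i \<omega>. \<omega> \<in> space M \<Longrightarrow> \<bar>F i \<omega>\<bar> \<le> C) \<Longrightarrow>
       (\<And>\<omega>. \<omega> \<in> space M \<Longrightarrow> (\<lambda>i::nat. F i \<omega>) \<longlonglongrightarrow> G \<omega>) \<Longrightarrow> H G"
    and exp: "\<And>js. set js \<subseteq> J \<Longrightarrow> H (\<lambda>\<omega>. exp (- (\<Sum>j\<leftarrow>js. Y j \<omega>)))"
begin

text \<open>A constant sequence in \<open>lim\<close>: for bounded functions only the values on
  \<open>space M\<close> matter.\<close>

lemma cong:
  assumes "H F" "\<And>\<omega>. \<omega> \<in> space M \<Longrightarrow> F \<omega> = G \<omega>" "\<And>\<omega>. \<omega> \<in> space M \<Longrightarrow> \<bar>G \<omega>\<bar> \<le> C"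
  shows "H G"
  by (rule lim[of "\<lambda>_. F" C]) (use assms in auto)

lemma one: "H (\<lambda>\<omega>. 1)"
  using exp[of "[]"] by simp

lemma setsum: "finite S \<Longrightarrow> (\<And>k. k \<in> S \<Longrightarrow> H (F k)) \<Longrightarrow> H (\<lambda>\<omega>. \<Sum>k\<in>S. a k * F k \<omega>)"
proof (induction S rule: finite_induct)
  case empty
  then show ?case using lin[OF one one, of 0 0] by simp
next
  case (insert k S)
  then show ?case using lin[of "F k" "\<lambda>\<omega>. \<Sum>k\<in>S. a k * F k \<omega>" "a k" 1] by simp
qed

primrec holds :: "('j \<times> nat) list \<Rightarrow> 'w \<Rightarrow> real" where
  "holds [] = (\<lambda>\<omega>. 1)"
| "holds (c # cs) = (\<lambda>\<omega>. holds cs \<omega> * (if Y (fst c) \<omega> = real (snd c) then 1 else 0))"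

lemma holds_bounds: "0 \<le> holds cs \<omega>" "holds cs \<omega> \<le> 1"
  by (induction cs) (auto simp: mult_le_one)

lemma sum_nonneg: "set js \<subseteq> J \<Longrightarrow> \<omega> \<in> space M \<Longrightarrow> 0 \<le> (\<Sum>j\<leftarrow>js. Y j \<omega>)"
  using Y by (intro sum_list_nonneg) (force simp: Nats_def)

text \<open>
  The indicator of \<open>Y = n\<close> is the limit for \<open>m \<rightarrow> \<infinity>\<close> of
  \<open>exp (m n) (exp (- m Y) - (\<Sum>k<n. exp (- m k) 1\<^bsub>Y=k\<^esub>))\<close>.
\<close>

lemma exp_holds:
  assumes "fst ` set cs \<subseteq> J" "set js \<subseteq> J"
  shows "H (\<lambda>\<omega>. exp (- (\<Sum>j\<leftarrow>js. Y j \<omega>)) * holds cs \<omega>)"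
  using assms
proof (induction cs arbitrary: js)
  case Nil
  then show ?case using exp by simp
next
  case (Cons c cs)
  obtain j n where c: "c = (j, n)" by (cases c)
  have j: "j \<in> J" using Cons.prems c by auto
  define G where "G js \<omega> = exp (- (\<Sum>j\<leftarrow>js. Y j \<omega>)) * holds cs \<omega>" for js \<omega>
  have HG: "H (G js)" if "set js \<subseteq> J" for js
    using Cons.IH[of js] Cons.prems that by (simp add: G_def[abs_def])
  have Gb: "0 \<le> G js \<omega>" "G js \<omega> \<le> 1" if "\<omega> \<in> space M" for \<omega>
    using holds_bounds[of cs \<omega>] sum_nonneg[OF Cons.prems(2) that] by (auto simp: G_def mult_le_one)
  have "H (\<lambda>\<omega>. G js \<omega> * (if Y j \<omega> = real n then 1 else 0))"
  \<comment> \<open>The correction term involves the indicators of \<open>Y j = k\<close> for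
    \<open>k < n\<close> only, for which the claim is the induction hypothesis.\<close>
  proof (induction n rule: less_induct)
    case (less n)
    define F where "F m \<omega> = exp (real m * real n) * G (replicate m j @ js) \<omega>
       + (-1) * (\<Sum>k\<in>{..<n}. exp (real m * (real n - real k)) * (G js \<omega> * (if Y j \<omega> = real k then 1 else 0)))" for m :: nat and \<omega>
    have HF: "H (F m)" for m
      unfolding F_def using j Cons.prems by (intro lin HG setsum less) auto
    \<comment> \<open>The three regimes that give the limit: values below \<open>n\<close> are
      cancelled exactly, the value \<open>n\<close> contributes 1 for every \<open>m\<close>, and
      values above \<open>n\<close> decay geometrically in \<open>m\<close>.\<close>
    have F: "F m \<omega> = G js \<omega> * (if Y j \<omega> < real n then 0 else exp (- real m * (Y j \<omega> - real n)))" if \<omega>: "\<omega> \<in> space M" for m \<omega>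
    proof -
      obtain y where y: "Y j \<omega> = real y" using Y[OF j \<omega>] by (auto simp: Nats_def)
      have 1: "G (replicate m j @ js) \<omega> = exp (- real m * Y j \<omega>) * G js \<omega>"
        by (simp add: G_def sum_list_replicate exp_add[symmetric] exp_diff exp_minus field_simps)
      have "(\<Sum>k\<in>{..<n}. exp (real m * (real n - real k)) * (G js \<omega> * (if Y j \<omega> = real k then 1 else 0)))
          = (\<Sum>k\<in>{..<n}. if k = y then exp (real m * (real n - real k)) * G js \<omega> else 0)"
        by (intro sum.cong) (auto simp: y)
      also have "\<dots> = (if y < n then exp (real m * (real n - real y)) * G js \<omega> else 0)"
        by (simp add: sum.delta)
      finally have 2: "(\<Sum>k\<in>{..<n}. exp (real m * (real n - real k)) * (G js \<omega> * (if Y j \<omega> = real k then 1 else 0)))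
          = (if y < n then exp (real m * (real n - real y)) * G js \<omega> else 0)" .
      have "exp (real m * real n) * (exp (- real m * real y) * G js \<omega>) = exp (real m * (real n - real y)) * G js \<omega>"
        unfolding mult.assoc[symmetric] exp_add[symmetric] by (simp add: right_diff_distrib)
      moreover have "- real m * (real y - real n) = real m * (real n - real y)" by (simp add: algebra_simps)
      ultimately show ?thesis unfolding F_def 1 2 unfolding y by (cases "y < n") (simp_all add: mult.commute)
    qed
    show ?case
    proof (rule lim[of F 1])
      show "H (F m)" for m by (rule HF)
      show "\<bar>F m \<omega>\<bar> \<le> 1" if "\<omega> \<in> space M" for m \<omega>
        unfolding F[OF that] using Gb[OF that] by (auto simp: abs_mult mult_le_one)
      fix \<omega> assume \<omega>: "\<omega> \<in> space M"
      obtain y where y: "Y j \<omega> = real y" using Y[OF j \<omega>] by (auto simp: Nats_def)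
      consider "y < n" | "y = n" | "n < y" by linarith
      then show "(\<lambda>m. F m \<omega>) \<longlonglongrightarrow> G js \<omega> * (if Y j \<omega> = real n then 1 else 0)"
      proof cases
        case 3
        have "(\<lambda>m. G js \<omega> * exp (- (real y - real n)) ^ m) \<longlonglongrightarrow> G js \<omega> * 0"
          using 3 by (intro tendsto_mult tendsto_const LIMSEQ_realpow_zero) auto
        moreover have "exp (- (real y - real n)) ^ m = exp (- real m * (real y - real n))" for m
          by (subst exp_of_nat_mult[symmetric]) (simp add: algebra_simps)
        ultimately show ?thesis using 3 by (simp add: F[OF \<omega>] y)
      qed (simp_all add: F[OF \<omega>] y)
    qed
  qed
  then show ?case by (simp add: G_def c mult.assoc)
qed

text \<open>The events prescribing finitely many values form an intersection-stable generator, and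
  their indicators are the functions \<open>holds cs\<close>. Linearity and bounded limits supply
  complements and disjoint unions.\<close>

lemma indicator:
  assumes A: "A \<in> sets M"
  shows "H (indicator A)"
proof -
  define \<G> where "\<G> = {{\<omega> \<in> space M. \<forall>c\<in>set cs. Y (fst c) \<omega> = real (snd c)} | cs. fst ` set cs \<subseteq> J}"
  have "sigma_sets (space M) {{\<omega> \<in> space M. Y j \<omega> = real n} | j n. j \<in> J} = sigma_sets (space M) \<G>"
  proof (rule sigma_sets_eqI)
    fix A assume "A \<in> {{\<omega> \<in> space M. Y j \<omega> = real n} | j n. j \<in> J}"
    then obtain j n where "A = {\<omega> \<in> space M. \<forall>c\<in>set [(j, n)]. Y (fst c) \<omega> = real (snd c)}" "j \<in> J" by auto
    then show "A \<in> sigma_sets (space M) \<G>" unfolding \<G>_def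
      by (intro sigma_sets.Basic CollectI exI[of _ "[(j, n)]"]) auto
  next
    fix A assume "A \<in> \<G>"
    then obtain cs where cs: "A = {\<omega> \<in> space M. \<forall>c\<in>set cs. Y (fst c) \<omega> = real (snd c)}" "fst ` set cs \<subseteq> J" unfolding \<G>_def by auto
    have "{\<omega> \<in> space M. Y (fst c) \<omega> = real (snd c)} \<in> sets M" if "c \<in> set cs" for c
      unfolding gen using cs that by (intro sigma_sets.Basic) auto
    then have "{\<omega> \<in> space M. \<forall>c\<in>set cs. Y (fst c) \<omega> = real (snd c)} \<in> sets M"
      by (intro sets.sets_Collect_finite_All) auto
    then show "A \<in> sigma_sets (space M) {{\<omega> \<in> space M. Y j \<omega> = real n} | j n. j \<in> J}"
      unfolding cs gen .
  qed
  then have A': "A \<in> sigma_sets (space M) \<G>" using A gen by simp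
  have I: "Int_stable \<G>"
  proof (rule Int_stableI)
    fix a b assume "a \<in> \<G>" "b \<in> \<G>"
    then obtain cs ds where "fst ` set cs \<subseteq> J" "fst ` set ds \<subseteq> J"
      "a = {\<omega> \<in> space M. \<forall>c\<in>set cs. Y (fst c) \<omega> = real (snd c)}" "b = {\<omega> \<in> space M. \<forall>c\<in>set ds. Y (fst c) \<omega> = real (snd c)}"
      unfolding \<G>_def by auto
    then show "a \<inter> b \<in> \<G>" unfolding \<G>_def by (intro CollectI exI[of _ "cs @ ds"]) auto
  qed
  have P: "\<G> \<subseteq> Pow (space M)" unfolding \<G>_def by auto
  show ?thesis using I P A'
  proof (induction rule: sigma_sets_induct_disjoint)
    case (basic A)
    then obtain cs where cs: "A = {\<omega> \<in> space M. \<forall>c\<in>set cs. Y (fst c) \<omega> = real (snd c)}" "fst ` set cs \<subseteq> J" unfolding \<G>_def by auto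
    have "holds cs \<omega> = (if \<forall>c\<in>set cs. Y (fst c) \<omega> = real (snd c) then 1 else 0)" for \<omega> by (induction cs) auto
    then have eq: "holds cs \<omega> = indicator A \<omega>" if "\<omega> \<in> space M" for \<omega> using that by (simp add: cs(1))
    have "H (holds cs)" using exp_holds[OF cs(2), of "[]"] by simp
    then show ?case by (rule cong[where C=1]) (auto simp: eq indicator_def)
  next
    case empty
    show ?case using lin[OF one one, of 0 0] by (simp add: indicator_def[abs_def])
  next
    case (compl A)
    show ?case
      by (rule cong[OF lin[OF one compl(2), of 1 "-1"], of _ 1]) (auto simp: indicator_def)
  next
    case (union A)
    show ?case
    proof (rule lim[of "\<lambda>n \<omega>. \<Sum>i\<in>{..<n}. 1 * indicator (A i) \<omega>" 1])
      show "H (\<lambda>\<omega>. \<Sum>i\<in>{..<n}. 1 * indicator (A i) \<omega>)" for n by (rule setsum) (auto simp: union)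
      have *: "(\<Sum>i\<in>{..<n}. 1 * indicator (A i) \<omega>) = (indicator (\<Union>i\<in>{..<n}. A i) \<omega> :: real)" for n :: nat and \<omega>
      proof -
        have "disjoint_family_on A {..<n}" using union(1) by (auto simp: disjoint_family_on_def)
        then show ?thesis by (simp add: indicator_UN_disjoint)
      qed
      show "\<bar>\<Sum>i\<in>{..<n}. 1 * indicator (A i) \<omega>\<bar> \<le> (1::real)" for n \<omega> unfolding * by (simp add: indicator_def)
      show "(\<lambda>n. \<Sum>i\<in>{..<n}. 1 * indicator (A i) \<omega>) \<longlonglongrightarrow> (indicator (\<Union>i. A i) \<omega> :: real)" for \<omega>
        unfolding * by (rule LIMSEQ_indicator_UN)
    qed
  qed
qed

end

section \<open>Kernels and laws determined by integrals of exponentials\<close>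

lemma borel_measurable_Nats:
  fixes Y :: "'w \<Rightarrow> real"
  assumes "\<And>\<omega>. \<omega> \<in> space M \<Longrightarrow> Y \<omega> \<in> \<nat>" "\<And>n. {\<omega> \<in> space M. Y \<omega> = real n} \<in> sets M"
  shows "Y \<in> borel_measurable M"
proof -
  have "Y \<in> measurable M (count_space (range real))"
  proof (subst measurable_count_space_eq_countable, safe)
    show "Y \<omega> \<in> range real" if "\<omega> \<in> space M" for \<omega> using assms(1)[OF that] by (simp add: Nats_def)
    fix n
    show "Y -` {real n} \<inter> space M \<in> sets M" using assms(2)[of n] by (simp add: vimage_def Int_def conj_commute)
  qed simp
  moreover have "(\<lambda>x. x) \<in> measurable (count_space (range real)) borel" by simp
  ultimately show ?thesis by (rule measurable_compose)
qed

text \<open>The functions \<open>F\<close> whose integral against \<open>K x\<close> is measurable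
  in \<open>x\<close> are closed under linear combinations and, by dominated convergence, under
  bounded limits. The class theorem therefore leads from exponentials to indicators. This is how the
  thinning kernel becomes available to \<open>bind\<close>.\<close>

lemma measurable_kernel_of_exp_integrals:
  fixes Y :: "'j \<Rightarrow> 'w \<Rightarrow> real"
  assumes Y: "\<And>j \<omega>. j \<in> J \<Longrightarrow> \<omega> \<in> space M \<Longrightarrow> Y j \<omega> \<in> \<nat>"
    and gen: "sets M = sigma_sets (space M) {{\<omega> \<in> space M. Y j \<omega> = real n} | j n. j \<in> J}"
    and K: "\<And>x. x \<in> space N \<Longrightarrow> prob_space (K x)" "\<And>x. x \<in> space N \<Longrightarrow> sets (K x) = sets M"
    and eq: "\<And>js. set js \<subseteq> J \<Longrightarrow> (\<lambda>x. \<integral>\<^sup>+\<omega>. ennreal (exp (- (\<Sum>j\<leftarrow>js. Y j \<omega>))) \<partial>K x) \<in> borel_measurable N"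
  shows "K \<in> measurable N (prob_algebra M)"
proof (rule measurable_prob_algebraI[OF K(1) measurable_subprob_algebra[OF prob_space_imp_subprob_space[OF K(1)] K(2)]])
  fix A assume A: "A \<in> sets M"
  have Ym: "Y j \<in> borel_measurable M" if j: "j \<in> J" for j
  proof (rule borel_measurable_Nats[OF Y[OF j]])
    show "{\<omega> \<in> space M. Y j \<omega> = real n} \<in> sets M" for n
      unfolding gen using j by (intro sigma_sets.Basic) auto
  qed
  have sp: "space (K x) = space M" if "x \<in> space N" for x by (rule sets_eq_imp_space_eq[OF K(2)[OF that]])
  have m: "borel_measurable (K x) = borel_measurable M" if "x \<in> space N" for x
    by (rule measurable_cong_sets[OF K(2)[OF that] refl])
  \<comment> \<open>Boundedness belongs to the class so that its members are integrable against
    every probability \<open>K x\<close>.\<close>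
  define H where "H F \<longleftrightarrow> F \<in> borel_measurable M \<and> (\<exists>C. \<forall>\<omega>\<in>space M. \<bar>F \<omega>\<bar> \<le> C) \<and> (\<lambda>x. \<integral>\<omega>. F \<omega> \<partial>K x) \<in> borel_measurable N" for F :: "'w \<Rightarrow> real"
  have int: "integrable (K x) F" if "x \<in> space N" "F \<in> borel_measurable M" "\<And>\<omega>. \<omega> \<in> space M \<Longrightarrow> \<bar>F \<omega>\<bar> \<le> C" for F :: "'w \<Rightarrow> real" and C x
  proof -
    interpret prob_space "K x" using K that by blast
    show ?thesis using that by (auto intro!: integrable_const_bound[of _ C] simp: sp m)
  qed
  interpret multiplicative_class M Y J H
  proof
    fix F G a b assume "H F" "H G"
    then obtain C D where C: "F \<in> borel_measurable M" "\<And>\<omega>. \<omega> \<in> space M \<Longrightarrow> \<bar>F \<omega>\<bar> \<le> C" "(\<lambda>x. \<integral>\<omega>. F \<omega> \<partial>K x) \<in> borel_measurable N"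
      and D: "G \<in> borel_measurable M" "\<And>\<omega>. \<omega> \<in> space M \<Longrightarrow> \<bar>G \<omega>\<bar> \<le> D" "(\<lambda>x. \<integral>\<omega>. G \<omega> \<partial>K x) \<in> borel_measurable N"
      unfolding H_def by blast
    have "\<bar>a * F \<omega> + b * G \<omega>\<bar> \<le> \<bar>a\<bar> * C + \<bar>b\<bar> * D" if "\<omega> \<in> space M" for \<omega>
      using mult_left_mono[OF C(2)[OF that], of "\<bar>a\<bar>"] mult_left_mono[OF D(2)[OF that], of "\<bar>b\<bar>"]
        abs_triangle_ineq[of "a * F \<omega>" "b * G \<omega>"] by (simp add: abs_mult)
    moreover have "(\<lambda>x. \<integral>\<omega>. a * F \<omega> + b * G \<omega> \<partial>K x) \<in> borel_measurable N"
    proof (subst measurable_cong)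
      show "(\<integral>\<omega>. a * F \<omega> + b * G \<omega> \<partial>K x) = a * (\<integral>\<omega>. F \<omega> \<partial>K x) + b * (\<integral>\<omega>. G \<omega> \<partial>K x)" if "x \<in> space N" for x
        using int[OF that C(1,2)] int[OF that D(1,2)] by simp
      show "(\<lambda>x. a * (\<integral>\<omega>. F \<omega> \<partial>K x) + b * (\<integral>\<omega>. G \<omega> \<partial>K x)) \<in> borel_measurable N" using C(3) D(3) by measurable
    qed
    ultimately show "H (\<lambda>\<omega>. a * F \<omega> + b * G \<omega>)"
      unfolding H_def using C(1) D(1) by auto
  next
    fix F :: "nat \<Rightarrow> 'w \<Rightarrow> real" and G C assume F: "\<And>i. H (F i)" and C: "\<And>i \<omega>. \<omega> \<in> space M \<Longrightarrow> \<bar>F i \<omega>\<bar> \<le> C"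
      and lim: "\<And>\<omega>. \<omega> \<in> space M \<Longrightarrow> (\<lambda>i. F i \<omega>) \<longlonglongrightarrow> G \<omega>"
    have Fm: "F i \<in> borel_measurable M" for i using F by (simp add: H_def)
    have Gm: "G \<in> borel_measurable M" by (rule borel_measurable_LIMSEQ_real[OF lim Fm])
    have "(\<lambda>i. \<integral>\<omega>. F i \<omega> \<partial>K x) \<longlonglongrightarrow> (\<integral>\<omega>. G \<omega> \<partial>K x)" if "x \<in> space N" for x
    proof -
      interpret prob_space "K x" using K that by blast
      show ?thesis
        by (rule integral_dominated_convergence[where w="\<lambda>_. C"]) (auto simp: m sp that Fm Gm lim C)
    qed
    then have "(\<lambda>x. \<integral>\<omega>. G \<omega> \<partial>K x) \<in> borel_measurable N"
      by (rule borel_measurable_LIMSEQ_real) (use F in \<open>auto simp: H_def\<close>)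
    moreover have "\<bar>G \<omega>\<bar> \<le> C" if "\<omega> \<in> space M" for \<omega>
      by (rule LIMSEQ_le_const2[OF tendsto_rabs[OF lim[OF that]]]) (use C[OF that] in blast)
    ultimately show "H G" unfolding H_def using Gm by blast
  next
    fix js assume js: "set js \<subseteq> J"
    let ?e = "\<lambda>\<omega>. exp (- (\<Sum>j\<leftarrow>js. Y j \<omega>))"
    have em: "?e \<in> borel_measurable M"
    proof -
      have "(\<lambda>\<omega>. \<Sum>j\<leftarrow>js. Y j \<omega>) \<in> borel_measurable M" using js by (induction js) (auto intro!: borel_measurable_add Ym)
      then show ?thesis by measurable
    qed
    have "\<bar>?e \<omega>\<bar> \<le> 1" if "\<omega> \<in> space M" for \<omega>
    proof -
      have "0 \<le> (\<Sum>j\<leftarrow>js. Y j \<omega>)" using Y js that by (intro sum_list_nonneg) (force simp: Nats_def)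
      then show ?thesis by simp
    qed
    moreover have "(\<lambda>x. \<integral>\<omega>. ?e \<omega> \<partial>K x) \<in> borel_measurable N"
    proof (subst measurable_cong)
      show "(\<integral>\<omega>. ?e \<omega> \<partial>K x) = enn2real (\<integral>\<^sup>+\<omega>. ennreal (?e \<omega>) \<partial>K x)" if "x \<in> space N" for x
        using em that by (simp add: integral_eq_nn_integral m)
      show "(\<lambda>x. enn2real (\<integral>\<^sup>+\<omega>. ennreal (?e \<omega>) \<partial>K x)) \<in> borel_measurable N" using eq[OF js] by measurable
    qed
    ultimately show "H ?e" unfolding H_def using em by blast
  qed (use Y gen in auto)
  have "(\<lambda>x. ennreal (\<integral>\<omega>. indicator A \<omega> \<partial>K x)) \<in> borel_measurable N"
    using indicator[OF A] by (auto simp: H_def)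
  then show "(\<lambda>x. emeasure (K x) A) \<in> borel_measurable N"
  proof (rule measurable_cong[THEN iffD1, rotated])
    fix x assume x: "x \<in> space N"
    interpret prob_space "K x" using K x by blast
    show "ennreal (\<integral>\<omega>. indicator A \<omega> \<partial>K x) = emeasure (K x) A"
      using A sets.sets_into_space[OF A] by (simp add: emeasure_eq_measure sp x K Int_absorb2)
  qed
qed

text \<open>A kernel from the trivial measurable space on two points is constant.\<close>

lemma measure_eq_of_exp_integrals:
  fixes Y :: "'j \<Rightarrow> 'w \<Rightarrow> real"
  assumes Y: "\<And>j \<omega>. j \<in> J \<Longrightarrow> \<omega> \<in> space M \<Longrightarrow> Y j \<omega> \<in> \<nat>"
    and gen: "sets M = sigma_sets (space M) {{\<omega> \<in> space M. Y j \<omega> = real n} | j n. j \<in> J}"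
    and PQ: "prob_space P" "prob_space Q" "sets P = sets M" "sets Q = sets M"
    and eq: "\<And>js. set js \<subseteq> J \<Longrightarrow> (\<integral>\<^sup>+\<omega>. ennreal (exp (- (\<Sum>j\<leftarrow>js. Y j \<omega>))) \<partial>P) = (\<integral>\<^sup>+\<omega>. ennreal (exp (- (\<Sum>j\<leftarrow>js. Y j \<omega>))) \<partial>Q)"
  shows "P = Q"
proof (rule measure_eqI)
  show "sets P = sets Q" using PQ by simp
  let ?N = "sigma (UNIV :: bool set) {}"
  let ?K = "\<lambda>b. if b then P else Q"
  have K: "?K \<in> measurable ?N (prob_algebra M)"
  proof (rule measurable_kernel_of_exp_integrals[OF Y gen])
    show "prob_space (?K b)" "sets (?K b) = sets M" for b using PQ by auto
    fix js assume "set js \<subseteq> J"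
    from eq[OF this] have "(\<lambda>b. \<integral>\<^sup>+\<omega>. ennreal (exp (- (\<Sum>j\<leftarrow>js. Y j \<omega>))) \<partial>?K b)
        = (\<lambda>_. \<integral>\<^sup>+\<omega>. ennreal (exp (- (\<Sum>j\<leftarrow>js. Y j \<omega>))) \<partial>P)"
      by (intro ext) simp
    then show "(\<lambda>b. \<integral>\<^sup>+\<omega>. ennreal (exp (- (\<Sum>j\<leftarrow>js. Y j \<omega>))) \<partial>?K b) \<in> borel_measurable ?N"
      by (simp only: borel_measurable_const)
  qed
  fix A assume "A \<in> sets P"
  then have A: "A \<in> sets M" using PQ by simp
  have "(\<lambda>b. emeasure (?K b) A) \<in> borel_measurable ?N"
    by (rule measurable_emeasure_kernel[OF measurable_prob_algebraD[OF K] A])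
  then have "(\<lambda>b. emeasure (?K b) A) -` {emeasure P A} \<inter> space ?N \<in> sets ?N" by (rule measurable_sets) simp
  then have "(\<lambda>b. emeasure (?K b) A) -` {emeasure P A} \<in> {{}, UNIV}"
    by (simp add: space_measure_of_conv sets_measure_of sigma_sets_empty_eq)
  moreover have "True \<in> (\<lambda>b. emeasure (?K b) A) -` {emeasure P A}" by simp
  ultimately have "False \<in> (\<lambda>b. emeasure (?K b) A) -` {emeasure P A}" by blast
  then show "emeasure P A = emeasure Q A" by simp
qed

section \<open>Laplace functionals\<close>

text \<open>Exactly the functions over which \<open>has_poisson_law\<close> quantifies.\<close>

definition laplace_test :: "('a::polish_space \<Rightarrow> real) \<Rightarrow> bool" where
  "laplace_test f \<longleftrightarrow> bounded_support_fun f \<and> (\<forall>x. 0 \<le> f x)"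

abbreviation laplace :: "('a \<Rightarrow> real) \<Rightarrow> 'a::polish_space measure \<Rightarrow> real" where
  "laplace f \<mu> \<equiv> exp (- (\<integral>x. f x \<partial>\<mu>))"

abbreviation bounded_borel :: "'a::polish_space set set" where
  "bounded_borel \<equiv> {B \<in> sets borel. bounded B}"

lemma measure_point_measure_Nats:
  assumes "\<mu> \<in> point_measures" "B \<in> bounded_borel"
  shows "measure \<mu> B \<in> \<nat>" "emeasure \<mu> B = ennreal (measure \<mu> B)"
proof -
  have "emeasure \<mu> B \<in> \<nat>" using assms by (intro point_measuresD) auto
  then obtain n where "emeasure \<mu> B = of_nat n" by (auto simp: Nats_def)
  then have "emeasure \<mu> B = ennreal (real n)" by (simp add: ennreal_of_nat_eq_real_of_nat)
  then show "measure \<mu> B \<in> \<nat>" "emeasure \<mu> B = ennreal (measure \<mu> B)"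
    by (simp_all add: measure_def)
qed

text \<open>Counts take countably many values, so their level sets suffice. This matches the
  generators expected by \<open>multiplicative_class\<close>.\<close>

lemma measurable_point_borel_count:
  fixes K :: "'w \<Rightarrow> 'a::polish_space measure"
  assumes K: "\<And>x. x \<in> space N \<Longrightarrow> K x \<in> point_measures"
    and c: "\<And>B n. B \<in> bounded_borel \<Longrightarrow> {x \<in> space N. measure (K x) B = real n} \<in> sets N"
  shows "K \<in> measurable N point_borel"
proof (rule measurable_point_borel[OF K])
  fix B :: "'a set" assume B: "B \<in> sets borel" "bounded B"
  then have B': "B \<in> bounded_borel" by simp
  have "(\<lambda>x. measure (K x) B) \<in> borel_measurable N"
    by (rule borel_measurable_Nats[OF measure_point_measure_Nats(1)[OF K B'] c[OF B']])
  then have "(\<lambda>x. ennreal (measure (K x) B)) \<in> borel_measurable N" by measurable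
  then show "(\<lambda>x. emeasure (K x) B) \<in> borel_measurable N"
    by (rule measurable_cong[THEN iffD1, rotated]) (rule measure_point_measure_Nats(2)[OF K B', symmetric])
qed

lemma measurable_measure_point_borel:
  assumes "B \<in> sets borel"
  shows "(\<lambda>\<mu>. measure \<mu> B) \<in> borel_measurable point_borel"
  unfolding measure_def
  by (rule borel_measurable_enn2real[OF measurable_emeasure_point_borel[OF assms]])

text \<open>The substantial inclusion says that the identity is measurable from the sigma-algebra
  generated by the counts to \<open>point_borel\<close>, which is a case of
  \<open>measurable_point_borel_count\<close>.\<close>

lemma sets_point_borel_generated:
  "sets (point_borel :: 'a::polish_space measure measure) =
     sigma_sets (space point_borel) {{\<mu> \<in> space point_borel. measure \<mu> B = real n} | B n. B \<in> bounded_borel}"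
  (is "_ = sigma_sets ?\<Omega> ?G")
proof (rule antisym)
  let ?N = "sigma ?\<Omega> ?G"
  have G: "?G \<subseteq> Pow ?\<Omega>" by blast
  have "(\<lambda>\<mu>. \<mu>) \<in> measurable ?N point_borel"
  proof (rule measurable_point_borel_count)
    show "\<mu> \<in> point_measures" if "\<mu> \<in> space ?N" for \<mu>
      using that by (simp add: space_measure_of_conv space_point_borel)
    show "{\<mu> \<in> space ?N. measure \<mu> B = real n} \<in> sets ?N" if "B \<in> bounded_borel" for B n
      unfolding space_measure_of_conv sets_measure_of[OF G]
      by (rule sigma_sets.Basic) (use that in blast)
  qed
  then have *: "A \<inter> ?\<Omega> \<in> sets ?N" if "A \<in> sets point_borel" for A
    using measurable_sets[OF _ that, of "\<lambda>\<mu>. \<mu>" ?N] by (simp add: space_measure_of_conv)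
  show "sets point_borel \<subseteq> sigma_sets ?\<Omega> ?G"
  proof
    fix A :: "'a measure set" assume A: "A \<in> sets point_borel"
    then have eq: "A \<inter> ?\<Omega> = A" using sets.sets_into_space[OF A] by blast
    show "A \<in> sigma_sets ?\<Omega> ?G" using *[OF A] unfolding sets_measure_of[OF G] eq .
  qed
  show "sigma_sets ?\<Omega> ?G \<subseteq> sets point_borel"
  proof (rule sets.sigma_sets_subset, safe)
    fix B :: "'a set" and n assume "B \<in> sets borel"
    then have [measurable]: "(\<lambda>\<mu>. measure \<mu> B) \<in> borel_measurable point_borel" by (rule measurable_measure_point_borel)
    show "{\<mu> \<in> space point_borel. measure \<mu> B = real n} \<in> sets point_borel" by measurable
  qed
qed

lemma space_PiM_point_borelD:
  "\<omega> \<in> space (PiM I (\<lambda>_. point_borel)) \<Longrightarrow> i \<in> I \<Longrightarrow> \<omega> i \<in> point_measures"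
  by (auto simp: space_PiM space_point_borel)

lemma sets_PiM_point_borel_generated:
  fixes I :: "'i set"
  defines "M \<equiv> PiM I (\<lambda>_. point_borel :: 'a::polish_space measure measure)"
  shows "sets M = sigma_sets (space M) {{\<omega> \<in> space M. measure (\<omega> (fst j)) (snd j) = real n} | j n. j \<in> I \<times> bounded_borel}"
  (is "_ = sigma_sets _ ?G")
proof (rule antisym)
  let ?N = "sigma (space M) ?G"
  have G: "?G \<subseteq> Pow (space M)" by blast
  have "(\<lambda>\<omega> i. \<omega> i) \<in> measurable ?N (PiM I (\<lambda>_. point_borel))"
  proof (rule measurable_PiM_single'[where f="\<lambda>i \<omega>. \<omega> i"])
    show "(\<lambda>\<omega>. \<omega> i) \<in> measurable ?N point_borel" if i: "i \<in> I" for i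
    proof (rule measurable_point_borel_count)
      show "\<omega> i \<in> point_measures" if "\<omega> \<in> space ?N" for \<omega>
        using that i by (simp add: space_measure_of_conv M_def space_PiM_point_borelD)
      show "{\<omega> \<in> space ?N. measure (\<omega> i) B = real n} \<in> sets ?N" if "B \<in> bounded_borel" for B n
        unfolding space_measure_of_conv sets_measure_of[OF G]
        by (rule sigma_sets.Basic, rule CollectI, rule exI[of _ "(i, B)"], rule exI[of _ n]) (use that i in simp)
    qed
    show "(\<lambda>\<omega> i. \<omega> i) \<in> space ?N \<rightarrow> (\<Pi>\<^sub>E i\<in>I. space point_borel)"
      unfolding space_measure_of_conv by (simp add: M_def space_PiM)
  qed
  then have "(\<lambda>\<omega>. \<omega>) \<in> measurable ?N M" by (simp only: M_def)
  then have *: "A \<inter> space M \<in> sets ?N" if "A \<in> sets M" for A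
    using measurable_sets[OF _ that, of "\<lambda>\<mu>. \<mu>" ?N] by (simp add: space_measure_of_conv)
  show "sets M \<subseteq> sigma_sets (space M) ?G"
  proof
    fix A assume A: "A \<in> sets M"
    then have eq: "A \<inter> space M = A" using sets.sets_into_space[OF A] by blast
    show "A \<in> sigma_sets (space M) ?G" using *[OF A] unfolding sets_measure_of[OF G] eq .
  qed
  show "sigma_sets (space M) ?G \<subseteq> sets M"
  proof (rule sets.sigma_sets_subset, safe)
    fix B :: "'a set" and i n assume i: "i \<in> I" and "B \<in> sets borel"
    then have "(\<lambda>\<omega>. measure (\<omega> i) B) \<in> borel_measurable M" unfolding M_def
      by (intro measurable_compose[OF measurable_component_singleton[OF i] measurable_measure_point_borel])
    then show "{\<omega> \<in> space M. measure (\<omega> (fst (i, B))) (snd (i, B)) = real n} \<in> sets M" by simp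
  qed
qed

section \<open>Uniqueness and measurability through Laplace functionals\<close>

lemma laplace_test_add: "laplace_test f \<Longrightarrow> laplace_test g \<Longrightarrow> laplace_test (\<lambda>x. f x + g x)"
proof -
  assume f: "laplace_test f" and g: "laplace_test g"
  have "bounded {x. f x + g x \<noteq> 0}"
    by (rule bounded_subset[of "{x. f x \<noteq> 0} \<union> {x. g x \<noteq> 0}"])
       (use f g in \<open>auto simp: laplace_test_def bounded_support_fun_def\<close>)
  moreover have "bounded (range (\<lambda>x. f x + g x))"
    by (rule bounded_plus_comp) (use f g in \<open>auto simp: laplace_test_def bounded_support_fun_def\<close>)
  ultimately show ?thesis
    using f g by (auto simp: laplace_test_def bounded_support_fun_def)
qed

lemma laplace_test_indicator: "B \<in> bounded_borel \<Longrightarrow> laplace_test (indicator B)"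
  by (auto simp: laplace_test_def bounded_support_fun_def bounded_iff indicator_def split: if_splits)

lemma laplace_test_zero: "laplace_test (\<lambda>x. 0)"
  by (auto simp: laplace_test_def bounded_support_fun_def bounded_iff)

lemma laplace_testD:
  assumes "laplace_test f"
  shows "bounded_support_fun f" "f \<in> borel_measurable borel" "0 \<le> f x" "bounded {x. f x \<noteq> 0}"
  using assms by (auto simp: laplace_test_def bounded_support_fun_def)

lemma integrable_laplace_test: "laplace_test f \<Longrightarrow> \<mu> \<in> locally_finite_measures \<Longrightarrow> integrable \<mu> f"
  by (simp add: laplace_test_def integrable_bounded_support_fun)

text \<open>Collecting the indicators that belong to each coordinate turns a sum of counts into
  integrals of step functions. So the exponentials of the class theorem are joint Laplace
  functionals; the functions \<open>f i\<close> are chosen uniformly in \<omega>.\<close>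

lemma sum_measure_eq_sum_integral:
  assumes I: "finite I" and js: "set js \<subseteq> I \<times> bounded_borel"
  shows "\<exists>f :: 'i \<Rightarrow> 'a::polish_space \<Rightarrow> real. (\<forall>i. laplace_test (f i)) \<and>
    (\<forall>\<omega>. (\<forall>i\<in>I. \<omega> i \<in> point_measures) \<longrightarrow> (\<Sum>j\<leftarrow>js. measure (\<omega> (fst j)) (snd j)) = (\<Sum>i\<in>I. \<integral>x. f i x \<partial>\<omega> i))"
  using js
proof (induction js)
  case Nil
  show ?case by (rule exI[of _ "\<lambda>_ _. 0"]) (simp add: laplace_test_zero)
next
  case (Cons j js)
  then obtain f :: "'i \<Rightarrow> 'a \<Rightarrow> real" where f: "\<And>i. laplace_test (f i)"
    "\<And>\<omega>. (\<forall>i\<in>I. \<omega> i \<in> point_measures) \<Longrightarrow> (\<Sum>j\<leftarrow>js. measure (\<omega> (fst j)) (snd j)) = (\<Sum>i\<in>I. \<integral>x. f i x \<partial>\<omega> i)"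
    by auto
  obtain k B where j: "j = (k, B)" by (cases j)
  have k: "k \<in> I" "B \<in> bounded_borel" using Cons.prems j by auto
  let ?g = "\<lambda>i. if i = k then (\<lambda>x. f i x + indicator B x) else f i"
  show ?case
  proof (intro exI[of _ ?g] conjI allI impI)
    show "laplace_test (?g i)" for i using f(1) laplace_test_indicator[OF k(2)] by (auto intro: laplace_test_add)
    fix \<omega> :: "'i \<Rightarrow> 'a measure" assume \<omega>: "\<forall>i\<in>I. \<omega> i \<in> point_measures"
    have i: "(\<integral>x. ?g i x \<partial>\<omega> i) = (\<integral>x. f i x \<partial>\<omega> i) + (if i = k then measure (\<omega> k) B else 0)" if "i \<in> I" for i
    proof (cases "i = k")
      case True
      have [simp]: "\<omega> k \<in> point_measures" using \<omega> k by blast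
      note [simp] = point_measuresD(1-3)[OF this]
      have "integrable (\<omega> k) (indicator B :: 'a \<Rightarrow> real)"
        by (rule integrable_laplace_test[OF laplace_test_indicator[OF k(2)]]) simp
      moreover have "integrable (\<omega> k) (f k)" by (rule integrable_laplace_test[OF f(1)]) simp
      ultimately show ?thesis using True by simp
    qed simp
    have "(\<Sum>i\<in>I. \<integral>x. ?g i x \<partial>\<omega> i) = (\<Sum>i\<in>I. \<integral>x. f i x \<partial>\<omega> i) + (\<Sum>i\<in>I. if i = k then measure (\<omega> k) B else 0)"
      unfolding sum.distrib[symmetric] by (rule sum.cong[OF refl i])
    also have "(\<Sum>i\<in>I. if i = k then measure (\<omega> k) B else 0) = measure (\<omega> k) B" using I k by simp
    finally show "(\<Sum>j\<leftarrow>j # js. measure (\<omega> (fst j)) (snd j)) = (\<Sum>i\<in>I. \<integral>x. ?g i x \<partial>\<omega> i)"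
      using f(2)[OF \<omega>] by (simp add: j)
  qed
qed

text \<open>The counts of the coordinates generate the product sigma-algebra, and exponentials of
  their sums are joint Laplace functionals at step functions.\<close>

lemma joint_laplace_unique:
  fixes P Q :: "('i \<Rightarrow> 'a::polish_space measure) measure"
  assumes I: "finite I" and P: "prob_space P" "prob_space Q"
    and sets: "sets P = sets (PiM I (\<lambda>_. point_borel))" "sets Q = sets (PiM I (\<lambda>_. point_borel))"
    and eq: "\<And>f. (\<And>i. laplace_test (f i)) \<Longrightarrow>
      (\<integral>\<^sup>+\<omega>. ennreal (exp (- (\<Sum>i\<in>I. \<integral>x. f i x \<partial>\<omega> i))) \<partial>P) = (\<integral>\<^sup>+\<omega>. ennreal (exp (- (\<Sum>i\<in>I. \<integral>x. f i x \<partial>\<omega> i))) \<partial>Q)"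
  shows "P = Q"
proof (rule measure_eq_of_exp_integrals[where Y="\<lambda>j \<omega>. measure (\<omega> (fst j)) (snd j)" and J="I \<times> bounded_borel" and M="PiM I (\<lambda>_. point_borel)"])
  show "measure (\<omega> (fst j)) (snd j) \<in> \<nat>" if "j \<in> I \<times> bounded_borel" "\<omega> \<in> space (PiM I (\<lambda>_. point_borel))"
    for j and \<omega> :: "'i \<Rightarrow> 'a measure"
    using measure_point_measure_Nats(1)[OF space_PiM_point_borelD[OF that(2), of "fst j"], of "snd j"] that(1)
    by (simp add: mem_Times_iff)
  fix js :: "('i \<times> 'a set) list" assume "set js \<subseteq> I \<times> bounded_borel"
  from sum_measure_eq_sum_integral[OF I this]
  obtain f :: "'i \<Rightarrow> 'a \<Rightarrow> real" where f: "\<And>i. laplace_test (f i)"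
    "\<And>\<omega>. (\<forall>i\<in>I. \<omega> i \<in> point_measures) \<Longrightarrow> (\<Sum>j\<leftarrow>js. measure (\<omega> (fst j)) (snd j)) = (\<Sum>i\<in>I. \<integral>x. f i x \<partial>\<omega> i)"
    by auto
  have *: "(\<integral>\<^sup>+\<omega>. ennreal (exp (- (\<Sum>j\<leftarrow>js. measure (\<omega> (fst j)) (snd j)))) \<partial>R) = (\<integral>\<^sup>+\<omega>. ennreal (exp (- (\<Sum>i\<in>I. \<integral>x. f i x \<partial>\<omega> i))) \<partial>R)"
    if "sets R = sets (PiM I (\<lambda>_. point_borel))" for R
  proof (rule nn_integral_cong)
    fix \<omega> assume "\<omega> \<in> space R"
    then have "\<omega> \<in> space (PiM I (\<lambda>_. point_borel))" using sets_eq_imp_space_eq[OF that] by (simp only:)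
    then have "\<forall>i\<in>I. \<omega> i \<in> point_measures" by (intro ballI space_PiM_point_borelD)
    then show "ennreal (exp (- (\<Sum>j\<leftarrow>js. measure (\<omega> (fst j)) (snd j)))) = ennreal (exp (- (\<Sum>i\<in>I. \<integral>x. f i x \<partial>\<omega> i)))"
      using f(2) by simp
  qed
  show "(\<integral>\<^sup>+\<omega>. ennreal (exp (- (\<Sum>j\<leftarrow>js. measure (\<omega> (fst j)) (snd j)))) \<partial>P)
     = (\<integral>\<^sup>+\<omega>. ennreal (exp (- (\<Sum>j\<leftarrow>js. measure (\<omega> (fst j)) (snd j)))) \<partial>Q)"
    unfolding *[OF sets(1)] *[OF sets(2)] by (rule eq[OF f(1)])
qed (use P sets sets_PiM_point_borel_generated in auto)

lemma measurable_kernel_laplace: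
  fixes K :: "'w \<Rightarrow> 'a::polish_space measure measure"
  assumes K: "\<And>x. x \<in> space N \<Longrightarrow> prob_space (K x)" "\<And>x. x \<in> space N \<Longrightarrow> sets (K x) = sets point_borel"
    and m: "\<And>f. laplace_test f \<Longrightarrow> (\<lambda>x. \<integral>\<^sup>+\<mu>. ennreal (laplace f \<mu>) \<partial>K x) \<in> borel_measurable N"
  shows "K \<in> measurable N (prob_algebra point_borel)"
proof (rule measurable_kernel_of_exp_integrals[where Y="\<lambda>B \<mu>. measure \<mu> B" and J=bounded_borel])
  show "measure \<mu> B \<in> \<nat>" if "B \<in> bounded_borel" "\<mu> \<in> space point_borel"
    for B and \<mu> :: "'a measure"
    using that by (intro measure_point_measure_Nats) (auto simp: space_point_borel)
  fix Bs :: "'a set list" assume Bs: "set Bs \<subseteq> bounded_borel"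
  \<comment> \<open>A one-point index set reduces the case of a single process to that of
    families.\<close>
  then have "set (map (Pair ()) Bs) \<subseteq> {()} \<times> bounded_borel" by auto
  from sum_measure_eq_sum_integral[OF _ this]
  obtain f :: "unit \<Rightarrow> 'a \<Rightarrow> real" where f: "\<And>i. laplace_test (f i)"
    "\<And>\<omega>. (\<forall>i\<in>{()}. \<omega> i \<in> point_measures) \<Longrightarrow> (\<Sum>j\<leftarrow>map (Pair ()) Bs. measure (\<omega> (fst j)) (snd j)) = (\<Sum>i\<in>{()}. \<integral>x. f i x \<partial>\<omega> i)"
    by auto
  have f': "(\<Sum>B\<leftarrow>Bs. measure \<mu> B) = (\<integral>x. f () x \<partial>\<mu>)" if "\<mu> \<in> point_measures" for \<mu>
    using f(2)[of "\<lambda>_. \<mu>"] that by (simp add: comp_def)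
  show "(\<lambda>x. \<integral>\<^sup>+\<mu>. ennreal (exp (- (\<Sum>B\<leftarrow>Bs. measure \<mu> B))) \<partial>K x) \<in> borel_measurable N"
  proof (rule measurable_cong[THEN iffD1, OF _ m[OF f(1)[of "()"]]], rule nn_integral_cong)
    fix x \<mu> assume "x \<in> space N" "\<mu> \<in> space (K x)"
    then have "\<mu> \<in> point_measures" using sets_eq_imp_space_eq[OF K(2)] by (simp add: space_point_borel)
    then show "ennreal (laplace (f ()) \<mu>) = ennreal (exp (- (\<Sum>B\<leftarrow>Bs. measure \<mu> B)))" using f' by simp
  qed
qed (use K sets_point_borel_generated in auto)

section \<open>Superposition and convolution\<close>

text \<open>Nonzero terms are at least 1, so a finite total leaves only finitely many of
  them.\<close>

lemma nn_integral_count_space_Nats: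
  fixes f :: "'i \<Rightarrow> ennreal"
  assumes f: "\<And>i. i \<in> I \<Longrightarrow> f i \<in> \<nat>" and fin: "(\<integral>\<^sup>+i. f i \<partial>count_space I) < \<infinity>"
  shows "(\<integral>\<^sup>+i. f i \<partial>count_space I) \<in> \<nat>"
proof -
  obtain r where r: "(\<integral>\<^sup>+i. f i \<partial>count_space I) = ennreal r" "0 \<le> r"
    using fin by (cases "\<integral>\<^sup>+i. f i \<partial>count_space I") auto
  define N where "N = nat \<lceil>r\<rceil>"
  have N: "(\<integral>\<^sup>+i. f i \<partial>count_space I) \<le> of_nat N"
    using r by (simp add: N_def ennreal_of_nat_eq_real_of_nat)
  have "card F \<le> N" if F: "F \<subseteq> {i \<in> I. f i \<noteq> 0}" "finite F" for F
  proof -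
    have "(of_nat (card F) :: ennreal) = (\<Sum>i\<in>F. 1)" by simp
    also have "\<dots> \<le> (\<Sum>i\<in>F. f i)"
    proof (rule sum_mono)
      fix i assume "i \<in> F"
      then have i: "i \<in> I" "f i \<noteq> 0" using F by auto
      obtain k where k: "f i = of_nat k" using f[OF i(1)] by (auto simp: Nats_def)
      then have "1 \<le> k" using i(2) by (cases k) auto
      then show "1 \<le> f i" unfolding k by (metis of_nat_1 of_nat_le_iff)
    qed
    also have "\<dots> = (\<integral>\<^sup>+i. f i \<partial>count_space F)" using F by (simp add: nn_integral_count_space_finite)
    also have "\<dots> = (\<integral>\<^sup>+i. f i * indicator F i \<partial>count_space I)"
      using F by (subst nn_integral_count_space_indicator[of F]) (auto simp: nn_integral_count_space_indicator[of I] indicator_def intro!: nn_integral_cong)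
    also have "\<dots> \<le> (\<integral>\<^sup>+i. f i \<partial>count_space I)"
      by (intro nn_integral_mono) (simp add: indicator_def)
    also note N
    finally show ?thesis by simp
  qed
  then have fin: "finite {i \<in> I. f i \<noteq> 0}"
    using finite_if_finite_subsets_card_bdd[of "{i \<in> I. f i \<noteq> 0}" N] by simp
  have "(\<integral>\<^sup>+i. f i \<partial>count_space I) = (\<Sum>i\<in>{i \<in> I. f i \<noteq> 0}. f i)"
    using fin by (intro nn_integral_count_space') auto
  also have "\<dots> \<in> \<nat>"
  proof -
    have "sum f S \<in> \<nat>" if "finite S" "S \<subseteq> I" for S
      using that by (induction S rule: finite_induct) (auto intro: f Nats_add)
    then show ?thesis using fin by simp
  qed
  finally show ?thesis .
qed

text \<open>\<open>convolve\<close> branches on local finiteness, a condition on all bounded sets.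
  Countably many balls decide it, which makes the branching measurable; integrality follows from
  \<open>nn_integral_count_space_Nats\<close>.\<close>

lemma superpose_in_point_measures_iff:
  fixes \<omega> :: "'i \<Rightarrow> 'a::polish_space measure"
  assumes \<omega>: "\<And>i. i \<in> I \<Longrightarrow> \<omega> i \<in> point_measures"
  shows "superpose I \<omega> \<in> point_measures \<longleftrightarrow> (\<forall>n::nat. emeasure (superpose I \<omega>) (ball undefined (real n)) < \<infinity>)"
proof
  assume "superpose I \<omega> \<in> point_measures"
  then show "\<forall>n::nat. emeasure (superpose I \<omega>) (ball undefined (real n)) < \<infinity>"
    using point_measuresD(5)[OF _ bounded_ball] by blast
next
  assume *: "\<forall>n::nat. emeasure (superpose I \<omega>) (ball undefined (real n)) < \<infinity>"
  have e: "emeasure (superpose I \<omega>) B = (\<integral>\<^sup>+i. emeasure (\<omega> i) B \<partial>count_space I)" if "B \<in> sets borel" for B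
    using \<omega> that by (intro emeasure_superpose point_measuresD(2)) auto
  have "emeasure (superpose I \<omega>) B < \<infinity> \<and> emeasure (superpose I \<omega>) B \<in> \<nat>" if B: "B \<in> sets borel" "bounded B" for B
  proof -
    obtain r where r: "\<And>y. y \<in> B \<Longrightarrow> dist undefined y \<le> r" using B(2) by (auto simp: bounded_any_center[where a=undefined])
    obtain n :: nat where "r < real n" using reals_Archimedean2 by blast
    then have "B \<subseteq> ball undefined (real n)" using r by (force intro: le_less_trans)
    then have "emeasure (superpose I \<omega>) B \<le> emeasure (superpose I \<omega>) (ball undefined (real n))" by (intro emeasure_mono) auto
    also have "\<dots> < \<infinity>" using * by blast
    finally have fin: "emeasure (superpose I \<omega>) B < \<infinity>" .
    moreover have "emeasure (superpose I \<omega>) B \<in> \<nat>"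
      using fin unfolding e[OF B(1)] by (intro nn_integral_count_space_Nats point_measuresD(4)[OF \<omega> B])
    ultimately show ?thesis by blast
  qed
  then show "superpose I \<omega> \<in> point_measures" by (simp add: point_measures_def locally_finite_measures_def)
qed

text \<open>The map along which \<open>convolve\<close> pushes the product law forward.\<close>

definition superpose' :: "'i set \<Rightarrow> ('i \<Rightarrow> 'a::polish_space measure) \<Rightarrow> 'a measure" where
  "superpose' I \<omega> = (if superpose I \<omega> \<in> point_measures then superpose I \<omega> else null_measure borel)"

lemma superpose'_in_point_measures: "superpose' I \<omega> \<in> point_measures"
  by (simp add: superpose'_def null_measure_in_point_measures)

text \<open>Over a countable index set the evaluation is jointly measurable in index and
  configuration, and counting measure is sigma-finite, so the sum is a measurable integral.\<close>

lemma measurable_superpose':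
  fixes Q :: "'i \<Rightarrow> 'a::polish_space measure measure"
  assumes I: "countable I" and Q: "\<And>i. i \<in> I \<Longrightarrow> sets (Q i) = sets point_borel"
  shows "superpose' I \<in> measurable (PiM I Q) point_borel"
proof (rule measurable_point_borel[OF superpose'_in_point_measures])
  have PM: "\<omega> i \<in> point_measures" if "\<omega> \<in> space (PiM I Q)" "i \<in> I" for \<omega> i
    using that sets_eq_imp_space_eq[OF Q[OF that(2)]] by (auto simp: space_PiM space_point_borel)
  have e: "(\<lambda>\<omega>. emeasure (superpose I \<omega>) B) \<in> borel_measurable (PiM I Q)" if B: "B \<in> sets borel" for B
  proof (rule measurable_cong[THEN iffD1])
    show "(\<integral>\<^sup>+i. emeasure (\<omega> i) B \<partial>count_space I) = emeasure (superpose I \<omega>) B" if "\<omega> \<in> space (PiM I Q)" for \<omega>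
      using PM[OF that] B by (intro emeasure_superpose[symmetric] point_measuresD(2)) auto
    interpret sigma_finite_measure "count_space I" using I by (rule sigma_finite_measure_count_space_countable)
    have c: "(\<lambda>\<omega>. emeasure (\<omega> i) B) \<in> borel_measurable (PiM I Q)" if "i \<in> I" for i
      using measurable_compose[OF measurable_component_singleton[OF that, of Q]] measurable_emeasure_point_borel[OF B]
      by (simp add: measurable_cong_sets[OF Q[OF that] refl])
    have "(\<lambda>p. emeasure (snd p (fst p)) B) \<in> borel_measurable (count_space I \<Otimes>\<^sub>M PiM I Q)"
      by (rule measurable_pair_measure_countable1[OF I]) (simp add: c)
    from measurable_compose[OF measurable_pair_swap' this]
    have "(\<lambda>(\<omega>, i). emeasure (\<omega> i) B) \<in> borel_measurable (PiM I Q \<Otimes>\<^sub>M count_space I)"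
      by (simp add: case_prod_beta')
    then show "(\<lambda>\<omega>. \<integral>\<^sup>+i. emeasure (\<omega> i) B \<partial>count_space I) \<in> borel_measurable (PiM I Q)"
      by (rule borel_measurable_nn_integral)
  qed
  fix B :: "'a set" assume B: "B \<in> sets borel" "bounded B"
  note [measurable] = e[OF B(1)]
  have [measurable]: "(\<lambda>\<omega>. emeasure (superpose I \<omega>) (ball undefined (real n))) \<in> borel_measurable (PiM I Q)" for n by (rule e) simp
  have "(\<lambda>\<omega>. if \<forall>n::nat. emeasure (superpose I \<omega>) (ball undefined (real n)) < \<infinity> then emeasure (superpose I \<omega>) B else 0) \<in> borel_measurable (PiM I Q)"
    by measurable
  then show "(\<lambda>\<omega>. emeasure (superpose' I \<omega>) B) \<in> borel_measurable (PiM I Q)"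
  proof (rule measurable_cong[THEN iffD1, rotated])
    fix \<omega> assume "\<omega> \<in> space (PiM I Q)"
    then have *: "superpose I \<omega> \<in> point_measures \<longleftrightarrow> (\<forall>n::nat. emeasure (superpose I \<omega>) (ball undefined (real n)) < \<infinity>)"
      by (intro superpose_in_point_measures_iff PM)
    show "(if \<forall>n::nat. emeasure (superpose I \<omega>) (ball undefined (real n)) < \<infinity> then emeasure (superpose I \<omega>) B else 0) = emeasure (superpose' I \<omega>) B"
      unfolding superpose'_def *[symmetric] by simp
  qed
qed

lemma finite_superpose:
  fixes \<omega> :: "'i \<Rightarrow> 'a::polish_space measure"
  assumes I: "finite I" and \<omega>: "\<And>i. i \<in> I \<Longrightarrow> \<omega> i \<in> point_measures"
  shows "superpose I \<omega> \<in> point_measures" "pmult (superpose I \<omega>) x = (\<Sum>i\<in>I. pmult (\<omega> i) x)"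
    "superpose' I \<omega> = superpose I \<omega>"
proof -
  have e: "emeasure (superpose I \<omega>) B = (\<Sum>i\<in>I. emeasure (\<omega> i) B)" if "B \<in> sets borel" for B
    using \<omega> that I by (subst emeasure_superpose) (auto simp: point_measuresD(2) nn_integral_count_space_finite)
  show 1: "superpose I \<omega> \<in> point_measures"
  proof (subst superpose_in_point_measures_iff[OF \<omega>], assumption, intro allI)
    have "emeasure (\<omega> i) (ball undefined (real n)) < top" if "i \<in> I" for i n
      using point_measuresD(5)[OF \<omega>[OF that] bounded_ball] by simp
    then show "emeasure (superpose I \<omega>) (ball undefined (real n)) < \<infinity>" for n using I by (simp add: e)
  qed
  have "of_nat (pmult (superpose I \<omega>) x) = (of_nat (\<Sum>i\<in>I. pmult (\<omega> i) x) :: ennreal)"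
    using e[of "{x}"] \<omega> by (simp add: emeasure_singleton_eq_mult[OF 1] emeasure_singleton_eq_mult(1))
  then show "pmult (superpose I \<omega>) x = (\<Sum>i\<in>I. pmult (\<omega> i) x)" by (simp only: of_nat_eq_iff)
  show "superpose' I \<omega> = superpose I \<omega>" using 1 by (simp add: superpose'_def)
qed

lemma convolve_eq_distr: "convolve I Q = distr (PiM I Q) point_borel (superpose' I)"
  unfolding convolve_def superpose'_def ..

lemma sets_convolve [simp]: "sets (convolve I Q) = sets point_borel"
  by (simp add: convolve_eq_distr)

lemma prob_space_convolve:
  assumes "countable I" "\<And>i. i \<in> I \<Longrightarrow> sets (Q i) = sets point_borel" "\<And>i. i \<in> I \<Longrightarrow> prob_space (Q i)"
  shows "prob_space (convolve I Q)"
  unfolding convolve_eq_distr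
  by (intro prob_space.prob_space_distr prob_space_PiM measurable_superpose' assms)

section \<open>Laplace functional of independent thinning\<close>

lemma sets_site_law [simp]: "sets (site_law s x) = sets point_borel"
  by (simp add: site_law_def)

lemma site_law_measurable:
  "(\<lambda>b. if b then return borel x else null_measure borel) \<in> measurable (measure_pmf (bernoulli_pmf s)) point_borel"
  by (simp add: space_point_borel null_measure_in_point_measures return_in_point_measures)

lemma prob_space_site_law: "prob_space (site_law s x)"
  unfolding site_law_def by (rule measure_pmf.prob_space_distr[OF site_law_measurable])

lemma space_site_law: "space (site_law s x) = point_measures"
  using sets_eq_imp_space_eq[OF sets_site_law] by (simp add: space_point_borel)

lemma borel_measurable_emeasure_Collect:
  fixes B :: "'a::polish_space set"
  assumes "B \<in> sets borel"
  shows "Measurable.pred point_borel (\<lambda>\<kappa>. emeasure \<kappa> B \<le> c)"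
  using measurable_emeasure_point_borel[OF assms] by measurable

text \<open>Both conjuncts are upper bounds so that each is an instance of
  \<open>borel_measurable_emeasure_Collect\<close>.\<close>

lemma AE_site_law:
  fixes x :: "'a::polish_space"
  shows "AE \<kappa> in site_law s x. emeasure \<kappa> (UNIV - {x}) \<le> 0 \<and> emeasure \<kappa> {x} \<le> 1"
proof -
  have "Measurable.pred point_borel (\<lambda>\<kappa>. emeasure \<kappa> (UNIV - {x}) \<le> 0 \<and> emeasure \<kappa> {x} \<le> 1)"
    by (intro pred_intros_logic borel_measurable_emeasure_Collect) auto
  from AE_distr_iff[OF site_law_measurable this[unfolded pred_def]] show ?thesis
    unfolding site_law_def by (simp only:) (rule AE_I2, simp add: indicator_def)
qed

text \<open>The exponent charges \<open>a\<close> for a kept point and \<open>b\<close> for a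
  deleted one. Thus the thinned measure and its remainder are handled at once.\<close>

lemma site_law_laplace:
  fixes x :: "'a::polish_space"
  assumes s: "0 \<le> s" "s \<le> 1"
  shows "(\<integral>\<^sup>+\<kappa>. ennreal (exp (- (a * measure \<kappa> {x} + b * (1 - measure \<kappa> {x})))) \<partial>site_law s x)
     = ennreal (s * exp (- a) + (1 - s) * exp (- b))"
proof -
  have [measurable]: "(\<lambda>\<kappa>. measure \<kappa> {x}) \<in> borel_measurable point_borel" by (rule measurable_measure_point_borel) simp
  have "(\<integral>\<^sup>+\<kappa>. ennreal (exp (- (a * measure \<kappa> {x} + b * (1 - measure \<kappa> {x})))) \<partial>site_law s x)
     = (\<integral>\<^sup>+c. ennreal (exp (- (a * measure (if c then return borel x else null_measure borel) {x} + b * (1 - measure (if c then return borel x else null_measure borel) {x})))) \<partial>measure_pmf (bernoulli_pmf s))"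
    unfolding site_law_def by (rule nn_integral_distr[OF site_law_measurable]) measurable
  also have "\<dots> = ennreal s * ennreal (exp (- a)) + ennreal (1 - s) * ennreal (exp (- b))"
    using s by (simp add: measure_return mult.commute)
  finally show ?thesis using s by (simp add: ennreal_mult[symmetric] ennreal_plus[symmetric] del: ennreal_plus)
qed

lemma nn_integral_convolve:
  assumes "countable I" "\<And>i. i \<in> I \<Longrightarrow> sets (Q i) = sets point_borel" "F \<in> borel_measurable point_borel"
  shows "(\<integral>\<^sup>+\<kappa>. F \<kappa> \<partial>convolve I Q) = (\<integral>\<^sup>+\<omega>. F (superpose' I \<omega>) \<partial>PiM I Q)"
  unfolding convolve_eq_distr by (rule nn_integral_distr) (simp_all add: measurable_superpose' assms)

text \<open>Kept and deleted copies at \<open>x\<close> both add up over the \<open>k\<close>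
  independent factors, so the integral is the \<open>k\<close>-th power of that for one
  copy.\<close>

lemma site_convolve_laplace:
  fixes x :: "'a::polish_space"
  assumes s: "0 \<le> s" "s \<le> 1"
  shows "(\<integral>\<^sup>+\<kappa>. ennreal (exp (- (a * measure \<kappa> {x} + b * (real k - measure \<kappa> {x})))) \<partial>convolve {..<k} (\<lambda>_. site_law s x))
     = ennreal ((s * exp (- a) + (1 - s) * exp (- b)) ^ k)"
proof -
  have m[measurable]: "(\<lambda>\<kappa>. measure \<kappa> {x}) \<in> borel_measurable point_borel" by (rule measurable_measure_point_borel) simp
  have m'[measurable]: "(\<lambda>\<kappa>. measure \<kappa> {x}) \<in> borel_measurable (site_law s x)"
    using m by (simp add: measurable_cong_sets[OF sets_site_law refl])
  interpret product_prob_space "\<lambda>_::nat. site_law s x" by (rule product_prob_spaceI[OF prob_space_site_law])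
  have "(\<integral>\<^sup>+\<kappa>. ennreal (exp (- (a * measure \<kappa> {x} + b * (real k - measure \<kappa> {x})))) \<partial>convolve {..<k} (\<lambda>_. site_law s x))
     = (\<integral>\<^sup>+\<omega>. ennreal (exp (- (a * measure (superpose' {..<k} \<omega>) {x} + b * (real k - measure (superpose' {..<k} \<omega>) {x})))) \<partial>PiM {..<k} (\<lambda>_. site_law s x))"
    by (rule nn_integral_convolve) auto
  also have "\<dots> = (\<integral>\<^sup>+\<omega>. (\<Prod>i\<in>{..<k}. ennreal (exp (- (a * measure (\<omega> i) {x} + b * (1 - measure (\<omega> i) {x}))))) \<partial>PiM {..<k} (\<lambda>_. site_law s x))"
  proof (rule nn_integral_cong)
    fix \<omega> assume "\<omega> \<in> space (PiM {..<k} (\<lambda>_. site_law s x))"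
    then have \<omega>: "\<omega> i \<in> point_measures" if "i \<in> {..<k}" for i
      using that by (auto simp: space_PiM space_site_law)
    have "measure (superpose' {..<k} \<omega>) {x} = (\<Sum>i\<in>{..<k}. measure (\<omega> i) {x})"
      using finite_superpose[OF _ \<omega>, of "{..<k}"] \<omega> by (simp add: emeasure_singleton_eq_mult(2))
    then have "- (a * measure (superpose' {..<k} \<omega>) {x} + b * (real k - measure (superpose' {..<k} \<omega>) {x}))
      = (\<Sum>i\<in>{..<k}. - (a * measure (\<omega> i) {x} + b * (1 - measure (\<omega> i) {x})))"
      by (simp add: sum_negf sum.distrib sum_subtractf sum_distrib_left[symmetric])
    then show "ennreal (exp (- (a * measure (superpose' {..<k} \<omega>) {x} + b * (real k - measure (superpose' {..<k} \<omega>) {x}))))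
      = (\<Prod>i\<in>{..<k}. ennreal (exp (- (a * measure (\<omega> i) {x} + b * (1 - measure (\<omega> i) {x})))))"
      by (simp only: exp_sum[OF finite_lessThan] prod_ennreal[OF exp_ge_zero])
  qed
  also have "\<dots> = (\<Prod>i\<in>{..<k}. \<integral>\<^sup>+\<kappa>. ennreal (exp (- (a * measure \<kappa> {x} + b * (1 - measure \<kappa> {x})))) \<partial>site_law s x)"
    by (rule product_nn_integral_prod) auto
  also have "\<dots> = ennreal ((s * exp (- a) + (1 - s) * exp (- b)) ^ k)"
    using s by (simp only: site_law_laplace[OF s] prod_constant card_lessThan) (simp add: ennreal_power s del: ennreal_plus)
  finally show ?thesis .
qed

lemma AE_site_convolve:
  fixes x :: "'a::polish_space"
  assumes s: "0 \<le> s" "s \<le> 1"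
  shows "AE \<kappa> in convolve {..<k} (\<lambda>_. site_law s x). emeasure \<kappa> (UNIV - {x}) \<le> 0 \<and> emeasure \<kappa> {x} \<le> of_nat k"
proof -
  have m: "superpose' {..<k} \<in> measurable (PiM {..<k} (\<lambda>_. site_law s x)) point_borel"
    by (rule measurable_superpose') auto
  have m2: "Measurable.pred point_borel (\<lambda>\<kappa>. emeasure \<kappa> (UNIV - {x}) \<le> 0 \<and> emeasure \<kappa> {x} \<le> of_nat k)"
    by (intro pred_intros_logic borel_measurable_emeasure_Collect) auto
  have "AE \<omega> in PiM {..<k} (\<lambda>_. site_law s x). \<forall>i\<in>{..<k}. emeasure (\<omega> i) (UNIV - {x}) \<le> 0 \<and> emeasure (\<omega> i) {x} \<le> 1"
  proof (rule AE_finite_allI)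
    fix i assume "i \<in> {..<k}"
    then show "AE \<omega> in PiM {..<k} (\<lambda>_. site_law s x). emeasure (\<omega> i) (UNIV - {x}) \<le> 0 \<and> emeasure (\<omega> i) {x} \<le> 1"
      by (intro AE_PiM_component prob_space_site_law AE_site_law)
  qed simp
  then have "AE \<omega> in PiM {..<k} (\<lambda>_. site_law s x). emeasure (superpose' {..<k} \<omega>) (UNIV - {x}) \<le> 0 \<and> emeasure (superpose' {..<k} \<omega>) {x} \<le> of_nat k"
  proof (rule AE_mp, intro AE_I2 impI)
    fix \<omega> assume "\<omega> \<in> space (PiM {..<k} (\<lambda>_. site_law s x))"
      and *: "\<forall>i\<in>{..<k}. emeasure (\<omega> i) (UNIV - {x}) \<le> 0 \<and> emeasure (\<omega> i) {x} \<le> 1"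
    then have \<omega>: "\<omega> i \<in> point_measures" if "i \<in> {..<k}" for i
      using that by (auto simp: space_PiM space_site_law)
    have e: "emeasure (superpose' {..<k} \<omega>) B = (\<Sum>i\<in>{..<k}. emeasure (\<omega> i) B)" if "B \<in> sets borel" for B
    proof -
      have "superpose' {..<k} \<omega> = superpose {..<k} \<omega>" by (rule finite_superpose(3)) (auto intro: \<omega>)
      moreover have "emeasure (superpose {..<k} \<omega>) B = (\<Sum>i\<in>{..<k}. emeasure (\<omega> i) B)"
        using that \<omega> by (subst emeasure_superpose) (auto simp: point_measuresD(2) nn_integral_count_space_finite)
      ultimately show ?thesis by (simp only:)
    qed
    have "(\<Sum>i\<in>{..<k}. emeasure (\<omega> i) {x}) \<le> (\<Sum>i\<in>{..<k}. 1)" using * by (intro sum_mono) blast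
    then show "emeasure (superpose' {..<k} \<omega>) (UNIV - {x}) \<le> 0 \<and> emeasure (superpose' {..<k} \<omega>) {x} \<le> of_nat k"
      using * by (simp add: e)
  qed
  then show ?thesis unfolding convolve_eq_distr
    using AE_distr_iff[OF m m2[unfolded pred_def]] by blast
qed


section \<open>The joint Laplace functional of a thinning and its remainder\<close>

lemma thin_kernel_eq:
  "thin_kernel s \<mu> = convolve {x. emeasure \<mu> {x} > 0} (\<lambda>x. convolve {..<pmult \<mu> x} (\<lambda>_. site_law s x))"
  by (simp add: thin_kernel_def pmult_def)

lemma sets_thin_kernel [simp]: "sets (thin_kernel s \<mu>) = sets point_borel"
  by (simp add: thin_kernel_eq)

lemma prob_space_site_convolve: "prob_space (convolve {..<k::nat} (\<lambda>_. site_law s x))"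
  by (intro prob_space_convolve prob_space_site_law) auto

lemma atoms_eq: "\<mu> \<in> point_measures \<Longrightarrow> {x. emeasure \<mu> {x} > 0} = {x. pmult \<mu> x \<noteq> 0}"
  by (simp add: emeasure_singleton_eq_mult(1))

lemma prob_space_thin_kernel:
  assumes "\<mu> \<in> point_measures"
  shows "prob_space (thin_kernel s \<mu>)"
  unfolding thin_kernel_eq atoms_eq[OF assms]
  by (intro prob_space_convolve prob_space_site_convolve countable_mult[OF assms]) auto

text \<open>A point at \<open>x\<close> that is kept with probability \<open>s\<close> and weighted
  \<open>exp (- f x)\<close> if kept, \<open>exp (- g x)\<close> if deleted, has mean weight
  \<open>exp (- mix s f g x)\<close>. Plain thinning is the case \<open>g = 0\<close>.\<close>

definition mix :: "real \<Rightarrow> ('a \<Rightarrow> real) \<Rightarrow> ('a \<Rightarrow> real) \<Rightarrow> 'a \<Rightarrow> real" where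
  "mix s f g x = - ln (s * exp (- f x) + (1 - s) * exp (- g x))"

lemma mix_bounds:
  fixes s a b C :: real
  assumes s: "0 \<le> s" "s \<le> 1" and fg: "0 \<le> a" "0 \<le> b" "a \<le> C" "b \<le> C"
  shows "exp (- C) \<le> s * exp (- a) + (1 - s) * exp (- b)" "s * exp (- a) + (1 - s) * exp (- b) \<le> 1"
proof -
  have "s * exp (- C) + (1 - s) * exp (- C) \<le> s * exp (- a) + (1 - s) * exp (- b)"
    using s fg by (intro add_mono mult_left_mono) auto
  then show "exp (- C) \<le> s * exp (- a) + (1 - s) * exp (- b)" by (simp add: algebra_simps)
  have "s * exp (- a) + (1 - s) * exp (- b) \<le> s * 1 + (1 - s) * 1"
    using s fg by (intro add_mono mult_left_mono) auto
  then show "s * exp (- a) + (1 - s) * exp (- b) \<le> 1" by simp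
qed

text \<open>The mean weight lies between \<open>exp (- max C D)\<close> and 1, hence its negative
  logarithm is nonnegative and bounded; it vanishes where both functions do.\<close>

lemma laplace_test_mix:
  assumes s: "0 \<le> s" "s \<le> 1" and f: "laplace_test f" and g: "laplace_test g"
  shows "laplace_test (mix s f g)"
proof -
  obtain C where C: "\<And>x. f x \<le> C" using f by (auto simp: laplace_test_def bounded_support_fun_def bounded_iff abs_le_iff)
  obtain D where D: "\<And>x. g x \<le> D" using g by (auto simp: laplace_test_def bounded_support_fun_def bounded_iff abs_le_iff)
  have b: "exp (- max C D) \<le> s * exp (- f x) + (1 - s) * exp (- g x)" "s * exp (- f x) + (1 - s) * exp (- g x) \<le> 1" for x
    using C[of x] D[of x] laplace_testD(3)[OF f, of x] laplace_testD(3)[OF g, of x] mix_bounds[OF s, of "f x" "g x" "max C D"]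
    by (simp_all add: le_max_iff_disj)
  have pos: "0 < s * exp (- f x) + (1 - s) * exp (- g x)" for x using b(1)[of x] exp_gt_zero[of "- max C D"] by linarith
  have mb: "0 \<le> mix s f g x" "mix s f g x \<le> max C D" for x
  proof -
    show "0 \<le> mix s f g x" using b(2)[of x] pos[of x] by (simp add: mix_def ln_le_zero_iff)
    have "ln (exp (- max C D)) \<le> ln (s * exp (- f x) + (1 - s) * exp (- g x))"
      using b(1)[of x] pos[of x] by (subst ln_le_cancel_iff) auto
    then show "mix s f g x \<le> max C D" by (simp add: mix_def)
  qed
  have "bounded (range (mix s f g))" unfolding bounded_iff using mb by (intro exI[of _ "max C D"]) auto
  moreover have "bounded {x. mix s f g x \<noteq> 0}"
    by (rule bounded_subset[of "{x. f x \<noteq> 0} \<union> {x. g x \<noteq> 0}"])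
       (use laplace_testD(4)[OF f] laplace_testD(4)[OF g] in \<open>auto simp: mix_def\<close>)
  moreover have "mix s f g \<in> borel_measurable borel"
    using laplace_testD(2)[OF f] laplace_testD(2)[OF g] unfolding mix_def[abs_def] by measurable
  ultimately show ?thesis using mb by (simp add: laplace_test_def bounded_support_fun_def)
qed

lemma AE_thinning_sites:
  assumes s: "0 \<le> s" "s \<le> 1" and \<mu>: "\<mu> \<in> point_measures" and I: "countable I"
  shows "AE \<omega> in PiM I (\<lambda>x. convolve {..<pmult \<mu> x} (\<lambda>_. site_law s x)).
    \<forall>x\<in>I. emeasure (\<omega> x) (UNIV - {x}) \<le> 0 \<and> emeasure (\<omega> x) {x} \<le> of_nat (pmult \<mu> x)"
proof (subst AE_ball_countable[OF I], intro ballI)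
  fix x assume x: "x \<in> I"
  show "AE \<omega> in PiM I (\<lambda>x. convolve {..<pmult \<mu> x} (\<lambda>_. site_law s x)).
      emeasure (\<omega> x) (UNIV - {x}) \<le> 0 \<and> emeasure (\<omega> x) {x} \<le> of_nat (pmult \<mu> x)"
    by (rule AE_PiM_component[OF prob_space_site_convolve x AE_site_convolve[OF s]])
qed

text \<open>The component of site \<open>x\<close> lives on \<open>{x}\<close> with at most the mass
  of \<mu> there. So the superposition is dominated by \<mu>, hence locally finite, and the default
  branch of \<open>superpose'\<close> is avoided.\<close>

lemma superpose'_sites:
  fixes \<mu> :: "'a::polish_space measure"
  assumes \<mu>: "\<mu> \<in> point_measures" and I: "I = {x. pmult \<mu> x \<noteq> 0}"
    and \<omega>: "\<And>x. x \<in> I \<Longrightarrow> \<omega> x \<in> point_measures"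
    and *: "\<And>x. x \<in> I \<Longrightarrow> emeasure (\<omega> x) (UNIV - {x}) = 0 \<and> emeasure (\<omega> x) {x} \<le> of_nat (pmult \<mu> x)"
  shows "pmult (superpose' I \<omega>) x = (if x \<in> I then pmult (\<omega> x) x else 0)" "pmult (superpose' I \<omega>) x \<le> pmult \<mu> x"
proof -
  define c where "c x = (if x \<in> I then pmult (\<omega> x) x else 0)" for x
  have le: "c x \<le> pmult \<mu> x" for x
    using * by (auto simp: c_def emeasure_singleton_eq_mult(1)[OF \<omega>])
  have fin: "finite {x \<in> B. c x \<noteq> 0}" if "bounded B" for B
  proof (rule finite_subset[OF _ finite_mult_bounded[OF \<mu> that]])
    have "pmult \<mu> x \<noteq> 0" if "c x \<noteq> 0" for x using le[of x] that by linarith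
    then show "{x \<in> B. c x \<noteq> 0} \<subseteq> {x \<in> B. pmult \<mu> x \<noteq> 0}" by auto
  qed
  have "superpose I \<omega> = from_mult c"
  proof (rule measure_eqI)
    show "sets (superpose I \<omega>) = sets (from_mult c)" by (simp add: from_mult_def)
    fix B assume "B \<in> sets (superpose I \<omega>)"
    then have B: "B \<in> sets borel" by simp
    have e: "emeasure (\<omega> x) B = of_nat (c x) * indicator B x" if x: "x \<in> I" for x
    proof -
      note [simp] = point_measuresD(2,3)[OF \<omega>[OF x]]
      have "emeasure (\<omega> x) (B - {x}) \<le> emeasure (\<omega> x) (UNIV - {x})" by (rule emeasure_mono) auto
      then have "emeasure (\<omega> x) (B - {x}) = 0" using * x by simp
      moreover have "emeasure (\<omega> x) B = emeasure (\<omega> x) (B \<inter> {x}) + emeasure (\<omega> x) (B - {x})"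
      proof -
        have "emeasure (\<omega> x) (B \<inter> {x}) + emeasure (\<omega> x) (B - {x}) = emeasure (\<omega> x) (B \<inter> {x} \<union> (B - {x}))"
          using B by (intro plus_emeasure) auto
        also have "B \<inter> {x} \<union> (B - {x}) = B" by blast
        finally show ?thesis by (rule sym)
      qed
      ultimately have eq: "emeasure (\<omega> x) B = emeasure (\<omega> x) (B \<inter> {x})" by (simp only: add_0_right)
      show ?thesis
      proof (cases "x \<in> B")
        case True
        then have "B \<inter> {x} = {x}" by blast
        then have "emeasure (\<omega> x) B = of_nat (pmult (\<omega> x) x)"
          by (simp only: eq emeasure_singleton_eq_mult(1)[OF \<omega>[OF x]])
        then show ?thesis using True x by (simp add: c_def)
      next
        case False
        then have "B \<inter> {x} = {}" by blast
        then show ?thesis using False by (simp add: eq)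
      qed
    qed
    have "emeasure (superpose I \<omega>) B = (\<integral>\<^sup>+x. emeasure (\<omega> x) B \<partial>count_space I)"
      using B \<omega> by (intro emeasure_superpose point_measuresD(2)) auto
    also have "\<dots> = (\<integral>\<^sup>+x. of_nat (c x) * indicator B x \<partial>count_space I)"
      by (intro nn_integral_cong) (simp add: e)
    also have "\<dots> = (\<integral>\<^sup>+x. of_nat (c x) * indicator B x \<partial>count_space UNIV)"
    proof (subst nn_integral_count_space_indicator)
      show "(\<integral>\<^sup>+x. of_nat (c x) * indicator B x * indicator I x \<partial>count_space UNIV) = (\<integral>\<^sup>+x. of_nat (c x) * indicator B x \<partial>count_space UNIV)"
        by (rule nn_integral_cong) (simp add: c_def)
    qed simp
    also have "\<dots> = emeasure (from_mult c) B"
      unfolding from_mult_def using B by (subst emeasure_superpose) auto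
    finally show "emeasure (superpose I \<omega>) B = emeasure (from_mult c) B" .
  qed
  then have "superpose' I \<omega> = from_mult c" using from_mult(1)[OF fin] by (simp add: superpose'_def)
  then have eq: "pmult (superpose' I \<omega>) x = c x" for x using from_mult(2)[OF fin] by simp
  show "pmult (superpose' I \<omega>) x = (if x \<in> I then pmult (\<omega> x) x else 0)" "pmult (superpose' I \<omega>) x \<le> pmult \<mu> x"
    using le[of x] by (simp_all add: eq) (simp add: c_def)
qed

lemma measurable_split_functional:
  assumes \<mu>: "\<mu> \<in> point_measures" and f: "laplace_test f" and g: "laplace_test g"
  shows "(\<lambda>\<kappa>. ennreal (exp (- (\<integral>x. f x \<partial>\<kappa>) - (\<integral>x. g x \<partial>point_diff \<mu> \<kappa>)))) \<in> borel_measurable point_borel"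
proof -
  have "(\<lambda>\<kappa>. point_diff \<mu> \<kappa>) \<in> measurable point_borel point_borel"
    by (rule measurable_point_diff[of "\<lambda>_. \<mu>"]) (use \<mu> in \<open>auto simp: space_point_borel\<close>)
  from measurable_compose[OF this measurable_integral_point_borel[OF laplace_testD(1)[OF g]]]
  have [measurable]: "(\<lambda>\<kappa>. \<integral>x. g x \<partial>point_diff \<mu> \<kappa>) \<in> borel_measurable point_borel" .
  have [measurable]: "(\<lambda>\<kappa>. \<integral>x. f x \<partial>\<kappa>) \<in> borel_measurable point_borel"
    by (rule measurable_integral_point_borel[OF laplace_testD(1)[OF f]])
  show ?thesis by measurable
qed

text \<open>Kept and deleted multiplicities at each atom turn the exponent into a sum over sites;
  independence of the sites makes the integral a product of site integrals, which recombines into an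
  integral against \<mu>.\<close>

theorem thin_kernel_laplace:
  fixes \<mu> :: "'a::polish_space measure"
  assumes s: "0 \<le> s" "s \<le> 1" and \<mu>: "\<mu> \<in> point_measures" and f: "laplace_test f" and g: "laplace_test g"
  shows "(\<integral>\<^sup>+\<kappa>. ennreal (exp (- (\<integral>x. f x \<partial>\<kappa>) - (\<integral>x. g x \<partial>point_diff \<mu> \<kappa>))) \<partial>thin_kernel s \<mu>)
     = ennreal (laplace (mix s f g) \<mu>)"
proof -
  define I where "I = {x. pmult \<mu> x \<noteq> 0}"
  \<comment> \<open>The product runs over all atoms, possibly infinitely many, but only these
    finitely many enter the integrals of \<open>f\<close> and \<open>g\<close>.\<close>
  define J where "J = {x \<in> {x. f x \<noteq> 0} \<union> {x. g x \<noteq> 0}. pmult \<mu> x \<noteq> 0}"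
  define Q where "Q x = convolve {..<pmult \<mu> x} (\<lambda>_. site_law s x)" for x
  define X where "X x \<kappa> = ennreal (exp (- (f x * measure \<kappa> {x} + g x * (real (pmult \<mu> x) - measure \<kappa> {x}))))" for x and \<kappa> :: "'a measure"
  have I: "countable I" unfolding I_def by (rule countable_mult[OF \<mu>])
  have J: "finite J" unfolding J_def
    by (rule finite_mult_bounded[OF \<mu>]) (use laplace_testD(4)[OF f] laplace_testD(4)[OF g] in simp)
  have JI: "J \<subseteq> I" by (auto simp: J_def I_def)
  interpret product_prob_space Q I unfolding Q_def by (rule product_prob_spaceI[OF prob_space_site_convolve])
  have sQ: "sets (Q x) = sets point_borel" for x by (simp add: Q_def)
  have Xm: "X x \<in> borel_measurable (Q x)" for x
  proof -
    have [measurable]: "(\<lambda>\<kappa>. measure \<kappa> {x}) \<in> borel_measurable point_borel" by (rule measurable_measure_point_borel) simp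
    have "X x \<in> borel_measurable point_borel" unfolding X_def by measurable
    then show ?thesis by (simp add: measurable_cong_sets[OF sQ refl])
  qed
  have "(\<integral>\<^sup>+\<kappa>. ennreal (exp (- (\<integral>x. f x \<partial>\<kappa>) - (\<integral>x. g x \<partial>point_diff \<mu> \<kappa>))) \<partial>thin_kernel s \<mu>)
    = (\<integral>\<^sup>+\<omega>. ennreal (exp (- (\<integral>x. f x \<partial>superpose' I \<omega>) - (\<integral>x. g x \<partial>point_diff \<mu> (superpose' I \<omega>)))) \<partial>PiM I Q)"
    unfolding thin_kernel_eq atoms_eq[OF \<mu>] I_def[symmetric] Q_def[symmetric]
    by (rule nn_integral_convolve[OF I sQ measurable_split_functional[OF \<mu> f g]])
  also have "\<dots> = (\<integral>\<^sup>+\<omega>. (\<Prod>x\<in>J. X x (\<omega> x)) \<partial>PiM I Q)"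
  proof (rule nn_integral_cong_AE, rule AE_mp[OF AE_thinning_sites[OF s \<mu> I, folded Q_def]], rule AE_I2, rule impI)
    fix \<omega> assume \<omega>s: "\<omega> \<in> space (PiM I Q)" and "\<forall>x\<in>I. emeasure (\<omega> x) (UNIV - {x}) \<le> 0 \<and> emeasure (\<omega> x) {x} \<le> of_nat (pmult \<mu> x)"
    then have *: "\<And>x. x \<in> I \<Longrightarrow> emeasure (\<omega> x) (UNIV - {x}) = 0 \<and> emeasure (\<omega> x) {x} \<le> of_nat (pmult \<mu> x)" by simp
    have \<omega>: "\<omega> x \<in> point_measures" if "x \<in> I" for x
      using that \<omega>s sets_eq_imp_space_eq[OF sQ] by (auto simp: space_PiM space_point_borel)
    let ?\<kappa> = "superpose' I \<omega>"
    note \<kappa> = superpose'_sites[OF \<mu> I_def \<omega> *]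
    have K: "?\<kappa> \<in> point_measures" by (rule superpose'_in_point_measures)
    have KJ: "pmult ?\<kappa> x = pmult (\<omega> x) x" "pmult ?\<kappa> x \<le> pmult \<mu> x" "\<omega> x \<in> point_measures" if "x \<in> J" for x
      using \<kappa>[of x] \<omega>[of x] that JI by auto
    have "(\<integral>x. f x \<partial>?\<kappa>) = (\<Sum>x\<in>J. f x * pmult ?\<kappa> x)"
    proof (rule integral_point_measure[OF K laplace_testD(2)[OF f] J])
      fix x assume "f x \<noteq> 0" "pmult ?\<kappa> x \<noteq> 0"
      then show "x \<in> J" using \<kappa>(2)[of x] by (simp add: J_def)
    qed
    moreover have "(\<integral>x. g x \<partial>point_diff \<mu> ?\<kappa>) = (\<Sum>x\<in>J. g x * pmult (point_diff \<mu> ?\<kappa>) x)"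
    proof (rule integral_point_measure[OF point_diff(1)[OF \<mu> K] laplace_testD(2)[OF g] J])
      fix x assume "g x \<noteq> 0" "pmult (point_diff \<mu> ?\<kappa>) x \<noteq> 0"
      then show "x \<in> J" by (simp add: J_def point_diff(2)[OF \<mu> K])
    qed
    ultimately have "- (\<integral>x. f x \<partial>?\<kappa>) - (\<integral>x. g x \<partial>point_diff \<mu> ?\<kappa>)
      = (\<Sum>x\<in>J. - (f x * pmult ?\<kappa> x + g x * pmult (point_diff \<mu> ?\<kappa>) x))"
      by (simp only: sum.distrib sum_negf minus_add_distrib diff_conv_add_uminus)
    also have "\<dots> = (\<Sum>x\<in>J. - (f x * measure (\<omega> x) {x} + g x * (real (pmult \<mu> x) - measure (\<omega> x) {x})))"
    proof (rule sum.cong[OF refl])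
      fix x assume x: "x \<in> J"
      show "- (f x * pmult ?\<kappa> x + g x * pmult (point_diff \<mu> ?\<kappa>) x) = - (f x * measure (\<omega> x) {x} + g x * (real (pmult \<mu> x) - measure (\<omega> x) {x}))"
        using KJ[OF x] by (simp add: emeasure_singleton_eq_mult(2) point_diff(2)[OF \<mu> K] of_nat_diff)
    qed
    finally show "ennreal (exp (- (\<integral>x. f x \<partial>?\<kappa>) - (\<integral>x. g x \<partial>point_diff \<mu> ?\<kappa>))) = (\<Prod>x\<in>J. X x (\<omega> x))"
      unfolding X_def by (simp only: exp_sum[OF J] prod_ennreal[OF exp_ge_zero])
  qed
  \<comment> \<open>The integrand depends on the coordinates in \<open>J\<close> only, so it is
    integrated against the finite marginal, to which the product formula applies.\<close>
  also have "\<dots> = (\<integral>\<^sup>+\<omega>. (\<Prod>x\<in>J. X x (restrict \<omega> J x)) \<partial>PiM I Q)"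
    by (intro nn_integral_cong prod.cong) auto
  also have "\<dots> = (\<integral>\<^sup>+\<omega>. (\<Prod>x\<in>J. X x (\<omega> x)) \<partial>distr (PiM I Q) (PiM J Q) (\<lambda>\<omega>. restrict \<omega> J))"
  proof (rule nn_integral_distr[symmetric])
    show "(\<lambda>\<omega>. restrict \<omega> J) \<in> measurable (PiM I Q) (PiM J Q)" by (rule measurable_restrict_subset[OF JI])
    have "(\<lambda>\<omega>. \<Prod>x\<in>J. X x (\<omega> x)) \<in> borel_measurable (PiM J Q)"
    proof (rule borel_measurable_prod_ennreal)
      fix x assume "x \<in> J"
      from measurable_compose[OF measurable_component_singleton[OF this, of Q] Xm[of x]]
      show "(\<lambda>\<omega>. X x (\<omega> x)) \<in> borel_measurable (PiM J Q)" .
    qed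
    then show "(\<lambda>\<omega>. \<Prod>x\<in>J. X x (\<omega> x)) \<in> borel_measurable (distr (PiM I Q) (PiM J Q) (\<lambda>\<omega>. restrict \<omega> J))" by simp
  qed
  also have "distr (PiM I Q) (PiM J Q) (\<lambda>\<omega>. restrict \<omega> J) = PiM J Q"
    by (rule distr_PiM_restrict_finite[OF J JI])
  also have "(\<integral>\<^sup>+\<omega>. (\<Prod>x\<in>J. X x (\<omega> x)) \<partial>PiM J Q) = (\<Prod>x\<in>J. \<integral>\<^sup>+\<kappa>. X x \<kappa> \<partial>Q x)"
    by (rule product_nn_integral_prod[OF J Xm])
  also have "\<dots> = (\<Prod>x\<in>J. ennreal (exp (- (mix s f g x * pmult \<mu> x))))"
  proof (rule prod.cong[OF refl])
    fix x
    have "0 < s * exp (- f x) + (1 - s) * exp (- g x)"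
      using s by (cases "s = 0") (auto intro: add_pos_nonneg)
    then have "(s * exp (- f x) + (1 - s) * exp (- g x)) ^ pmult \<mu> x = exp (- (mix s f g x * pmult \<mu> x))"
      by (simp add: mix_def mult.commute[of _ "real _"] exp_of_nat_mult)
    then show "(\<integral>\<^sup>+\<kappa>. X x \<kappa> \<partial>Q x) = ennreal (exp (- (mix s f g x * pmult \<mu> x)))"
      unfolding X_def Q_def site_convolve_laplace[OF s] by simp
  qed
  also have "\<dots> = ennreal (exp (- (\<Sum>x\<in>J. mix s f g x * pmult \<mu> x)))"
    by (simp only: prod_ennreal[OF exp_ge_zero] exp_sum[OF J] sum_negf[symmetric])
  also have "(\<Sum>x\<in>J. mix s f g x * pmult \<mu> x) = (\<integral>x. mix s f g x \<partial>\<mu>)"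
  proof (rule integral_point_measure[symmetric, OF \<mu> laplace_testD(2)[OF laplace_test_mix[OF s f g]] J])
    fix x assume "mix s f g x \<noteq> 0" "pmult \<mu> x \<noteq> 0"
    moreover have "mix s f g x = 0" if "f x = 0" "g x = 0" using that by (simp add: mix_def)
    ultimately show "x \<in> J" by (auto simp: J_def)
  qed
  finally show ?thesis .
qed

section \<open>Laplace functional of multi-splitting\<close>

lemma thin_kernel_laplace_single:
  fixes \<mu> :: "'a::polish_space measure"
  assumes s: "0 \<le> s" "s \<le> 1" and \<mu>: "\<mu> \<in> point_measures" and f: "laplace_test f"
  shows "(\<integral>\<^sup>+\<kappa>. ennreal (laplace f \<kappa>) \<partial>thin_kernel s \<mu>) = ennreal (laplace (mix s f (\<lambda>_. 0)) \<mu>)"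
  using thin_kernel_laplace[OF s \<mu> f laplace_test_zero] by simp

text \<open>The product space behind \<open>thin_kernel s \<mu>\<close> changes with \<mu>, but its
  Laplace functional is an explicit measurable function of \<mu>, and this suffices by
  \<open>measurable_kernel_laplace\<close>.\<close>

lemma measurable_thin_kernel:
  assumes s: "0 \<le> s" "s \<le> 1"
  shows "thin_kernel s \<in> measurable (point_borel :: 'a::polish_space measure measure) (prob_algebra point_borel)"
proof (rule measurable_kernel_laplace)
  fix f :: "'a \<Rightarrow> real" assume f: "laplace_test f"
  have [measurable]: "(\<lambda>\<mu>. \<integral>x. mix s f (\<lambda>_. 0) x \<partial>\<mu>) \<in> borel_measurable point_borel"
    by (rule measurable_integral_point_borel[OF laplace_testD(1)[OF laplace_test_mix[OF s f laplace_test_zero]]])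
  have "(\<lambda>\<mu>. ennreal (laplace (mix s f (\<lambda>_. 0)) \<mu>)) \<in> borel_measurable point_borel" by measurable
  then show "(\<lambda>\<mu>. \<integral>\<^sup>+\<kappa>. ennreal (laplace f \<kappa>) \<partial>thin_kernel s \<mu>) \<in> borel_measurable point_borel"
    by (rule measurable_cong[THEN iffD1, rotated])
       (rule thin_kernel_laplace_single[OF s _ f, symmetric], simp add: space_point_borel)
qed (simp_all add: space_point_borel prob_space_thin_kernel)

lemma measurable_superpose_finite:
  fixes I :: "'i set"
  assumes I: "finite I"
  shows "superpose I \<in> measurable (PiM I (\<lambda>_. point_borel :: 'a::polish_space measure measure)) point_borel"
proof (rule measurable_cong[THEN iffD1, OF _ measurable_superpose'[of I "\<lambda>_. point_borel"]])
  show "superpose' I \<omega> = superpose I \<omega>" if "\<omega> \<in> space (PiM I (\<lambda>_. point_borel :: 'a measure measure))" for \<omega>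
    by (rule finite_superpose(3)[OF I space_PiM_point_borelD[OF that]])
qed (use I in \<open>auto intro: countable_finite\<close>)

lemma measurable_remainder:
  fixes I :: "'i set"
  assumes I: "finite I"
  shows "(\<lambda>p. point_diff (fst p) (superpose I (snd p))) \<in>
    measurable (point_borel \<Otimes>\<^sub>M PiM I (\<lambda>_. point_borel :: 'a::polish_space measure measure)) point_borel"
  by (intro measurable_point_diff measurable_compose[OF measurable_snd measurable_superpose_finite[OF I]] measurable_fst)

lemma measurable_successive_thin:
  assumes s: "\<And>j. j \<in> {1..m} \<Longrightarrow> 0 \<le> s j \<and> s j \<le> 1"
  shows "(\<lambda>\<mu>. successive_thin s \<mu> m) \<in>
    measurable (point_borel :: 'a::polish_space measure measure) (prob_algebra (PiM {1..m} (\<lambda>_. point_borel)))"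
  using s
proof (induction m)
  case 0
  have "return (PiM {1..0::nat} (\<lambda>_. point_borel :: 'a measure measure)) (\<lambda>_. undefined)
      \<in> space (prob_algebra (PiM {1..0::nat} (\<lambda>_. point_borel)))"
    by (simp add: space_prob_algebra prob_space_return)
  then show ?case unfolding successive_thin.simps by (rule measurable_const)
next
  case (Suc m)
  let ?R = "PiM {1..m} (\<lambda>_. point_borel :: 'a measure measure)" and ?S = "PiM {1..Suc m} (\<lambda>_. point_borel :: 'a measure measure)"
  have 1: "(\<lambda>\<mu>. successive_thin s \<mu> m) \<in> measurable point_borel (prob_algebra ?R)"
    by (rule Suc.IH) (use Suc.prems in auto)
  have t: "(\<lambda>p. thin_kernel (s (Suc m)) (point_diff (fst p) (superpose {1..m} (snd p)))) \<in> measurable (point_borel \<Otimes>\<^sub>M ?R) (prob_algebra point_borel)"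
    by (rule measurable_compose[OF measurable_remainder measurable_thin_kernel]) (use Suc.prems in auto)
  have u: "(\<lambda>(p, \<kappa>'). (snd p)(Suc m := \<kappa>')) \<in> measurable ((point_borel \<Otimes>\<^sub>M ?R) \<Otimes>\<^sub>M point_borel) ?S"
    unfolding case_prod_beta'
  proof (rule measurable_fun_upd[where J="{1..m}"])
    show "{1..Suc m} = {1..m} \<union> {Suc m}" by auto
    show "(\<lambda>x. snd (fst x)) \<in> measurable ((point_borel \<Otimes>\<^sub>M ?R) \<Otimes>\<^sub>M point_borel) ?R"
      by (rule measurable_compose[OF measurable_fst measurable_snd])
  qed (rule measurable_snd)
  have "(\<lambda>p. distr (thin_kernel (s (Suc m)) (point_diff (fst p) (superpose {1..m} (snd p)))) ?S (\<lambda>\<kappa>'. (snd p)(Suc m := \<kappa>')))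
      \<in> measurable (point_borel \<Otimes>\<^sub>M ?R) (prob_algebra ?S)"
    by (rule measurable_distr_prob_space2[OF t u])
  then show ?case unfolding successive_thin.simps
    by (intro measurable_bind_prob_space2[OF 1]) (simp only: case_prod_beta')
qed

lemma atLeastAtMost_pred_insert: "1 \<le> n \<Longrightarrow> {1..n} = {1..n - 1} \<union> {n::nat}"
  by auto

lemma measurable_split_kernel:
  assumes n: "1 \<le> n" and s: "\<And>j. j \<in> {1..n - 1} \<Longrightarrow> 0 \<le> s j \<and> s j \<le> 1"
  shows "split_kernel n s \<in>
    measurable (point_borel :: 'a::polish_space measure measure) (prob_algebra (PiM {1..n} (\<lambda>_. point_borel)))"
  unfolding split_kernel_def[abs_def]
proof (rule measurable_distr_prob_space2[OF measurable_successive_thin[OF s]])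
  show "(\<lambda>(\<mu>, \<kappa>). \<kappa>(n := point_diff \<mu> (superpose {1..n - 1} \<kappa>)))
    \<in> measurable (point_borel \<Otimes>\<^sub>M PiM {1..n - 1} (\<lambda>_. point_borel)) (PiM {1..n} (\<lambda>_. point_borel :: 'a measure measure))"
    unfolding case_prod_beta'
    by (rule measurable_fun_upd[OF atLeastAtMost_pred_insert[OF n] measurable_snd measurable_remainder]) simp
qed

text \<open>Truncated subtraction of natural numbers satisfies
  \<open>a - (b + c) = a - b - c\<close>, so no inclusion between the measures is required.\<close>

lemma point_diff_superpose_Suc:
  fixes \<mu> :: "'a::polish_space measure"
  assumes \<mu>: "\<mu> \<in> point_measures" and \<kappa>: "\<And>i. i \<in> {1..m} \<Longrightarrow> \<kappa> i \<in> point_measures" and \<kappa>': "\<kappa>' \<in> point_measures"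
  shows "point_diff \<mu> (superpose {1..Suc m} (\<kappa>(Suc m := \<kappa>'))) = point_diff (point_diff \<mu> (superpose {1..m} \<kappa>)) \<kappa>'"
proof (rule point_measure_eqI)
  let ?\<omega> = "\<kappa>(Suc m := \<kappa>')"
  have \<omega>: "?\<omega> i \<in> point_measures" if "i \<in> {1..Suc m}" for i
    using \<kappa>[of i] \<kappa>' that by (cases "i = Suc m") auto
  have S: "superpose {1..Suc m} ?\<omega> \<in> point_measures" "superpose {1..m} \<kappa> \<in> point_measures"
    by (rule finite_superpose(1); use \<omega> \<kappa> in simp)+
  show "point_diff \<mu> (superpose {1..Suc m} ?\<omega>) \<in> point_measures" by (rule point_diff[OF \<mu> S(1)])
  have D: "point_diff \<mu> (superpose {1..m} \<kappa>) \<in> point_measures" by (rule point_diff[OF \<mu> S(2)])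
  then show "point_diff (point_diff \<mu> (superpose {1..m} \<kappa>)) \<kappa>' \<in> point_measures" by (rule point_diff[OF _ \<kappa>'])
  fix x
  have "pmult (superpose {1..Suc m} ?\<omega>) x = (\<Sum>i\<in>{1..Suc m}. pmult (?\<omega> i) x)"
    by (rule finite_superpose(2)[OF _ \<omega>]) simp_all
  also have "\<dots> = (\<Sum>i\<in>{1..m}. pmult (?\<omega> i) x) + pmult \<kappa>' x" by simp
  also have "(\<Sum>i\<in>{1..m}. pmult (?\<omega> i) x) = (\<Sum>i\<in>{1..m}. pmult (\<kappa> i) x)"
    by (rule sum.cong) auto
  also have "(\<Sum>i\<in>{1..m}. pmult (\<kappa> i) x) = pmult (superpose {1..m} \<kappa>) x"
    by (rule finite_superpose(2)[OF _ \<kappa>, symmetric]) simp_all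
  finally have "pmult (superpose {1..Suc m} ?\<omega>) x = pmult (superpose {1..m} \<kappa>) x + pmult \<kappa>' x" .
  then show "pmult (point_diff \<mu> (superpose {1..Suc m} ?\<omega>)) x = pmult (point_diff (point_diff \<mu> (superpose {1..m} \<kappa>)) \<kappa>') x"
    by (simp only: point_diff(2)[OF \<mu> S(1)] point_diff(2)[OF D \<kappa>'] point_diff(2)[OF \<mu> S(2)] diff_diff_left)
qed

text \<open>The function \<open>g\<close> belongs to the remainder. Thinnings are integrated out
  from the last to the first, each merging its own \<open>f\<close> with the current
  \<open>g\<close> into the function for the preceding remainder.\<close>

primrec mixes :: "(nat \<Rightarrow> real) \<Rightarrow> (nat \<Rightarrow> 'a \<Rightarrow> real) \<Rightarrow> nat \<Rightarrow> ('a \<Rightarrow> real) \<Rightarrow> 'a \<Rightarrow> real" where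
  "mixes s f 0 g = g"
| "mixes s f (Suc m) g = mixes s f m (mix (s (Suc m)) (f (Suc m)) g)"

lemma measurable_sum_integral_PiM:
  assumes f: "\<And>i. laplace_test (f i)" and J: "J \<subseteq> I"
  shows "(\<lambda>\<omega>. \<Sum>i\<in>J. \<integral>x. f i x \<partial>\<omega> i) \<in> borel_measurable (PiM I (\<lambda>_. point_borel :: 'a::polish_space measure measure))"
proof (rule borel_measurable_sum)
  fix i assume "i \<in> J"
  then have "i \<in> I" using J by blast
  from measurable_compose[OF measurable_component_singleton[OF this, of "\<lambda>_. point_borel"] measurable_integral_point_borel[OF laplace_testD(1)[OF f]]]
  show "(\<lambda>\<omega>. \<integral>x. f i x \<partial>\<omega> i) \<in> borel_measurable (PiM I (\<lambda>_. point_borel))" .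
qed

lemma successive_thin_laplace:
  fixes \<mu> :: "'a::polish_space measure"
  assumes \<mu>: "\<mu> \<in> point_measures" and s: "\<And>j. j \<in> {1..m} \<Longrightarrow> 0 \<le> s j \<and> s j \<le> 1"
    and f: "\<And>i. laplace_test (f i)" and g: "laplace_test g"
  shows "(\<integral>\<^sup>+\<kappa>. ennreal (exp (- (\<Sum>i\<in>{1..m}. \<integral>x. f i x \<partial>\<kappa> i) - (\<integral>x. g x \<partial>point_diff \<mu> (superpose {1..m} \<kappa>)))) \<partial>successive_thin s \<mu> m)
    = ennreal (laplace (mixes s f m g) \<mu>)"
  using s g
\<comment> \<open>\<open>g\<close> varies because integrating out the last thinning replaces it by a
  \<open>mix\<close>.\<close>
proof (induction m arbitrary: g)
  case 0
  let ?e = "\<lambda>\<kappa>. ennreal (exp (- (\<Sum>i\<in>{1..0::nat}. \<integral>x. f i x \<partial>\<kappa> i) - (\<integral>x. g x \<partial>point_diff \<mu> (superpose {1..0::nat} \<kappa>))))"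
  let ?u = "\<lambda>_::nat. undefined :: 'a measure"
  have S: "superpose {1..0::nat} ?u \<in> point_measures" "pmult (superpose {1..0::nat} ?u) x = 0" for x
    using finite_superpose[of "{1..0::nat}" ?u] by auto
  \<comment> \<open>Over the empty index set the superposition is the zero measure whatever
    \<open>undefined\<close> is, so the remainder is \<mu> itself.\<close>
  have "point_diff \<mu> (superpose {1..0::nat} ?u) = \<mu>"
    by (rule point_measure_eqI[OF point_diff(1)[OF \<mu> S(1)] \<mu>]) (simp only: point_diff(2)[OF \<mu> S(1)] S(2) diff_zero)
  moreover have "?e \<in> borel_measurable (PiM {1..0::nat} (\<lambda>_. point_borel))"
    by (simp add: PiM_empty)
  ultimately show ?case unfolding successive_thin.simps
    by (subst nn_integral_return) (simp_all add: space_PiM)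
next
  case (Suc m)
  let ?R = "PiM {1..m} (\<lambda>_. point_borel :: 'a measure measure)" and ?S = "PiM {1..Suc m} (\<lambda>_. point_borel :: 'a measure measure)"
  let ?\<eta> = "\<lambda>\<kappa>. point_diff \<mu> (superpose {1..m} \<kappa>)"
  let ?t = "\<lambda>\<kappa>. thin_kernel (s (Suc m)) (?\<eta> \<kappa>)"
  let ?e = "\<lambda>\<kappa>. ennreal (exp (- (\<Sum>i\<in>{1..Suc m}. \<integral>x. f i x \<partial>\<kappa> i) - (\<integral>x. g x \<partial>point_diff \<mu> (superpose {1..Suc m} \<kappa>))))"
  have s: "0 \<le> s (Suc m)" "s (Suc m) \<le> 1" using Suc.prems(1)[of "Suc m"] by auto
  have st: "sets (successive_thin s \<mu> m) = sets ?R"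
  proof -
    have "(\<lambda>\<mu>. successive_thin s \<mu> m) \<in> measurable (point_borel :: 'a measure measure) (prob_algebra ?R)"
      by (rule measurable_successive_thin) (use Suc.prems in auto)
    from measurable_space[OF this, of \<mu>] \<mu> show ?thesis by (simp add: space_point_borel space_prob_algebra)
  qed
  have rm: "?\<eta> \<in> measurable ?R point_borel"
    using measurable_compose[OF measurable_Pair1'[of \<mu> point_borel] measurable_remainder[of "{1..m}"]] \<mu>
    by (simp add: space_point_borel)
  have em: "?e \<in> borel_measurable ?S"
  proof -
    have "(\<lambda>\<kappa>. point_diff \<mu> (superpose {1..Suc m} \<kappa>)) \<in> measurable ?S point_borel"
      using measurable_compose[OF measurable_Pair1'[of \<mu> point_borel] measurable_remainder[of "{1..Suc m}"]] \<mu>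
      by (simp add: space_point_borel)
    from measurable_compose[OF this measurable_integral_point_borel[OF laplace_testD(1)[OF Suc.prems(2)]]]
    have [measurable]: "(\<lambda>\<kappa>. \<integral>x. g x \<partial>point_diff \<mu> (superpose {1..Suc m} \<kappa>)) \<in> borel_measurable ?S" .
    note [measurable] = measurable_sum_integral_PiM[of f "{1..Suc m}" "{1..Suc m}", OF f order_refl]
    show ?thesis by measurable
  qed
  have up: "(\<lambda>\<kappa>'. \<kappa>(Suc m := \<kappa>')) \<in> measurable point_borel ?S" if "\<kappa> \<in> space ?R" for \<kappa>
  proof (rule measurable_fun_upd[where J="{1..m}"])
    show "{1..Suc m} = {1..m} \<union> {Suc m}" by auto
    show "(\<lambda>x. \<kappa>) \<in> measurable point_borel ?R" using that by (rule measurable_const)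
    show "(\<lambda>x. x) \<in> measurable point_borel (point_borel :: 'a measure measure)" by simp
  qed
  have km: "(\<lambda>\<kappa>. distr (?t \<kappa>) ?S (\<lambda>\<kappa>'. \<kappa>(Suc m := \<kappa>'))) \<in> measurable (successive_thin s \<mu> m) (subprob_algebra ?S)"
    unfolding measurable_cong_sets[OF st refl]
  proof (rule measurable_distr2)
    show "?t \<in> measurable ?R (subprob_algebra point_borel)"
      by (rule measurable_compose[OF rm measurable_prob_algebraD[OF measurable_thin_kernel[OF s]]])
    show "(\<lambda>(\<kappa>, \<kappa>'). \<kappa>(Suc m := \<kappa>')) \<in> measurable (?R \<Otimes>\<^sub>M point_borel) ?S"
      unfolding case_prod_beta'
      by (rule measurable_fun_upd[where J="{1..m}"]) (auto intro: measurable_fst measurable_snd)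
  qed
  have "(\<integral>\<^sup>+\<kappa>. ?e \<kappa> \<partial>successive_thin s \<mu> (Suc m))
     = (\<integral>\<^sup>+\<kappa>. \<integral>\<^sup>+\<kappa>'. ?e \<kappa>' \<partial>distr (?t \<kappa>) ?S (\<lambda>\<kappa>'. \<kappa>(Suc m := \<kappa>')) \<partial>successive_thin s \<mu> m)"
    unfolding successive_thin.simps by (rule nn_integral_bind[OF em km])
  also have "\<dots> = (\<integral>\<^sup>+\<kappa>. ennreal (exp (- (\<Sum>i\<in>{1..m}. \<integral>x. f i x \<partial>\<kappa> i) - (\<integral>x. mix (s (Suc m)) (f (Suc m)) g x \<partial>?\<eta> \<kappa>))) \<partial>successive_thin s \<mu> m)"
  proof (rule nn_integral_cong)
    fix \<kappa> assume "\<kappa> \<in> space (successive_thin s \<mu> m)"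
    then have \<kappa>s: "\<kappa> \<in> space ?R" using sets_eq_imp_space_eq[OF st] by (simp only:)
    have \<kappa>: "\<kappa> i \<in> point_measures" if "i \<in> {1..m}" for i by (rule space_PiM_point_borelD[OF \<kappa>s that])
    have \<eta>: "?\<eta> \<kappa> \<in> point_measures"
      by (intro point_diff(1) \<mu> finite_superpose(1) \<kappa>) auto
    have m1: "?e \<in> borel_measurable (distr (?t \<kappa>) ?S (\<lambda>\<kappa>'. \<kappa>(Suc m := \<kappa>')))" using em by simp
    have m2: "(\<lambda>\<kappa>'. \<kappa>(Suc m := \<kappa>')) \<in> measurable (?t \<kappa>) ?S"
      unfolding measurable_cong_sets[OF sets_thin_kernel refl] by (rule up[OF \<kappa>s])
    have "(\<integral>\<^sup>+\<kappa>'. ?e \<kappa>' \<partial>distr (?t \<kappa>) ?S (\<lambda>\<kappa>'. \<kappa>(Suc m := \<kappa>'))) = (\<integral>\<^sup>+\<kappa>'. ?e (\<kappa>(Suc m := \<kappa>')) \<partial>?t \<kappa>)"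
      by (rule nn_integral_distr[OF m2 m1])
    also have "\<dots> = (\<integral>\<^sup>+\<kappa>'. ennreal (exp (- (\<Sum>i\<in>{1..m}. \<integral>x. f i x \<partial>\<kappa> i))) *
        ennreal (exp (- (\<integral>x. f (Suc m) x \<partial>\<kappa>') - (\<integral>x. g x \<partial>point_diff (?\<eta> \<kappa>) \<kappa>'))) \<partial>?t \<kappa>)"
    proof (rule nn_integral_cong)
      fix \<kappa>' assume "\<kappa>' \<in> space (?t \<kappa>)"
      then have \<kappa>': "\<kappa>' \<in> point_measures" using sets_eq_imp_space_eq[OF sets_thin_kernel] space_point_borel by blast
      have "(\<Sum>i\<in>{1..Suc m}. \<integral>x. f i x \<partial>(\<kappa>(Suc m := \<kappa>')) i) = (\<Sum>i\<in>{1..m}. \<integral>x. f i x \<partial>\<kappa> i) + (\<integral>x. f (Suc m) x \<partial>\<kappa>')"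
      proof -
        have "(\<Sum>i\<in>{1..m}. \<integral>x. f i x \<partial>(\<kappa>(Suc m := \<kappa>')) i) = (\<Sum>i\<in>{1..m}. \<integral>x. f i x \<partial>\<kappa> i)"
          by (rule sum.cong) auto
        then show ?thesis by simp
      qed
      then show "?e (\<kappa>(Suc m := \<kappa>')) = ennreal (exp (- (\<Sum>i\<in>{1..m}. \<integral>x. f i x \<partial>\<kappa> i))) *
        ennreal (exp (- (\<integral>x. f (Suc m) x \<partial>\<kappa>') - (\<integral>x. g x \<partial>point_diff (?\<eta> \<kappa>) \<kappa>')))"
        using point_diff_superpose_Suc[OF \<mu> \<kappa> \<kappa>']
        by (simp del: One_nat_def add: ennreal_mult[symmetric] exp_add[symmetric])
    qed
    also have "\<dots> = ennreal (exp (- (\<Sum>i\<in>{1..m}. \<integral>x. f i x \<partial>\<kappa> i))) * ennreal (laplace (mix (s (Suc m)) (f (Suc m)) g) (?\<eta> \<kappa>))"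
    proof (subst nn_integral_cmult)
      show "(\<lambda>\<kappa>'. ennreal (exp (- (\<integral>x. f (Suc m) x \<partial>\<kappa>') - (\<integral>x. g x \<partial>point_diff (?\<eta> \<kappa>) \<kappa>')))) \<in> borel_measurable (?t \<kappa>)"
        unfolding measurable_cong_sets[OF sets_thin_kernel refl]
        by (rule measurable_split_functional[OF \<eta> f Suc.prems(2)])
    qed (simp only: thin_kernel_laplace[OF s \<eta> f Suc.prems(2)])
    also have "\<dots> = ennreal (exp (- (\<Sum>i\<in>{1..m}. \<integral>x. f i x \<partial>\<kappa> i) - (\<integral>x. mix (s (Suc m)) (f (Suc m)) g x \<partial>?\<eta> \<kappa>)))"
      by (simp add: ennreal_mult[symmetric] exp_add[symmetric])
    finally show "(\<integral>\<^sup>+\<kappa>'. ?e \<kappa>' \<partial>distr (?t \<kappa>) ?S (\<lambda>\<kappa>'. \<kappa>(Suc m := \<kappa>')))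
      = ennreal (exp (- (\<Sum>i\<in>{1..m}. \<integral>x. f i x \<partial>\<kappa> i) - (\<integral>x. mix (s (Suc m)) (f (Suc m)) g x \<partial>?\<eta> \<kappa>)))" .
  qed
  also have "\<dots> = ennreal (laplace (mixes s f (Suc m) g) \<mu>)"
    unfolding mixes.simps by (rule Suc.IH) (use Suc.prems in \<open>auto intro!: laplace_test_mix s f\<close>)
  finally show ?case .
qed

lemma exp_mix:
  assumes "0 \<le> s" "s \<le> 1"
  shows "exp (- mix s f g x) = s * exp (- f x) + (1 - s) * exp (- g x)"
proof -
  have "0 < s * exp (- f x) + (1 - s) * exp (- g x)"
    using assms by (cases "s = 0") (auto intro: add_pos_nonneg)
  then show ?thesis by (simp add: mix_def)
qed

text \<open>The ratio at step \<open>m\<close> is the conditional probability of collection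
  \<open>m\<close> for a point not placed earlier. Multiplying it by the mass
  \<open>q m + ... + q n\<close> still to be distributed gives back \<open>q m\<close>, and the
  product telescopes. The bound \<open>m < n\<close> keeps this mass positive.\<close>

lemma exp_mixes:
  fixes q :: "nat \<Rightarrow> real"
  assumes q: "\<And>m. m \<in> {1..n} \<Longrightarrow> 0 < q m" "(\<Sum>m=1..n. q m) = 1" and m: "m < n"
  shows "exp (- mixes (\<lambda>m. q m / (\<Sum>j=m..n. q j)) f m g x) = (\<Sum>i=1..m. q i * exp (- f i x)) + (\<Sum>i=Suc m..n. q i) * exp (- g x)"
  using m
proof (induction m arbitrary: g)
  case 0
  then show ?case using q(2) by simp
next
  case (Suc m)
  let ?r = "\<Sum>i=Suc m..n. q i"
  have r: "?r = q (Suc m) + (\<Sum>i=Suc (Suc m)..n. q i)" using Suc.prems by (simp add: sum.atLeast_Suc_atMost)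
  have "0 \<le> (\<Sum>i=Suc (Suc m)..n. q i)" using q(1) by (intro sum_nonneg) (auto intro: less_imp_le)
  moreover have "0 < q (Suc m)" using q(1)[of "Suc m"] Suc.prems by simp
  ultimately have s: "0 \<le> q (Suc m) / ?r" "q (Suc m) / ?r \<le> 1" "?r > 0" by (simp_all add: r)
  have "exp (- mixes (\<lambda>m. q m / (\<Sum>j=m..n. q j)) f (Suc m) g x)
    = (\<Sum>i=1..m. q i * exp (- f i x)) + ?r * (q (Suc m) / ?r * exp (- f (Suc m) x) + (1 - q (Suc m) / ?r) * exp (- g x))"
    using Suc.prems by (simp add: Suc.IH exp_mix[OF s(1,2)])
  also have "?r * (q (Suc m) / ?r * exp (- f (Suc m) x) + (1 - q (Suc m) / ?r) * exp (- g x))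
    = (?r * (q (Suc m) / ?r)) * exp (- f (Suc m) x) + (?r - ?r * (q (Suc m) / ?r)) * exp (- g x)"
    by (simp only: algebra_simps)
  also have "?r * (q (Suc m) / ?r) = q (Suc m)" using s(3) by simp
  also have "?r - q (Suc m) = (\<Sum>i=Suc (Suc m)..n. q i)" by (simp add: r)
  finally show ?case by simp
qed


section \<open>Laplace functional of the multi-splitting kernel\<close>

definition splitting_mix :: "nat \<Rightarrow> (nat \<Rightarrow> real) \<Rightarrow> (nat \<Rightarrow> 'a \<Rightarrow> real) \<Rightarrow> 'a \<Rightarrow> real" where
  "splitting_mix n q f x = - ln (\<Sum>i=1..n. q i * exp (- f i x))"

context
  fixes n :: nat and q :: "nat \<Rightarrow> real"
  assumes n: "1 \<le> n" and q: "\<And>m. m \<in> {1..n} \<Longrightarrow> 0 < q m" "(\<Sum>m=1..n. q m) = 1"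
begin

lemma splitting_ratio_bounds:
  assumes "j \<in> {1..n - 1}"
  shows "0 \<le> q j / (\<Sum>i=j..n. q i) \<and> q j / (\<Sum>i=j..n. q i) \<le> 1"
proof -
  have "j \<le> n" using assms by auto
  then have "(\<Sum>i=j..n. q i) = q j + (\<Sum>i=Suc j..n. q i)" by (rule sum.atLeast_Suc_atMost)
  moreover have "0 \<le> (\<Sum>i=Suc j..n. q i)" using q(1) by (intro sum_nonneg) (auto intro: less_imp_le)
  moreover have "0 < q j" using q(1)[of j] assms by auto
  ultimately show ?thesis by simp
qed

text \<open>There are \<open>n - 1\<close> thinnings, and the final remainder is the
  \<open>n\<close>-th collection; so \<open>f n\<close> takes the place of the function for the
  remainder, with mass \<open>q n\<close> left to it.\<close>

lemma splitting_mix_eq_mixes: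
  "splitting_mix n q f = mixes (\<lambda>m. q m / (\<Sum>j=m..n. q j)) f (n - 1) (f n)"
proof
  fix x
  have "exp (- mixes (\<lambda>m. q m / (\<Sum>j=m..n. q j)) f (n - 1) (f n) x)
    = (\<Sum>i=1..n - 1. q i * exp (- f i x)) + (\<Sum>i=Suc (n - 1)..n. q i) * exp (- f n x)"
    by (rule exp_mixes[OF q]) (use n in auto)
  also have "\<dots> = (\<Sum>i=1..n. q i * exp (- f i x))"
  proof -
    obtain k where "n = Suc k" using n by (cases n) auto
    then show ?thesis by simp
  qed
  finally have "exp (- mixes (\<lambda>m. q m / (\<Sum>j=m..n. q j)) f (n - 1) (f n) x) = (\<Sum>i=1..n. q i * exp (- f i x))" .
  from this[symmetric] show "splitting_mix n q f x = mixes (\<lambda>m. q m / (\<Sum>j=m..n. q j)) f (n - 1) (f n) x"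
    by (simp only: splitting_mix_def ln_exp minus_minus)
qed

lemma laplace_test_mixes:
  assumes "\<And>j. j \<in> {1..m} \<Longrightarrow> 0 \<le> s j \<and> s j \<le> 1" "\<And>i. laplace_test (f i)" "laplace_test g"
  shows "laplace_test (mixes s f m g)"
  using assms
proof (induction m arbitrary: g)
  case (Suc m)
  have "0 \<le> s (Suc m)" "s (Suc m) \<le> 1" using Suc.prems(1)[of "Suc m"] by auto
  then have "laplace_test (mix (s (Suc m)) (f (Suc m)) g)" by (rule laplace_test_mix[OF _ _ Suc.prems(2,3)])
  then show ?case unfolding mixes.simps by (intro Suc.IH Suc.prems) auto
qed simp

lemma laplace_test_splitting_mix:
  assumes "\<And>i. laplace_test (f i)"
  shows "laplace_test (splitting_mix n q f)"
  unfolding splitting_mix_eq_mixes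
  by (rule laplace_test_mixes[OF _ assms assms]) (rule splitting_ratio_bounds)

lemma exp_splitting_mix: "exp (- splitting_mix n q f x) = (\<Sum>i=1..n. q i * exp (- f i x))"
proof -
  have "0 < (\<Sum>i=1..n. q i * exp (- f i x))" using q(1) n by (intro sum_pos) auto
  then show ?thesis by (simp add: splitting_mix_def)
qed

lemma split_kernel_laplace:
  fixes \<mu> :: "'a::polish_space measure"
  assumes \<mu>: "\<mu> \<in> point_measures" and f: "\<And>i. laplace_test (f i)"
  shows "(\<integral>\<^sup>+\<kappa>. ennreal (exp (- (\<Sum>i\<in>{1..n}. \<integral>x. f i x \<partial>\<kappa> i))) \<partial>split_kernel n (\<lambda>m. q m / (\<Sum>j=m..n. q j)) \<mu>)
    = ennreal (laplace (splitting_mix n q f) \<mu>)"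
proof -
  let ?s = "\<lambda>m. q m / (\<Sum>j=m..n. q j)"
  let ?R = "PiM {1..n - 1} (\<lambda>_. point_borel :: 'a measure measure)" and ?S = "PiM {1..n} (\<lambda>_. point_borel :: 'a measure measure)"
  let ?d = "\<lambda>\<kappa>. \<kappa>(n := point_diff \<mu> (superpose {1..n - 1} \<kappa>))"
  have st: "sets (successive_thin ?s \<mu> (n - 1)) = sets ?R"
  proof -
    have "(\<lambda>\<mu>. successive_thin ?s \<mu> (n - 1)) \<in> measurable (point_borel :: 'a measure measure) (prob_algebra ?R)"
      by (rule measurable_successive_thin) (rule splitting_ratio_bounds)
    from measurable_space[OF this, of \<mu>] \<mu> show ?thesis by (simp add: space_point_borel space_prob_algebra)
  qed
  have rm: "(\<lambda>\<kappa>. point_diff \<mu> (superpose {1..n - 1} \<kappa>)) \<in> measurable ?R point_borel"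
    using measurable_compose[OF measurable_Pair1'[of \<mu> point_borel] measurable_remainder[of "{1..n - 1}"]] \<mu>
    by (simp add: space_point_borel)
  have d: "?d \<in> measurable (successive_thin ?s \<mu> (n - 1)) ?S"
    unfolding measurable_cong_sets[OF st refl]
    by (rule measurable_fun_upd[OF atLeastAtMost_pred_insert[OF n] _ rm]) simp
  have e: "(\<lambda>\<kappa>. ennreal (exp (- (\<Sum>i\<in>{1..n}. \<integral>x. f i x \<partial>\<kappa> i)))) \<in> borel_measurable ?S"
    using measurable_sum_integral_PiM[of f "{1..n}" "{1..n}", OF f order_refl] by measurable
  have "(\<integral>\<^sup>+\<kappa>. ennreal (exp (- (\<Sum>i\<in>{1..n}. \<integral>x. f i x \<partial>\<kappa> i))) \<partial>split_kernel n ?s \<mu>)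
    = (\<integral>\<^sup>+\<kappa>. ennreal (exp (- (\<Sum>i\<in>{1..n}. \<integral>x. f i x \<partial>?d \<kappa> i))) \<partial>successive_thin ?s \<mu> (n - 1))"
    unfolding split_kernel_def by (rule nn_integral_distr[OF d]) (use e in simp)
  also have "\<dots> = (\<integral>\<^sup>+\<kappa>. ennreal (exp (- (\<Sum>i\<in>{1..n - 1}. \<integral>x. f i x \<partial>\<kappa> i) - (\<integral>x. f n x \<partial>point_diff \<mu> (superpose {1..n - 1} \<kappa>)))) \<partial>successive_thin ?s \<mu> (n - 1))"
  proof (rule nn_integral_cong)
    fix \<kappa>
    have "(\<Sum>i\<in>{1..n}. \<integral>x. f i x \<partial>?d \<kappa> i) = (\<Sum>i\<in>{1..n - 1}. \<integral>x. f i x \<partial>?d \<kappa> i) + (\<integral>x. f n x \<partial>?d \<kappa> n)"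
      unfolding atLeastAtMost_pred_insert[OF n] using n by (subst sum.union_disjoint) auto
    also have "(\<Sum>i\<in>{1..n - 1}. \<integral>x. f i x \<partial>?d \<kappa> i) = (\<Sum>i\<in>{1..n - 1}. \<integral>x. f i x \<partial>\<kappa> i)"
      by (rule sum.cong) (use n in auto)
    finally show "ennreal (exp (- (\<Sum>i\<in>{1..n}. \<integral>x. f i x \<partial>?d \<kappa> i)))
      = ennreal (exp (- (\<Sum>i\<in>{1..n - 1}. \<integral>x. f i x \<partial>\<kappa> i) - (\<integral>x. f n x \<partial>point_diff \<mu> (superpose {1..n - 1} \<kappa>))))"
      by (simp del: One_nat_def)
  qed
  also have "\<dots> = ennreal (laplace (splitting_mix n q f) \<mu>)"
    unfolding splitting_mix_eq_mixes
    by (rule successive_thin_laplace[OF \<mu> _ f f]) (rule splitting_ratio_bounds)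
  finally show ?thesis .
qed

end

section \<open>Laplace functionals of the processes\<close>

lemma point_processD:
  assumes "point_process P"
  shows "prob_space P" "sets P = sets point_borel" "space P = point_measures" "measurable P = measurable point_borel"
  using assms sets_eq_imp_space_eq[of P point_borel]
  by (auto simp: point_process_def space_point_borel fun_eq_iff intro!: measurable_cong_sets)

lemma thinning_laplace:
  fixes P :: "'a::polish_space measure measure"
  assumes P: "point_process P" and s: "0 \<le> s" "s \<le> 1" and f: "laplace_test f"
  shows "(\<integral>\<^sup>+\<kappa>. ennreal (laplace f \<kappa>) \<partial>thinning s P) = (\<integral>\<^sup>+\<mu>. ennreal (laplace (mix s f (\<lambda>_. 0)) \<mu>) \<partial>P)"
proof -
  have [measurable]: "(\<lambda>\<mu>. \<integral>x. f x \<partial>\<mu>) \<in> borel_measurable point_borel" by (rule measurable_integral_point_borel[OF laplace_testD(1)[OF f]])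
  have e: "(\<lambda>\<mu>. ennreal (laplace f \<mu>)) \<in> borel_measurable point_borel" by measurable
  have k: "thin_kernel s \<in> measurable P (subprob_algebra point_borel)"
    unfolding point_processD(4)[OF P] by (rule measurable_prob_algebraD[OF measurable_thin_kernel[OF s]])
  show ?thesis unfolding thinning_def nn_integral_bind[OF e k]
    by (intro nn_integral_cong thin_kernel_laplace_single s f) (simp add: point_processD(3)[OF P])
qed

lemma thinning_prob_space:
  fixes P :: "'a::polish_space measure measure"
  assumes P: "point_process P" and s: "0 \<le> s" "s \<le> 1"
  shows "prob_space (thinning s P)" "sets (thinning s P) = sets point_borel"
proof -
  interpret prob_space P by (rule point_processD(1)[OF P])
  have k: "thin_kernel s \<in> measurable P (subprob_algebra point_borel)"
    unfolding point_processD(4)[OF P] by (rule measurable_prob_algebraD[OF measurable_thin_kernel[OF s]])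
  show "prob_space (thinning s P)" unfolding thinning_def
    by (rule prob_space_bind[OF AE_I2 k]) (simp add: point_processD(3)[OF P] prob_space_thin_kernel)
  show "sets (thinning s P) = sets point_borel" unfolding thinning_def
    by (rule sets_bind) (simp_all add: not_empty)
qed

context
  fixes n :: nat and q :: "nat \<Rightarrow> real" and P :: "'a::polish_space measure measure"
  assumes P: "point_process P" and n: "1 \<le> n" and q: "\<And>m. m \<in> {1..n} \<Longrightarrow> q m \<in> {0<..<1}" "(\<Sum>m=1..n. q m) = 1"
begin

lemma q_bounds: "m \<in> {1..n} \<Longrightarrow> 0 < q m" "m \<in> {1..n} \<Longrightarrow> 0 \<le> q m" "m \<in> {1..n} \<Longrightarrow> q m \<le> 1"
  using q(1)[of m] by auto

lemma multi_splitting_kernel: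
  "split_kernel n (\<lambda>m. q m / (\<Sum>j=m..n. q j)) \<in> measurable P (prob_algebra (PiM {1..n} (\<lambda>_. point_borel)))"
  unfolding point_processD(4)[OF P]
  by (rule measurable_split_kernel[OF n splitting_ratio_bounds[OF n q_bounds(1) q(2)]])

lemma multi_splitting_prob_space:
  "prob_space (multi_splitting n q P)" "sets (multi_splitting n q P) = sets (PiM {1..n} (\<lambda>_. point_borel))"
proof -
  interpret prob_space P by (rule point_processD(1)[OF P])
  have k: "split_kernel n (\<lambda>m. q m / (\<Sum>j=m..n. q j)) \<mu> \<in> space (prob_algebra (PiM {1..n} (\<lambda>_. point_borel)))" if "\<mu> \<in> space P" for \<mu>
    by (rule measurable_space[OF multi_splitting_kernel that])
  show "prob_space (multi_splitting n q P)" unfolding multi_splitting_def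
    by (rule prob_space_bind[OF AE_I2 measurable_prob_algebraD[OF multi_splitting_kernel]])
       (use k in \<open>auto simp: space_prob_algebra\<close>)
  show "sets (multi_splitting n q P) = sets (PiM {1..n} (\<lambda>_. point_borel))" unfolding multi_splitting_def
    by (rule sets_bind) (use k not_empty in \<open>auto simp: space_prob_algebra\<close>)
qed

lemma multi_splitting_laplace:
  assumes f: "\<And>i. laplace_test (f i)"
  shows "(\<integral>\<^sup>+\<kappa>. ennreal (exp (- (\<Sum>i\<in>{1..n}. \<integral>x. f i x \<partial>\<kappa> i))) \<partial>multi_splitting n q P)
    = (\<integral>\<^sup>+\<mu>. ennreal (laplace (splitting_mix n q f) \<mu>) \<partial>P)"
proof -
  have e: "(\<lambda>\<kappa>. ennreal (exp (- (\<Sum>i\<in>{1..n}. \<integral>x. f i x \<partial>\<kappa> i)))) \<in> borel_measurable (PiM {1..n} (\<lambda>_. point_borel))"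
    using measurable_sum_integral_PiM[of f "{1..n}" "{1..n}", OF f order_refl] by measurable
  show ?thesis unfolding multi_splitting_def nn_integral_bind[OF e measurable_prob_algebraD[OF multi_splitting_kernel]]
    by (intro nn_integral_cong split_kernel_laplace[OF n q_bounds(1) q(2) _ f]) (simp_all add: point_processD(3)[OF P])
qed

lemma product_thinning_prob_space:
  "prob_space (PiM {1..n} (\<lambda>m. thinning (q m) P))" "sets (PiM {1..n} (\<lambda>m. thinning (q m) P)) = sets (PiM {1..n} (\<lambda>_. point_borel))"
  by (rule prob_space_PiM, rule thinning_prob_space[OF P q_bounds(2,3)], assumption+)
     (rule sets_PiM_cong[OF refl], rule thinning_prob_space[OF P q_bounds(2,3)], assumption+)

lemma product_thinning_laplace:
  assumes f: "\<And>i. laplace_test (f i)"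
  shows "(\<integral>\<^sup>+\<kappa>. ennreal (exp (- (\<Sum>i\<in>{1..n}. \<integral>x. f i x \<partial>\<kappa> i))) \<partial>PiM {1..n} (\<lambda>m. thinning (q m) P))
    = (\<Prod>i\<in>{1..n}. \<integral>\<^sup>+\<mu>. ennreal (laplace (mix (q i) (f i) (\<lambda>_. 0)) \<mu>) \<partial>P)"
proof -
  \<comment> \<open>The locale \<open>product_prob_space\<close> asks for a probability at every
    index, but \<open>q\<close> is arbitrary outside \<open>{1..n}\<close>; extending it by 0 keeps
    all thinnings probabilities.\<close>
  define p where "p m = (if m \<in> {1..n} then q m else 0)" for m
  have p: "0 \<le> p m" "p m \<le> 1" for m using q_bounds[of m] by (auto simp: p_def)
  note sets_p = thinning_prob_space(2)[OF P p] and laplace_p = thinning_laplace[OF P p f]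
  interpret product_prob_space "\<lambda>m. thinning (p m) P"
    by (rule product_prob_spaceI[OF thinning_prob_space(1)[OF P p]])
  have eq: "PiM {1..n} (\<lambda>m. thinning (q m) P) = PiM {1..n} (\<lambda>m. thinning (p m) P)"
    by (rule PiM_cong) (auto simp: p_def)
  have m: "(\<lambda>\<kappa>. ennreal (laplace (f i) \<kappa>)) \<in> borel_measurable (thinning (p i) P)" for i
  proof -
    have [measurable]: "(\<lambda>\<kappa>. \<integral>x. f i x \<partial>\<kappa>) \<in> borel_measurable point_borel" by (rule measurable_integral_point_borel[OF laplace_testD(1)[OF f]])
    show ?thesis unfolding measurable_cong_sets[OF sets_p refl] by measurable
  qed
  have "(\<integral>\<^sup>+\<kappa>. ennreal (exp (- (\<Sum>i\<in>{1..n}. \<integral>x. f i x \<partial>\<kappa> i))) \<partial>PiM {1..n} (\<lambda>m. thinning (q m) P))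
    = (\<integral>\<^sup>+\<kappa>. (\<Prod>i\<in>{1..n}. ennreal (laplace (f i) (\<kappa> i))) \<partial>PiM {1..n} (\<lambda>m. thinning (p m) P))"
    unfolding eq by (simp only: sum_negf[symmetric] exp_sum[OF finite_atLeastAtMost] prod_ennreal[OF exp_ge_zero])
  also have "\<dots> = (\<Prod>i\<in>{1..n}. \<integral>\<^sup>+\<kappa>. ennreal (laplace (f i) \<kappa>) \<partial>thinning (p i) P)"
    by (rule product_nn_integral_prod[OF finite_atLeastAtMost m])
  also have "\<dots> = (\<Prod>i\<in>{1..n}. \<integral>\<^sup>+\<mu>. ennreal (laplace (mix (q i) (f i) (\<lambda>_. 0)) \<mu>) \<partial>P)"
    unfolding laplace_p by (rule prod.cong[OF refl]) (simp add: p_def)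
  finally show ?thesis .
qed

end

section \<open>The characterization\<close>

lemma emeasure_first_moment:
  fixes P :: "'a::polish_space measure measure"
  assumes P: "point_process P" and B: "B \<in> sets borel"
  shows "emeasure (first_moment P) B = (\<integral>\<^sup>+\<mu>. emeasure \<mu> B \<partial>P)"
  unfolding first_moment_def
proof (rule emeasure_measure_of_sigma)
  show "sigma_algebra UNIV (sets (borel :: 'a measure))"
    using sets.sigma_algebra_axioms[of "borel :: 'a measure"] by simp
  show "positive (sets borel) (\<lambda>B. \<integral>\<^sup>+\<mu>. emeasure \<mu> B \<partial>P)"
    by (simp add: positive_def)
  show "countably_additive (sets borel) (\<lambda>B. \<integral>\<^sup>+\<mu>. emeasure \<mu> B \<partial>P)"
  proof (rule countably_additiveI)
    fix A :: "nat \<Rightarrow> 'a set"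
    assume A: "range A \<subseteq> sets borel" "disjoint_family A"
    have m: "(\<lambda>\<mu>. emeasure \<mu> (A n)) \<in> borel_measurable P" for n
      unfolding point_processD(4)[OF P] using A by (intro measurable_emeasure_point_borel) auto
    have "(\<Sum>n. \<integral>\<^sup>+\<mu>. emeasure \<mu> (A n) \<partial>P) = (\<integral>\<^sup>+\<mu>. (\<Sum>n. emeasure \<mu> (A n)) \<partial>P)"
      by (rule nn_integral_suminf[symmetric, OF m])
    also have "\<dots> = (\<integral>\<^sup>+\<mu>. emeasure \<mu> (\<Union>n. A n) \<partial>P)"
      using A point_measuresD(2) by (intro nn_integral_cong suminf_emeasure) (auto simp: point_processD(3)[OF P])
    finally show "(\<Sum>n. \<integral>\<^sup>+\<mu>. emeasure \<mu> (A n) \<partial>P) = (\<integral>\<^sup>+\<mu>. emeasure \<mu> (\<Union>n. A n) \<partial>P)" .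
  qed
qed (rule B)

lemma nn_integral_first_moment:
  fixes P :: "'a::polish_space measure measure"
  assumes P: "point_process P" and u: "u \<in> borel_measurable borel"
  shows "(\<integral>\<^sup>+x. u x \<partial>first_moment P) = (\<integral>\<^sup>+\<mu>. (\<integral>\<^sup>+x. u x \<partial>\<mu>) \<partial>P)"
proof -
  have sets_fm: "sets (first_moment P) = sets borel"
    using sets.sigma_sets_eq[of borel] by (simp add: first_moment_def sets_measure_of_conv)
  note mfm = measurable_cong_sets[OF sets_fm refl]
  have PM: "sets \<mu> = sets borel" if "\<mu> \<in> space P" for \<mu>
    using that by (simp add: point_processD(3)[OF P] point_measuresD(2))
  have m: "(\<lambda>\<mu>. \<integral>\<^sup>+x. v x \<partial>\<mu>) \<in> borel_measurable P" if "v \<in> borel_measurable borel" for v :: "'a \<Rightarrow> ennreal"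
    by (rule measurable_nn_integral_locally_finite[OF PM _ that]) (simp_all add: point_processD(4)[OF P] measurable_emeasure_point_borel)
  show ?thesis using u
  proof (induction u rule: borel_measurable_induct)
    case (cong f g)
    then show ?case by (simp cong: nn_integral_cong)
  next
    case (set A)
    have "(\<integral>\<^sup>+\<mu>. (\<integral>\<^sup>+x. indicator A x \<partial>\<mu>) \<partial>P) = (\<integral>\<^sup>+\<mu>. emeasure \<mu> A \<partial>P)"
      by (rule nn_integral_cong) (simp add: PM set)
    then show ?case using set by (simp add: sets_fm emeasure_first_moment[OF P])
  next
    case (mult u c)
    have "(\<integral>\<^sup>+\<mu>. (\<integral>\<^sup>+x. c * u x \<partial>\<mu>) \<partial>P) = (\<integral>\<^sup>+\<mu>. c * (\<integral>\<^sup>+x. u x \<partial>\<mu>) \<partial>P)"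
    proof (rule nn_integral_cong)
      fix \<mu> assume "\<mu> \<in> space P"
      then have "u \<in> borel_measurable \<mu>" using mult by (simp add: measurable_cong_sets[OF PM refl])
      then show "(\<integral>\<^sup>+x. c * u x \<partial>\<mu>) = c * (\<integral>\<^sup>+x. u x \<partial>\<mu>)" by (rule nn_integral_cmult)
    qed
    also have "\<dots> = c * (\<integral>\<^sup>+x. u x \<partial>first_moment P)" using m mult by (simp add: nn_integral_cmult)
    finally show ?case using mult by (simp add: nn_integral_cmult mfm)
  next
    case (add u v)
    have "(\<integral>\<^sup>+\<mu>. (\<integral>\<^sup>+x. v x + u x \<partial>\<mu>) \<partial>P) = (\<integral>\<^sup>+\<mu>. (\<integral>\<^sup>+x. v x \<partial>\<mu>) + (\<integral>\<^sup>+x. u x \<partial>\<mu>) \<partial>P)"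
    proof (rule nn_integral_cong)
      fix \<mu> assume "\<mu> \<in> space P"
      then have "u \<in> borel_measurable \<mu>" "v \<in> borel_measurable \<mu>" using add by (simp_all add: measurable_cong_sets[OF PM refl])
      then show "(\<integral>\<^sup>+x. v x + u x \<partial>\<mu>) = (\<integral>\<^sup>+x. v x \<partial>\<mu>) + (\<integral>\<^sup>+x. u x \<partial>\<mu>)" by (intro nn_integral_add)
    qed
    also have "\<dots> = (\<integral>\<^sup>+x. v x \<partial>first_moment P) + (\<integral>\<^sup>+x. u x \<partial>first_moment P)" using m add by (simp add: nn_integral_add)
    finally show ?case using add by (simp add: nn_integral_add mfm)
  next
    case (seq U)
    have "(\<integral>\<^sup>+\<mu>. (\<integral>\<^sup>+x. (SUP i. U i x) \<partial>\<mu>) \<partial>P) = (\<integral>\<^sup>+\<mu>. (SUP i. \<integral>\<^sup>+x. U i x \<partial>\<mu>) \<partial>P)"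
    proof (rule nn_integral_cong)
      fix \<mu> assume "\<mu> \<in> space P"
      then have "U i \<in> borel_measurable \<mu>" for i using seq by (simp add: measurable_cong_sets[OF PM refl])
      then show "(\<integral>\<^sup>+x. (SUP i. U i x) \<partial>\<mu>) = (SUP i. \<integral>\<^sup>+x. U i x \<partial>\<mu>)"
        by (intro nn_integral_monotone_convergence_SUP seq)
    qed
    also have "\<dots> = (SUP i. \<integral>\<^sup>+\<mu>. (\<integral>\<^sup>+x. U i x \<partial>\<mu>) \<partial>P)"
    proof (rule nn_integral_monotone_convergence_SUP)
      show "incseq (\<lambda>i \<mu>. \<integral>\<^sup>+x. U i x \<partial>\<mu>)"
        by (intro monoI le_funI nn_integral_mono) (rule le_funD[OF incseqD[OF seq(3)]])
    qed (rule m[OF seq(1)])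
    also have "\<dots> = (SUP i. \<integral>\<^sup>+x. U i x \<partial>first_moment P)" using seq by simp
    also have "\<dots> = (\<integral>\<^sup>+x. (SUP i. U i x) \<partial>first_moment P)"
      by (rule nn_integral_monotone_convergence_SUP[symmetric, OF seq(3)]) (simp add: mfm seq)
    finally show ?case by (simp add: image_comp)
  qed
qed

text \<open>A test function is integrable against the locally finite first moment measure, so the
  expectation of its integral, computed as a nonnegative integral, is finite.\<close>

lemma campbell:
  fixes P :: "'a::polish_space measure measure"
  assumes P: "point_process P" and fo: "first_order P" and u: "laplace_test u"
  shows "integrable P (\<lambda>\<mu>. \<integral>x. u x \<partial>\<mu>)" "(\<integral>\<mu>. (\<integral>x. u x \<partial>\<mu>) \<partial>P) = (\<integral>x. u x \<partial>first_moment P)"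
proof -
  have LF: "first_moment P \<in> locally_finite_measures" using fo by (simp add: first_order_def)
  have m: "(\<lambda>\<mu>. \<integral>x. u x \<partial>\<mu>) \<in> borel_measurable P"
    unfolding point_processD(4)[OF P] by (rule measurable_integral_point_borel[OF laplace_testD(1)[OF u]])
  have "(\<integral>\<^sup>+\<mu>. ennreal (\<integral>x. u x \<partial>\<mu>) \<partial>P) = (\<integral>\<^sup>+\<mu>. (\<integral>\<^sup>+x. ennreal (u x) \<partial>\<mu>) \<partial>P)"
  proof (rule nn_integral_cong)
    fix \<mu> assume "\<mu> \<in> space P"
    then have "\<mu> \<in> locally_finite_measures" by (simp add: point_processD(3)[OF P] point_measuresD(1))
    then show "ennreal (\<integral>x. u x \<partial>\<mu>) = (\<integral>\<^sup>+x. ennreal (u x) \<partial>\<mu>)"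
      using laplace_testD(3)[OF u] by (intro nn_integral_eq_integral[symmetric] integrable_laplace_test u) auto
  qed
  also have "\<dots> = (\<integral>\<^sup>+x. ennreal (u x) \<partial>first_moment P)"
    using laplace_testD(2)[OF u] by (intro nn_integral_first_moment[OF P, symmetric]) simp
  also have "\<dots> = ennreal (\<integral>x. u x \<partial>first_moment P)"
    using laplace_testD(3)[OF u] by (intro nn_integral_eq_integral integrable_laplace_test u LF) auto
  finally have eq: "(\<integral>\<^sup>+\<mu>. ennreal (\<integral>x. u x \<partial>\<mu>) \<partial>P) = ennreal (\<integral>x. u x \<partial>first_moment P)" .
  have nn: "0 \<le> (\<integral>x. u x \<partial>\<mu>)" for \<mu> using laplace_testD(3)[OF u] by (intro Bochner_Integration.integral_nonneg) auto
  show "integrable P (\<lambda>\<mu>. \<integral>x. u x \<partial>\<mu>)"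
    by (rule integrableI_nn_integral_finite[OF m _ eq]) (simp add: nn)
  show "(\<integral>\<mu>. (\<integral>x. u x \<partial>\<mu>) \<partial>P) = (\<integral>x. u x \<partial>first_moment P)"
    using m nn by (simp add: integral_eq_nn_integral eq)
qed

text \<open>For \<open>b\<close> and \<open>p\<close> in the unit interval, \<open>1 - b p\<close>
  is at most \<open>(1 - b) + (1 - p)\<close>; Bernoulli's inequality bounds the contribution of
  each single power.\<close>

lemma one_minus_prod_power_le:
  fixes a :: "'i \<Rightarrow> real" and k :: "'i \<Rightarrow> nat"
  assumes "finite J" "\<And>x. x \<in> J \<Longrightarrow> 0 \<le> a x \<and> a x \<le> 1"
  shows "1 - (\<Prod>x\<in>J. (1 - a x) ^ k x) \<le> (\<Sum>x\<in>J. a x * k x)"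
  using assms
proof (induction J rule: finite_induct)
  case (insert y J)
  let ?p = "\<Prod>x\<in>J. (1 - a x) ^ k x" and ?b = "(1 - a y) ^ k y"
  have p: "0 \<le> ?p" "?p \<le> 1" using insert.prems by (auto intro!: prod_nonneg prod_le_1 simp: power_le_one)
  have a: "0 \<le> a y" "a y \<le> 1" using insert.prems by auto
  have "1 + real (k y) * (- a y) \<le> (1 + (- a y)) ^ k y" using a by (intro Bernoulli_inequality) simp
  then have b: "1 - a y * k y \<le> ?b" by (simp add: mult.commute)
  have "?b \<le> 1" using a by (intro power_le_one) auto
  have "1 - ?b * ?p = (1 - ?b) * ?p + (1 - ?p)" by (simp add: algebra_simps)
  also have "(1 - ?b) * ?p \<le> (1 - ?b) * 1" using \<open>?b \<le> 1\<close> p by (intro mult_left_mono) auto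
  finally have "1 - ?b * ?p \<le> (1 - ?b) + (1 - ?p)" by simp
  moreover have "1 - ?p \<le> (\<Sum>x\<in>J. a x * k x)" using insert by auto
  ultimately show ?case using insert.hyps b by simp
qed simp

section \<open>Behaviour of the Laplace functional as the retention probability tends to 0\<close>

context
  fixes f :: "'a::polish_space \<Rightarrow> real"
  assumes f: "laplace_test f"
begin

lemma laplace_test_one_minus_exp: "laplace_test (\<lambda>x. 1 - exp (- f x))"
proof -
  have "bounded (range (\<lambda>x. 1 - exp (- f x)))"
    unfolding bounded_iff using laplace_testD(3)[OF f] by (intro exI[of _ 1]) auto
  moreover have "bounded {x. 1 - exp (- f x) \<noteq> 0}" using laplace_testD(4)[OF f] by simp
  ultimately show ?thesis
    using laplace_testD(2,3)[OF f] by (simp add: laplace_test_def bounded_support_fun_def)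
qed

text \<open>For fixed \<mu> this is a polynomial in \<open>t\<close>. Both the bound linear in
  \<open>t\<close> and the derivative at 0 are read off from it.\<close>

lemma laplace_mix_eq_prod:
  assumes \<mu>: "\<mu> \<in> point_measures" and t: "0 \<le> t" "t \<le> 1"
    and J: "finite J" "\<And>x. f x \<noteq> 0 \<Longrightarrow> pmult \<mu> x \<noteq> 0 \<Longrightarrow> x \<in> J"
  shows "laplace (mix t f (\<lambda>_. 0)) \<mu> = (\<Prod>x\<in>J. (1 - t * (1 - exp (- f x))) ^ pmult \<mu> x)"
proof -
  have "(\<integral>x. mix t f (\<lambda>_. 0) x \<partial>\<mu>) = (\<Sum>x\<in>J. mix t f (\<lambda>_. 0) x * pmult \<mu> x)"
  proof (rule integral_point_measure[OF \<mu> laplace_testD(2)[OF laplace_test_mix[OF t f laplace_test_zero]] J(1)])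
    fix x assume "mix t f (\<lambda>_. 0) x \<noteq> 0" "pmult \<mu> x \<noteq> 0"
    moreover have "mix t f (\<lambda>_. 0) x = 0" if "f x = 0" using that by (simp add: mix_def)
    ultimately show "x \<in> J" using J(2) by blast
  qed
  then have "laplace (mix t f (\<lambda>_. 0)) \<mu> = (\<Prod>x\<in>J. exp (- (mix t f (\<lambda>_. 0) x * pmult \<mu> x)))"
    by (simp only: sum_negf[symmetric] exp_sum[OF J(1)])
  also have "\<dots> = (\<Prod>x\<in>J. (1 - t * (1 - exp (- f x))) ^ pmult \<mu> x)"
  proof (rule prod.cong[OF refl])
    fix x
    have "exp (- (mix t f (\<lambda>_. 0) x * pmult \<mu> x)) = exp (- mix t f (\<lambda>_. 0) x) ^ pmult \<mu> x"
      by (subst exp_of_nat_mult[symmetric]) (simp add: mult.commute)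
    also have "exp (- mix t f (\<lambda>_. 0) x) = 1 - t * (1 - exp (- f x))"
      unfolding exp_mix[OF t] by (simp add: algebra_simps)
    finally show "exp (- (mix t f (\<lambda>_. 0) x * pmult \<mu> x)) = (1 - t * (1 - exp (- f x))) ^ pmult \<mu> x" .
  qed
  finally show ?thesis .
qed

lemma finite_support_point_measure:
  assumes "\<mu> \<in> point_measures"
  shows "finite {x \<in> {x. f x \<noteq> 0}. pmult \<mu> x \<noteq> 0}"
  by (rule finite_mult_bounded[OF assms laplace_testD(4)[OF f]])

lemma integral_one_minus_exp:
  assumes "\<mu> \<in> point_measures"
  shows "(\<integral>x. 1 - exp (- f x) \<partial>\<mu>) = (\<Sum>x\<in>{x \<in> {x. f x \<noteq> 0}. pmult \<mu> x \<noteq> 0}. (1 - exp (- f x)) * pmult \<mu> x)"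
  by (rule integral_point_measure[OF assms laplace_testD(2)[OF laplace_test_one_minus_exp] finite_support_point_measure[OF assms]]) auto

text \<open>After division by \<open>t\<close> the upper bound no longer depends on
  \<open>t\<close>: it dominates all difference quotients at 0.\<close>

lemma one_minus_laplace_mix_bounds:
  assumes \<mu>: "\<mu> \<in> point_measures" and t: "0 \<le> t" "t \<le> 1"
  shows "0 \<le> 1 - laplace (mix t f (\<lambda>_. 0)) \<mu>"
    "1 - laplace (mix t f (\<lambda>_. 0)) \<mu> \<le> t * (\<integral>x. 1 - exp (- f x) \<partial>\<mu>)"
proof -
  let ?J = "{x \<in> {x. f x \<noteq> 0}. pmult \<mu> x \<noteq> 0}"
  have "0 \<le> (\<integral>x. mix t f (\<lambda>_. 0) x \<partial>\<mu>)"
    using laplace_testD(3)[OF laplace_test_mix[OF t f laplace_test_zero]] by (intro Bochner_Integration.integral_nonneg) auto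
  then show "0 \<le> 1 - laplace (mix t f (\<lambda>_. 0)) \<mu>" by simp
  have "1 - (\<Prod>x\<in>?J. (1 - t * (1 - exp (- f x))) ^ pmult \<mu> x) \<le> (\<Sum>x\<in>?J. t * (1 - exp (- f x)) * pmult \<mu> x)"
  proof (rule one_minus_prod_power_le[OF finite_support_point_measure[OF \<mu>]])
    fix x
    have "t * (1 - exp (- f x)) \<le> 1 * 1" using t laplace_testD(3)[OF f, of x] by (intro mult_mono) auto
    then show "0 \<le> t * (1 - exp (- f x)) \<and> t * (1 - exp (- f x)) \<le> 1" using t laplace_testD(3)[OF f, of x] by auto
  qed
  also have "\<dots> = t * (\<integral>x. 1 - exp (- f x) \<partial>\<mu>)"
    unfolding integral_one_minus_exp[OF \<mu>] sum_distrib_left by (simp only: mult.assoc)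
  finally show "1 - laplace (mix t f (\<lambda>_. 0)) \<mu> \<le> t * (\<integral>x. 1 - exp (- f x) \<partial>\<mu>)"
    by (subst laplace_mix_eq_prod[OF \<mu> t finite_support_point_measure[OF \<mu>]]) auto
qed

text \<open>These are the negated difference quotients at 0 of a finite product. All factors equal 1
  at 0, so the derivative of the product is the sum of the derivatives of its factors.\<close>

lemma laplace_mix_derivative:
  assumes \<mu>: "\<mu> \<in> point_measures" and t: "\<And>k::nat. 0 < t k \<and> t k \<le> 1" "t \<longlonglongrightarrow> 0"
  shows "(\<lambda>k. (1 - laplace (mix (t k) f (\<lambda>_. 0)) \<mu>) / t k) \<longlonglongrightarrow> (\<integral>x. 1 - exp (- f x) \<partial>\<mu>)"
proof -
  let ?J = "{x \<in> {x. f x \<noteq> 0}. pmult \<mu> x \<noteq> 0}"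
  let ?u = "\<lambda>x. 1 - exp (- f x)"
  define F where "F s = (\<Prod>x\<in>?J. (1 - s * ?u x) ^ pmult \<mu> x)" for s
  have "((\<lambda>s. \<Prod>x\<in>?J. (1 - s * ?u x) ^ pmult \<mu> x) has_real_derivative
     (\<Sum>x\<in>?J. - (?u x * pmult \<mu> x))) (at 0)"
    if "finite J'" "J' = ?J" for J'
  proof -
    have "((\<lambda>s. \<Prod>x\<in>S. (1 - s * ?u x) ^ pmult \<mu> x) has_real_derivative (\<Sum>x\<in>S. - (?u x * pmult \<mu> x))) (at 0)" if "finite S" for S
      using that
    proof (induction S rule: finite_induct)
      case (insert y S)
      have "((\<lambda>s. (1 - s * ?u y) ^ pmult \<mu> y) has_real_derivative - (?u y * pmult \<mu> y)) (at 0)"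
        by (auto intro!: derivative_eq_intros simp: algebra_simps)
      from DERIV_mult[OF this insert.IH] show ?case using insert.hyps by (simp add: algebra_simps)
    qed simp
    then show ?thesis using that by blast
  qed
  then have "(F has_real_derivative - (\<integral>x. ?u x \<partial>\<mu>)) (at 0)"
    using finite_support_point_measure[OF \<mu>] unfolding F_def integral_one_minus_exp[OF \<mu>] sum_negf by blast
  then have "(\<lambda>s. (F s - F 0) / (s - 0)) \<midarrow>0\<rightarrow> - (\<integral>x. ?u x \<partial>\<mu>)"
    by (simp only: has_field_derivative_iff)
  then have lim: "(\<lambda>k. (F (t k) - F 0) / (t k - 0)) \<longlonglongrightarrow> - (\<integral>x. ?u x \<partial>\<mu>)"
  proof (rule filterlim_compose)
    have "t k \<noteq> 0" for k using t(1)[of k] by simp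
    then show "filterlim t (at 0) sequentially" by (simp add: filterlim_at t(2))
  qed
  have F0: "F 0 = 1" by (simp add: F_def)
  have "(1 - laplace (mix (t k) f (\<lambda>_. 0)) \<mu>) / t k = - ((F (t k) - F 0) / (t k - 0))" for k
  proof -
    have "laplace (mix (t k) f (\<lambda>_. 0)) \<mu> = F (t k)"
      unfolding F_def by (rule laplace_mix_eq_prod[OF \<mu> _ _ finite_support_point_measure[OF \<mu>]]) (use t(1)[of k] in auto)
    then show ?thesis using F0 by (simp add: minus_divide_left)
  qed
  then show ?thesis using tendsto_minus[OF lim] by simp
qed

end

lemma measurable_laplace:
  assumes P: "point_process P" and f: "laplace_test f"
  shows "(\<lambda>\<mu>. laplace f \<mu>) \<in> borel_measurable P"
proof -
  have [measurable]: "(\<lambda>\<mu>. \<integral>x. f x \<partial>\<mu>) \<in> borel_measurable P"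
    unfolding point_processD(4)[OF P] by (rule measurable_integral_point_borel[OF laplace_testD(1)[OF f]])
  show ?thesis by measurable
qed

lemma integrable_laplace:
  assumes P: "point_process P" and f: "laplace_test f"
  shows "integrable P (\<lambda>\<mu>. laplace f \<mu>)"
proof -
  interpret prob_space P by (rule point_processD(1)[OF P])
  have "0 \<le> (\<integral>x. f x \<partial>\<mu>)" for \<mu> using laplace_testD(3)[OF f] by (intro Bochner_Integration.integral_nonneg) auto
  then show ?thesis by (intro integrable_const_bound[of _ 1] measurable_laplace[OF P f] AE_I2) simp
qed

lemma nn_integral_laplace:
  assumes P: "point_process P" and f: "laplace_test f"
  shows "(\<integral>\<^sup>+\<mu>. ennreal (laplace f \<mu>) \<partial>P) = ennreal (\<integral>\<mu>. laplace f \<mu> \<partial>P)"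
  by (rule nn_integral_eq_integral[OF integrable_laplace[OF P f]]) simp

text \<open>A positive integrand cannot have integral 0 under a probability. Positivity is what
  permits taking logarithms of the functional.\<close>

lemma laplace_functional_bounds:
  assumes P: "point_process P" and f: "laplace_test f"
  shows "0 < (\<integral>\<mu>. laplace f \<mu> \<partial>P)" "(\<integral>\<mu>. laplace f \<mu> \<partial>P) \<le> 1"
proof -
  interpret prob_space P by (rule point_processD(1)[OF P])
  have nn: "0 \<le> (\<integral>x. f x \<partial>\<mu>)" for \<mu> using laplace_testD(3)[OF f] by (intro Bochner_Integration.integral_nonneg) auto
  have "0 \<le> (\<integral>\<mu>. laplace f \<mu> \<partial>P)" by (intro Bochner_Integration.integral_nonneg) simp
  moreover have "(\<integral>\<mu>. laplace f \<mu> \<partial>P) \<noteq> 0"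
  proof
    assume "(\<integral>\<mu>. laplace f \<mu> \<partial>P) = 0"
    then have "AE \<mu> in P. laplace f \<mu> = 0"
      by (subst (asm) integral_nonneg_eq_0_iff_AE[OF integrable_laplace[OF P f]]) auto
    then show False by (simp add: AE_False)
  qed
  ultimately show "0 < (\<integral>\<mu>. laplace f \<mu> \<partial>P)" by linarith
  have "(\<integral>\<mu>. laplace f \<mu> \<partial>P) \<le> (\<integral>\<mu>. 1 \<partial>P)"
    using nn by (intro integral_mono integrable_laplace[OF P f]) auto
  then show "(\<integral>\<mu>. laplace f \<mu> \<partial>P) \<le> 1" by (simp add: prob_space)
qed

text \<open>The derivative for fixed \<mu> passes through the expectation by dominated convergence,
  with the integral of \<open>1 - exp (- f x)\<close> against \<mu> as integrable bound. Near 1 the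
  negative logarithm of \<open>G\<close> agrees with \<open>1 - G\<close> to first order.\<close>

lemma laplace_functional_derivative:
  fixes P :: "'a::polish_space measure measure"
  assumes P: "point_process P" and fo: "first_order P" and f: "laplace_test f"
    and t: "\<And>k::nat. 0 < t k \<and> t k \<le> 1" "t \<longlonglongrightarrow> 0"
  shows "(\<lambda>k. - ln (\<integral>\<mu>. laplace (mix (t k) f (\<lambda>_. 0)) \<mu> \<partial>P) / t k) \<longlonglongrightarrow> (\<integral>x. 1 - exp (- f x) \<partial>first_moment P)"
proof -
  interpret prob_space P by (rule point_processD(1)[OF P])
  define G where "G k = (\<integral>\<mu>. laplace (mix (t k) f (\<lambda>_. 0)) \<mu> \<partial>P)" for k
  let ?a = "\<integral>x. 1 - exp (- f x) \<partial>first_moment P"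
  have test: "laplace_test (mix (t k) f (\<lambda>_. 0))" for k
    using t(1)[of k] by (intro laplace_test_mix f laplace_test_zero) auto
  have PM: "\<mu> \<in> point_measures" if "\<mu> \<in> space P" for \<mu> using that by (simp add: point_processD(3)[OF P])
  have G: "0 < G k" "G k \<le> 1" for k unfolding G_def by (rule laplace_functional_bounds[OF P test])+
  have "(\<lambda>k. \<integral>\<mu>. (1 - laplace (mix (t k) f (\<lambda>_. 0)) \<mu>) / t k \<partial>P) \<longlonglongrightarrow> (\<integral>\<mu>. (\<integral>x. 1 - exp (- f x) \<partial>\<mu>) \<partial>P)"
  proof (rule integral_dominated_convergence[where w="\<lambda>\<mu>. \<integral>x. 1 - exp (- f x) \<partial>\<mu>"])
    show "integrable P (\<lambda>\<mu>. \<integral>x. 1 - exp (- f x) \<partial>\<mu>)" by (rule campbell(1)[OF P fo laplace_test_one_minus_exp[OF f]])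
    then show "(\<lambda>\<mu>. \<integral>x. 1 - exp (- f x) \<partial>\<mu>) \<in> borel_measurable P" by (rule borel_measurable_integrable)
    show "(\<lambda>\<mu>. (1 - laplace (mix (t k) f (\<lambda>_. 0)) \<mu>) / t k) \<in> borel_measurable P" for k
      using measurable_laplace[OF P test[of k]] by measurable
    show "AE \<mu> in P. (\<lambda>k. (1 - laplace (mix (t k) f (\<lambda>_. 0)) \<mu>) / t k) \<longlonglongrightarrow> (\<integral>x. 1 - exp (- f x) \<partial>\<mu>)"
      by (rule AE_I2) (rule laplace_mix_derivative[OF f PM t])
    show "AE \<mu> in P. norm ((1 - laplace (mix (t k) f (\<lambda>_. 0)) \<mu>) / t k) \<le> (\<integral>x. 1 - exp (- f x) \<partial>\<mu>)" for k
    proof (rule AE_I2)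
      fix \<mu> assume "\<mu> \<in> space P"
      then show "norm ((1 - laplace (mix (t k) f (\<lambda>_. 0)) \<mu>) / t k) \<le> (\<integral>x. 1 - exp (- f x) \<partial>\<mu>)"
        using one_minus_laplace_mix_bounds[OF f PM, of \<mu> "t k"] t(1)[of k]
        by (simp add: pos_divide_le_eq mult.commute abs_of_nonneg)
    qed
  qed
  moreover have eq: "(\<integral>\<mu>. (1 - laplace (mix (t k) f (\<lambda>_. 0)) \<mu>) / t k \<partial>P) = (1 - G k) / t k" for k
    using integrable_laplace[OF P test[of k]] by (simp add: G_def prob_space)
  ultimately have lim: "(\<lambda>k. (1 - G k) / t k) \<longlonglongrightarrow> ?a"
    by (simp only: eq campbell(2)[OF P fo laplace_test_one_minus_exp[OF f]])
  \<comment> \<open>\<open>1 - G k\<close> is a convergent quotient times a null sequence, hence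
    \<open>G\<close> tends to 1.\<close>
  have "(\<lambda>k. (1 - G k) / t k * t k) \<longlonglongrightarrow> ?a * 0" by (rule tendsto_mult[OF lim t(2)])
  moreover have "(1 - G k) / t k * t k = 1 - G k" for k using t(1)[of k] by simp
  ultimately have "(\<lambda>k. 1 - (1 - G k)) \<longlonglongrightarrow> 1 - 0" by (intro tendsto_diff tendsto_const) simp
  then have G1: "G \<longlonglongrightarrow> 1" by simp
  have "(\<lambda>k. (1 - G k) / t k / G k) \<longlonglongrightarrow> ?a / 1" by (intro tendsto_divide lim G1) simp
  then have lim2: "(\<lambda>k. (1 - G k) / t k / G k) \<longlonglongrightarrow> ?a" by simp
  \<comment> \<open>Sandwich by \<open>1 - G \<le> - ln G \<le> (1 - G) / G\<close>; the second
    inequality is the first bound for the logarithm applied to \<open>1 / G\<close>.\<close>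
  have "(\<lambda>k. - ln (G k) / t k) \<longlonglongrightarrow> ?a"
  proof (rule tendsto_sandwich[OF _ _ lim lim2]; rule always_eventually; rule allI)
    fix k
    have tk: "0 < t k" using t(1)[of k] by simp
    have "ln (G k) \<le> G k - 1" by (rule ln_le_minus_one[OF G(1)])
    then show "(1 - G k) / t k \<le> - ln (G k) / t k" using tk by (intro divide_right_mono) auto
    have "ln (1 / G k) \<le> 1 / G k - 1" using G(1)[of k] by (intro ln_le_minus_one) simp
    then have "- ln (G k) \<le> (1 - G k) / G k" using G(1)[of k] by (simp add: ln_div diff_divide_distrib)
    then have "- ln (G k) / t k \<le> (1 - G k) / G k / t k" using tk by (intro divide_right_mono) auto
    then show "- ln (G k) / t k \<le> (1 - G k) / t k / G k" by (simp add: divide_divide_eq_left mult.commute)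
  qed
  then show ?thesis by (simp only: G_def)
qed

text \<open>An average of deviations from \<open>a\<close> cannot exceed all of them in modulus. So
  some argument \<open>q m * t\<close> carries a deviation at least as large as that at
  \<open>t\<close>. Iterating from 1 gives arguments tending to 0 along which the deviation does not
  decrease, although it tends to 0.\<close>

lemma averaging_fixpoint:
  fixes \<psi> :: "real \<Rightarrow> real" and n :: nat and q :: "nat \<Rightarrow> real"
  assumes n: "1 \<le> n" and q: "\<And>m. m \<in> {1..n} \<Longrightarrow> 0 < q m \<and> q m < 1" "(\<Sum>m=1..n. q m) = 1"
    and avg: "\<And>t. 0 < t \<Longrightarrow> t \<le> 1 \<Longrightarrow> \<psi> t = (\<Sum>m=1..n. q m * \<psi> (q m * t))"
    and lim: "\<And>t. (\<And>k::nat. 0 < t k \<and> t k \<le> 1) \<Longrightarrow> t \<longlonglongrightarrow> 0 \<Longrightarrow> (\<lambda>k. \<psi> (t k)) \<longlonglongrightarrow> a"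
  shows "\<psi> 1 = a"
proof -
  \<comment> \<open>The largest weight is below 1 and bounds the factor by which every step shrinks
    the argument.\<close>
  define Q where "Q = Max (q ` {1..n})"
  have "Q \<in> q ` {1..n}" unfolding Q_def using n by (intro Max_in) auto
  then have Q: "0 < Q" "Q < 1" using q(1) by auto
  have qQ: "q m \<le> Q" if "m \<in> {1..n}" for m unfolding Q_def using that by (intro Max_ge) auto
  have "\<exists>t'. 0 < t' \<and> t' \<le> Q * t \<and> \<bar>\<psi> t - a\<bar> \<le> \<bar>\<psi> t' - a\<bar>" if t: "0 < t" "t \<le> 1" for t
  proof (rule ccontr)
    assume no: "\<not> ?thesis"
    have less: "\<bar>\<psi> (q m * t) - a\<bar> < \<bar>\<psi> t - a\<bar>" if m: "m \<in> {1..n}" for m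
    proof (rule ccontr)
      assume "\<not> \<bar>\<psi> (q m * t) - a\<bar> < \<bar>\<psi> t - a\<bar>"
      moreover have "0 < q m * t" "q m * t \<le> Q * t" using q(1)[OF m] qQ[OF m] t by (auto intro: mult_right_mono)
      ultimately show False using no by (metis not_le)
    qed
    \<comment> \<open>As the weights sum to 1, \<open>a\<close> is its own average and can be
      subtracted inside the sum.\<close>
    have "\<psi> t - a = (\<Sum>m=1..n. q m * (\<psi> (q m * t) - a))"
      using avg[OF t] q(2) by (simp add: right_diff_distrib sum_subtractf sum_distrib_right[symmetric])
    then have "\<bar>\<psi> t - a\<bar> \<le> (\<Sum>m=1..n. \<bar>q m * (\<psi> (q m * t) - a)\<bar>)" by (simp only: sum_abs)
    also have "\<dots> < (\<Sum>m=1..n. q m * \<bar>\<psi> t - a\<bar>)"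
    proof (rule sum_strict_mono)
      show "\<bar>q m * (\<psi> (q m * t) - a)\<bar> < q m * \<bar>\<psi> t - a\<bar>" if "m \<in> {1..n}" for m
        using less[OF that] q(1)[OF that] by (simp add: abs_mult)
    qed (use n in auto)
    also have "\<dots> = \<bar>\<psi> t - a\<bar>" using q(2) by (simp add: sum_distrib_right[symmetric])
    finally show False by simp
  qed
  then obtain step where step: "\<And>t. 0 < t \<Longrightarrow> t \<le> 1 \<Longrightarrow> 0 < step t \<and> step t \<le> Q * t \<and> \<bar>\<psi> t - a\<bar> \<le> \<bar>\<psi> (step t) - a\<bar>"
    by metis
  define t where "t k = (step ^^ k) 1" for k
  have t: "0 < t k \<and> t k \<le> Q ^ k \<and> \<bar>\<psi> 1 - a\<bar> \<le> \<bar>\<psi> (t k) - a\<bar>" for k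
  proof (induction k)
    case (Suc k)
    have "Q ^ k \<le> 1" using Q by (intro power_le_one) auto
    then have "t k \<le> 1" using Suc by linarith
    from step[OF _ this] Suc have s: "0 < t (Suc k)" "t (Suc k) \<le> Q * t k" "\<bar>\<psi> (t k) - a\<bar> \<le> \<bar>\<psi> (t (Suc k)) - a\<bar>"
      by (auto simp: t_def)
    have "Q * t k \<le> Q * Q ^ k" using Suc Q by (intro mult_left_mono) auto
    then show ?case using s Suc by auto
  qed (simp add: t_def)
  have t1: "0 < t k \<and> t k \<le> 1" for k
    using t[of k] power_le_one[of Q k] Q by auto
  have "(\<lambda>k. Q ^ k) \<longlonglongrightarrow> 0" using Q by (intro LIMSEQ_realpow_zero) auto
  then have "t \<longlonglongrightarrow> 0"
    by (rule tendsto_sandwich[OF _ _ tendsto_const, rotated 2]) (use t in \<open>auto intro: always_eventually less_imp_le\<close>)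
  from lim[OF t1 this] have "(\<lambda>k. \<bar>\<psi> (t k) - a\<bar>) \<longlonglongrightarrow> \<bar>a - a\<bar>" by (intro tendsto_intros)
  then have "\<bar>\<psi> 1 - a\<bar> \<le> \<bar>a - a\<bar>"
    by (rule LIMSEQ_le_const) (use t in blast)
  then show ?thesis by simp
qed

theorem theorem2:
  fixes P :: "'a::polish_space measure measure" and n :: nat and q :: "nat \<Rightarrow> real"
  assumes "point_process P" and "first_order P"
    and "2 \<le> n"
    and "\<And>m. m \<in> {1..n} \<Longrightarrow> q m \<in> {0<..<1}"
    and "(\<Sum>m=1..n. q m) = 1"
  shows "poisson_process P \<longleftrightarrow>
    multi_splitting n q P = PiM {1..n} (\<lambda>m. thinning (q m) P)"
proof -
  note P = assms(1) and fo = assms(2) and q = assms(4,5)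
  have n: "1 \<le> n" using assms(3) by simp
  have qb: "0 < q m" "0 \<le> q m" "q m \<le> 1" if "m \<in> {1..n}" for m using q(1)[OF that] by auto
  let ?L = "\<lambda>f. \<integral>\<mu>. laplace f \<mu> \<partial>P"
  have mixt: "laplace_test (mix (q i) g (\<lambda>_. 0))" if "i \<in> {1..n}" "laplace_test g" for i and g :: "'a \<Rightarrow> real"
    by (rule laplace_test_mix[OF qb(2,3)[OF that(1)] that(2) laplace_test_zero])
  have left: "(\<integral>\<^sup>+\<kappa>. ennreal (exp (- (\<Sum>i\<in>{1..n}. \<integral>x. f i x \<partial>\<kappa> i))) \<partial>multi_splitting n q P) = ennreal (?L (splitting_mix n q f))"
    if f: "\<And>i. laplace_test (f i)" for f :: "nat \<Rightarrow> 'a \<Rightarrow> real"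
    by (rule trans[OF multi_splitting_laplace[OF P n q f] nn_integral_laplace[OF P laplace_test_splitting_mix[OF n qb(1) q(2) f]]])
  have right: "(\<integral>\<^sup>+\<kappa>. ennreal (exp (- (\<Sum>i\<in>{1..n}. \<integral>x. f i x \<partial>\<kappa> i))) \<partial>PiM {1..n} (\<lambda>m. thinning (q m) P))
      = ennreal (\<Prod>i\<in>{1..n}. ?L (mix (q i) (f i) (\<lambda>_. 0)))"
    if f: "\<And>i. laplace_test (f i)" for f :: "nat \<Rightarrow> 'a \<Rightarrow> real"
  proof -
    have "(\<integral>\<^sup>+\<kappa>. ennreal (exp (- (\<Sum>i\<in>{1..n}. \<integral>x. f i x \<partial>\<kappa> i))) \<partial>PiM {1..n} (\<lambda>m. thinning (q m) P))
      = (\<Prod>i\<in>{1..n}. \<integral>\<^sup>+\<mu>. ennreal (laplace (mix (q i) (f i) (\<lambda>_. 0)) \<mu>) \<partial>P)"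
      using product_thinning_laplace[where f=f and q=q, OF P n q f] .
    also have "\<dots> = (\<Prod>i\<in>{1..n}. ennreal (?L (mix (q i) (f i) (\<lambda>_. 0))))"
      by (rule prod.cong[OF refl]) (rule nn_integral_laplace[OF P mixt[OF _ f]])
    also have "\<dots> = ennreal (\<Prod>i\<in>{1..n}. ?L (mix (q i) (f i) (\<lambda>_. 0)))"
      by (rule prod_ennreal) (rule less_imp_le[OF laplace_functional_bounds(1)[OF P mixt[OF _ f]]])
    finally show ?thesis .
  qed
  show ?thesis
  proof
    assume "poisson_process P"
    then obtain \<rho> where \<rho>: "\<rho> \<in> locally_finite_measures" "has_poisson_law \<rho> P" by (auto simp: poisson_process_def)
    have L: "?L f = exp (- (\<integral>x. 1 - exp (- f x) \<partial>\<rho>))" if "laplace_test f" for f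
      using \<rho>(2) that by (simp add: has_poisson_law_def laplace_test_def bounded_support_fun_def)
    show "multi_splitting n q P = PiM {1..n} (\<lambda>m. thinning (q m) P)"
    proof (rule joint_laplace_unique[OF finite_atLeastAtMost multi_splitting_prob_space(1)[OF P n q] product_thinning_prob_space(1)[OF P n q]
          multi_splitting_prob_space(2)[OF P n q] product_thinning_prob_space(2)[OF P n q]])
      fix f :: "nat \<Rightarrow> 'a \<Rightarrow> real" assume f: "\<And>i. laplace_test (f i)"
      have int: "integrable \<rho> (\<lambda>x. 1 - exp (- f i x))" for i
        by (rule integrable_laplace_test[OF laplace_test_one_minus_exp[OF f] \<rho>(1)])
      \<comment> \<open>Passing to \<open>1 - exp (- f)\<close> makes the splitting linear: the
        exponent of the Poisson functional becomes a sum over the collections, hence the functional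
        a product.\<close>
      have pt: "1 - exp (- splitting_mix n q f x) = (\<Sum>i=1..n. q i * (1 - exp (- f i x)))" for x
      proof -
        have "exp (- splitting_mix n q f x) = (\<Sum>i=1..n. q i * exp (- f i x))"
          by (rule exp_splitting_mix[OF n qb(1) q(2)])
        then show ?thesis by (simp only: right_diff_distrib sum_subtractf q(2) mult_1_right)
      qed
      have "?L (splitting_mix n q f) = exp (- (\<integral>x. 1 - exp (- splitting_mix n q f x) \<partial>\<rho>))"
        by (rule L) (rule laplace_test_splitting_mix[OF n qb(1) q(2) f])
      also have "\<dots> = exp (- (\<integral>x. (\<Sum>i=1..n. q i * (1 - exp (- f i x))) \<partial>\<rho>))"
        by (simp only: pt)
      also have "(\<integral>x. (\<Sum>i=1..n. q i * (1 - exp (- f i x))) \<partial>\<rho>) = (\<Sum>i=1..n. q i * (\<integral>x. 1 - exp (- f i x) \<partial>\<rho>))"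
        using int by (subst Bochner_Integration.integral_sum) simp_all
      also have "exp (- \<dots>) = (\<Prod>i=1..n. exp (- (q i * (\<integral>x. 1 - exp (- f i x) \<partial>\<rho>))))"
        by (simp only: sum_negf[symmetric] exp_sum[OF finite_atLeastAtMost])
      also have "\<dots> = (\<Prod>i=1..n. ?L (mix (q i) (f i) (\<lambda>_. 0)))"
      proof (rule prod.cong[OF refl])
        fix i assume i: "i \<in> {1..n}"
        have "1 - exp (- mix (q i) (f i) (\<lambda>_. 0) x) = q i * (1 - exp (- f i x))" for x
          unfolding exp_mix[OF qb(2,3)[OF i]] by (simp add: algebra_simps)
        then show "exp (- (q i * (\<integral>x. 1 - exp (- f i x) \<partial>\<rho>))) = ?L (mix (q i) (f i) (\<lambda>_. 0))"
          unfolding L[OF mixt[OF i f]] by (simp only: integral_mult_right_zero)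
      qed
      finally show "(\<integral>\<^sup>+\<kappa>. ennreal (exp (- (\<Sum>i\<in>{1..n}. \<integral>x. f i x \<partial>\<kappa> i))) \<partial>multi_splitting n q P)
        = (\<integral>\<^sup>+\<kappa>. ennreal (exp (- (\<Sum>i\<in>{1..n}. \<integral>x. f i x \<partial>\<kappa> i))) \<partial>PiM {1..n} (\<lambda>m. thinning (q m) P))"
        unfolding left[OF f] right[OF f] by (simp only:)
    qed
  next
    assume eq: "multi_splitting n q P = PiM {1..n} (\<lambda>m. thinning (q m) P)"
    have fact: "?L f = (\<Prod>i\<in>{1..n}. ?L (mix (q i) f (\<lambda>_. 0)))" if f: "laplace_test f" for f
    proof -
      \<comment> \<open>With one and the same function on all collections the splitting is
        invisible, since the weights sum to 1.\<close>
      have "splitting_mix n q (\<lambda>_. f) x = f x" for x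
        using exp_splitting_mix[OF n qb(1) q(2), of "\<lambda>_. f" x] q(2)
        by (simp add: sum_distrib_right[symmetric] del: One_nat_def)
      then have sm: "splitting_mix n q (\<lambda>_. f) = f" by (rule ext)
      have "ennreal (?L f) = ennreal (\<Prod>i\<in>{1..n}. ?L (mix (q i) f (\<lambda>_. 0)))"
        using left[of "\<lambda>_. f", OF f] right[of "\<lambda>_. f", OF f] unfolding eq sm by (rule trans[OF sym])
      moreover have "0 \<le> (\<Prod>i\<in>{1..n}. ?L (mix (q i) f (\<lambda>_. 0)))"
        by (rule prod_nonneg) (rule less_imp_le[OF laplace_functional_bounds(1)[OF P mixt[OF _ f]]])
      ultimately show ?thesis using less_imp_le[OF laplace_functional_bounds(1)[OF P f]] by (simp only: ennreal_inj)
    qed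
    \<comment> \<open>The intensity of a Poisson process is its first moment measure, so this is the
      only candidate.\<close>
    have "has_poisson_law (first_moment P) P"
      unfolding has_poisson_law_def
    proof (intro conjI allI impI P)
      fix f :: "'a \<Rightarrow> real"
      assume "f \<in> borel_measurable borel" "\<forall>x. 0 \<le> f x" "bounded (range f)" "bounded {x. f x \<noteq> 0}"
      then have f: "laplace_test f" by (simp add: laplace_test_def bounded_support_fun_def)
      define G where "G t = ?L (mix t f (\<lambda>_. 0))" for t
      have ft: "laplace_test (mix t f (\<lambda>_. 0))" if "0 < t" "t \<le> 1" for t
        using that by (intro laplace_test_mix f laplace_test_zero) auto
      have G: "0 < G t" if "0 < t" "t \<le> 1" for t
        unfolding G_def by (rule laplace_functional_bounds(1)[OF P ft[OF that]])
      have Gq: "G t = (\<Prod>m=1..n. G (q m * t))" if t: "0 < t" "t \<le> 1" for t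
        unfolding G_def fact[OF ft[OF t]]
      proof (rule prod.cong[OF refl])
        fix m assume m: "m \<in> {1..n}"
        \<comment> \<open>Successive thinnings multiply their retention probabilities.\<close>
        have "mix (q m) (mix t f (\<lambda>_. 0)) (\<lambda>_. 0) = mix (q m * t) f (\<lambda>_. 0)"
          unfolding mix_def[of "q m"] mix_def[of "q m * t"] using t
          by (intro ext) (simp add: exp_mix algebra_simps)
        then show "?L (mix (q m) (mix t f (\<lambda>_. 0)) (\<lambda>_. 0)) = ?L (mix (q m * t) f (\<lambda>_. 0))" by (simp only:)
      qed
      define \<psi> where "\<psi> t = - ln (G t) / t" for t
      have "\<psi> 1 = (\<integral>x. 1 - exp (- f x) \<partial>first_moment P)"
      proof (rule averaging_fixpoint[OF n _ q(2)])
        show "0 < q m \<and> q m < 1" if "m \<in> {1..n}" for m using q(1)[OF that] by simp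
        show "(\<lambda>k. \<psi> (t k)) \<longlonglongrightarrow> (\<integral>x. 1 - exp (- f x) \<partial>first_moment P)" if "\<And>k::nat. 0 < t k \<and> t k \<le> 1" "t \<longlonglongrightarrow> 0" for t
          unfolding \<psi>_def G_def by (rule laplace_functional_derivative[OF P fo f that])
        fix t :: real assume t: "0 < t" "t \<le> 1"
        have qt: "0 < q m * t" "q m * t \<le> 1" if "m \<in> {1..n}" for m
          using qb[OF that] t by (auto intro: mult_le_one)
        have "ln (G t) = (\<Sum>m=1..n. ln (G (q m * t)))"
          unfolding Gq[OF t]
        proof (rule ln_prod)
          show "G (q m * t) \<noteq> 0" if "m \<in> {1..n}" for m using G[OF qt[OF that]] by simp
        qed simp
        then have "\<psi> t = (\<Sum>m=1..n. - ln (G (q m * t)) / t)"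
          by (simp only: \<psi>_def sum_negf[symmetric] sum_divide_distrib)
        also have "\<dots> = (\<Sum>m=1..n. q m * \<psi> (q m * t))"
        proof (rule sum.cong[OF refl])
          fix m assume "m \<in> {1..n}"
          \<comment> \<open>The factor \<open>q m\<close> compensates for dividing by
            \<open>q m * t\<close> instead of \<open>t\<close>; this turns the sum of logarithms
            into an average with weights \<open>q m\<close>.\<close>
          then show "- ln (G (q m * t)) / t = q m * \<psi> (q m * t)" using qb(1)[of m] t by (simp add: \<psi>_def)
        qed
        finally show "\<psi> t = (\<Sum>m=1..n. q m * \<psi> (q m * t))" .
      qed
      moreover have "G 1 = ?L f"
      proof -
        have "mix 1 f (\<lambda>_. 0) = f" by (rule ext) (simp add: mix_def)
        then show ?thesis by (simp only: G_def)
      qed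
      ultimately have "ln (?L f) = - (\<integral>x. 1 - exp (- f x) \<partial>first_moment P)" by (simp add: \<psi>_def)
      then show "?L f = exp (- (\<integral>x. 1 - exp (- f x) \<partial>first_moment P))"
        by (metis exp_ln laplace_functional_bounds(1)[OF P f])
    qed
    then show "poisson_process P" using fo by (auto simp: poisson_process_def first_order_def)
  qed
qed

end
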